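(* Let $\phi^n,U^n,u^n$ and $\phi^{n-1},U^{n-1},u^{n-1}$ be known (the numerical solution at the two previous time steps), and put $\phi^{\star}=2\phi^n-\phi^{n-1}$ and $Z^{\star}=Z(\phi^{\star})$. Consider the linear variational problem with unknowns $(\phi,u)\in (H^1_{per},H^1_{per})(\Omega)$: $$\frac{3}{2\delta t}(\tau(\phi^{\star})\phi,\psi)+\frac{S_1}{\epsilon^2}(\phi,\psi)+S_2(\nabla\phi,\nabla\psi)+\frac12(Z^{\star}\phi,Z^{\star}\psi)+\frac{\lambda}{\epsilon}(p'(\phi^{\star})u,\psi)=(f_1,\psi),$$ $$\frac{\lambda}{\epsilon K}(u,v)+\frac{2\delta t}{3}\frac{\lambda D}{\epsilon K}(\nabla u,\nabla v)-\frac{\lambda}{\epsilon}(p'(\phi^{\star})\phi,v)=(f_2,v),$$ for any $(\psi,v)\in (H^1_{per},H^1_{per})(\Omega)$, where $f_1,f_2$ include only terms from the previous time steps. This system admits a unique solution $(\phi,u)\in (H^1_{per},H^1_{per})(\Omega)$.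
   Context: $\Omega$ is a smooth, open, bounded, connected domain in $\mathbb{R}^d$, $d=2,3$, and periodic boundary conditions are considered; $H^1_{per}(\Omega)=\{\phi\text{ is periodic},\ \phi\in H^1(\Omega)\}$; $(f,g)=\int_\Omega fg\,d\boldsymbol{x}$ is the $L^2$ inner product. Here $\delta t>0$ is the time step, $\epsilon,\lambda,K>0$ are model parameters, $D>0$ is the diffusion rate of the temperature $u$, and $S_1,S_2>0$ are stabilizing parameters. The mobility $\tau(\cdot)>0$ is a constant or a function of $\phi$. The function $p$ has two common choices: $p(\phi)=\frac15\phi^5-\frac23\phi^3+\phi$ with $p'(\phi)=(1-\phi^2)^2$, or $p(\phi)=\phi-\frac13\phi^3$ with $p'(\phi)=1-\phi^2$. With $F(\phi)=(\phi^2-1)^2$, $f(\phi)=\frac14F'(\phi)=\phi^3-\phi$, and $B$ a constant ensuring that the radicand below is positive, set $$Z(\phi)=\frac{-\nabla\cdot\big(\kappa^2(\nabla\phi)\nabla\phi+\kappa(\nabla\phi)|\nabla\phi|^2\boldsymbol{H}(\phi)\big)+\frac{1}{\epsilon^2}f(\phi)}{\sqrt{\frac12|\kappa(\nabla\phi)\nabla\phi|^2+\frac{1}{4\epsilon^2}F(\phi)+B}}.$$ Here $\kappa(\nabla\phi)$ is the anisotropy coefficient. In 2D it is usually $\kappa(\nabla\phi)=1+\epsilon_4\cos(m\Theta)$ with $\Theta=\arctan(\phi_y/\phi_x)$, $m$ the number of folds and $\epsilon_4$ the anisotropy strength; for $m=4$ this is $(1-3\epsilon_4)\big(1+\frac{4\epsilon_4}{1-3\epsilon_4}\frac{\phi_x^4+\phi_y^4}{|\nabla\phi|^4}\big)$.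 In 3D (fourfold), $\kappa(\nabla\phi)=(1-3\epsilon_4)\big(1+\frac{4\epsilon_4}{1-3\epsilon_4}\frac{\phi_x^4+\phi_y^4+\phi_z^4}{|\nabla\phi|^4}\big)$. $\boldsymbol{H}(\phi)$ is the variational derivative of $\kappa(\nabla\phi)$, i.e. the gradient of $\kappa$ with respect to its argument $\nabla\phi$; for the fourfold case in 2D, $\boldsymbol{H}(\phi)=\frac{16\epsilon_4}{|\nabla\phi|^6}\big(\phi_x(\phi_x^2\phi_y^2-\phi_y^4),\ \phi_y(\phi_x^2\phi_y^2-\phi_x^4)\big)$, and in 3D $\boldsymbol{H}(\phi)=\frac{16\epsilon_4}{|\nabla\phi|^6}\big(\phi_x(\phi_x^2\phi_y^2+\phi_x^2\phi_z^2-\phi_y^4-\phi_z^4),\ \phi_y(\phi_y^2\phi_z^2+\phi_x^2\phi_y^2-\phi_x^4-\phi_z^4),\ \phi_z(\phi_x^2\phi_z^2+\phi_y^2\phi_z^2-\phi_x^4-\phi_y^4)\big)$. The variational problem is the weak form of one step (unknowns $\phi=\phi^{n+1}$, $u=u^{n+1}$) of the time-marching scheme $$\tau(\phi^{\star})\frac{3\phi^{n+1}-4\phi^n+\phi^{n-1}}{2\delta t}+\frac{S_1}{\epsilon^2}(\phi^{n+1}-2\phi^n+\phi^{n-1})-S_2\Delta(\phi^{n+1}-2\phi^n+\phi^{n-1})=-Z^{\star}U^{n+1}-\frac{\lambda}{\epsilon}p'(\phi^{\star})u^{n+1},$$ $$3U^{n+1}-4U^n+U^{n-1}=\frac12Z^{\star}(3\phi^{n+1}-4\phi^n+\phi^{n-1}),$$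 $$\frac{3u^{n+1}-4u^n+u^{n-1}}{2\delta t}-D\Delta u^{n+1}=Kp'(\phi^{\star})\frac{3\phi^{n+1}-4\phi^n+\phi^{n-1}}{2\delta t},$$ after eliminating $U^{n+1}=\frac12Z^{\star}\phi^{n+1}+A_1$ with $A_1=\frac{4U^n-U^{n-1}}{3}-\frac12Z^{\star}\frac{4\phi^n-\phi^{n-1}}{3}$ and multiplying the last equation by $\frac{2\delta t}{3}\frac{\lambda}{\epsilon K}$. The resulting right-hand sides are $$f_1=\tau(\phi^{\star})\frac{4\phi^n-\phi^{n-1}}{2\delta t}+\frac{S_1}{\epsilon^2}(2\phi^n-\phi^{n-1})-S_2\Delta(2\phi^n-\phi^{n-1})-Z^{\star}A_1,$$ $$f_2=\frac{\lambda}{\epsilon K}\frac{4u^n-u^{n-1}}{3}-\frac{\lambda}{\epsilon}p'(\phi^{\star})\frac{4\phi^n-\phi^{n-1}}{3}.$$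
   Formalization: So that f_1, Z* and all terms make sense, it is assumed that φ^n, φ^{n-1} lie in H^2_per, U^n, U^{n-1} in L^2, u^n, u^{n-1} in H^1_per, τ is continuous, the flux in Z* has a weak divergence, and Z*w is in L^2 for each w in H^1_per; Ω is a periodic box. *)

theory Defs
  imports "HOL-Analysis.Analysis"
begin

section \<open>Smooth functions and weak derivatives on Euclidean space\<close>

definition grad :: "(real^'n \<Rightarrow> real) \<Rightarrow> real^'n \<Rightarrow> real^'n" where
  "grad f x = (\<chi> i. frechet_derivative f (at x) (axis i 1))"

primrec Ck :: "nat \<Rightarrow> (real^'n \<Rightarrow> real) \<Rightarrow> bool" where
  "Ck 0 f \<longleftrightarrow> continuous_on UNIV f"
| "Ck (Suc k) f \<longleftrightarrow> f differentiable_on UNIV \<and> (\<forall>i. Ck k (\<lambda>x. grad f x $ i))"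

definition test_function :: "(real^'n \<Rightarrow> real) \<Rightarrow> bool" where
  "test_function \<psi> \<longleftrightarrow> (\<forall>k. Ck k \<psi>) \<and> compact (closure {x. \<psi> x \<noteq> 0})"

definition locally_integrable :: "(real^'n \<Rightarrow> 'b::euclidean_space) \<Rightarrow> bool" where
  "locally_integrable f \<longleftrightarrow> (\<forall>C. compact C \<longrightarrow> f absolutely_integrable_on C)"

definition is_weak_grad :: "(real^'n \<Rightarrow> real) \<Rightarrow> (real^'n \<Rightarrow> real^'n) \<Rightarrow> bool" where
  "is_weak_grad \<phi> g \<longleftrightarrow> locally_integrable \<phi> \<and> locally_integrable g \<and>
     (\<forall>\<psi>. test_function \<psi> \<longrightarrow>
        (\<integral>x. \<phi> x *\<^sub>R grad \<psi> x \<partial>lebesgue) = - (\<integral>x. \<psi> x *\<^sub>R g x \<partial>lebesgue))"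

definition is_weak_div :: "(real^'n \<Rightarrow> real^'n) \<Rightarrow> (real^'n \<Rightarrow> real) \<Rightarrow> bool" where
  "is_weak_div w q \<longleftrightarrow> locally_integrable w \<and> locally_integrable q \<and>
     (\<forall>\<psi>. test_function \<psi> \<longrightarrow>
        (\<integral>x. w x \<bullet> grad \<psi> x \<partial>lebesgue) = - (\<integral>x. q x * \<psi> x \<partial>lebesgue))"

text \<open>Weak gradient and weak divergence are unique up to a null set; the operators below
  pick one version, and are only meaningful when a version exists.\<close>

definition wgrad :: "(real^'n \<Rightarrow> real) \<Rightarrow> real^'n \<Rightarrow> real^'n" where
  "wgrad \<phi> = (SOME g. is_weak_grad \<phi> g)"

definition wdiv :: "(real^'n \<Rightarrow> real^'n) \<Rightarrow> real^'n \<Rightarrow> real" where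
  "wdiv w = (SOME q. is_weak_div w q)"

definition wlaplacian :: "(real^'n \<Rightarrow> real) \<Rightarrow> real^'n \<Rightarrow> real" where
  "wlaplacian \<phi> = wdiv (wgrad \<phi>)"

section \<open>Square integrable functions and periodic Sobolev spaces\<close>

definition L2 :: "(real^'n) set \<Rightarrow> (real^'n \<Rightarrow> 'b::euclidean_space) set" where
  "L2 \<Omega> = {f. f \<in> borel_measurable (lebesgue_on \<Omega>) \<and>
               integrable (lebesgue_on \<Omega>) (\<lambda>x. (norm (f x))\<^sup>2)}"

definition ip :: "(real^'n) set \<Rightarrow> (real^'n \<Rightarrow> 'b::euclidean_space) \<Rightarrow> (real^'n \<Rightarrow> 'b) \<Rightarrow> real" where
  "ip \<Omega> f g = (\<integral>x. f x \<bullet> g x \<partial>lebesgue_on \<Omega>)"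

definition periodic :: "real^'n \<Rightarrow> (real^'n \<Rightarrow> real) \<Rightarrow> bool" where
  "periodic l f \<longleftrightarrow> (\<forall>i. AE x in lebesgue. f (x + (l $ i) *\<^sub>R axis i 1) = f x)"

text \<open>The period cell is \<open>\<Omega> = box a b\<close>, with period \<open>b $ i - a $ i\<close> in the \<open>i\<close>-th coordinate.
  Elements of \<open>H1per\<close> are functions on the whole space, and the weak gradient is tested against
  test functions on the whole space, not only on those supported in \<open>\<Omega>\<close>: every function on
  \<open>\<Omega>\<close> has a periodic extension, and it is the absence of a singular part of the derivative on
  the faces of the cells that expresses that the traces on opposite faces of \<open>\<Omega>\<close> agree.\<close>

definition H1per :: "real^'n \<Rightarrow> real^'n \<Rightarrow> (real^'n \<Rightarrow> real) set" where
  "H1per a b = {\<phi>. periodic (b - a) \<phi> \<and> \<phi> \<in> L2 (box a b) \<and>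
                   (\<exists>g. is_weak_grad \<phi> g \<and> g \<in> L2 (box a b))}"

definition H2per :: "real^'n \<Rightarrow> real^'n \<Rightarrow> (real^'n \<Rightarrow> real) set" where
  "H2per a b = {\<phi> \<in> H1per a b. \<forall>i. (\<lambda>x. wgrad \<phi> x $ i) \<in> H1per a b}"

section \<open>The anisotropic nonlinearity\<close>

definition well_F :: "real \<Rightarrow> real" where
  "well_F s = (s\<^sup>2 - 1)\<^sup>2"

definition well_f :: "real \<Rightarrow> real" where
  "well_f s = s ^ 3 - s"

lemma well_f_eq_deriv: "well_f s = deriv well_F s / 4"
proof -
  have "(well_F has_real_derivative 4 * well_f s) (at s)"
    unfolding well_F_def[abs_def] well_f_def
    by (auto intro!: derivative_eq_intros simp: power2_eq_square power3_eq_cube algebra_simps)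
  then show ?thesis
    by (simp add: DERIV_imp_deriv)
qed

text \<open>Here \<open>\<kappa>\<close> and \<open>H\<close> are functions of \<open>\<xi> = \<nabla>\<phi>\<close>, with \<open>H\<close> the gradient of \<open>\<kappa>\<close>.  The usual
  \<open>\<kappa>\<close> is singular at \<open>\<xi> = 0\<close>, but the flux vanishes there whatever the values of
  \<open>\<kappa> 0\<close> and \<open>H 0\<close>.\<close>

definition flux :: "(real^'n \<Rightarrow> real) \<Rightarrow> (real^'n \<Rightarrow> real^'n) \<Rightarrow> real^'n \<Rightarrow> real^'n" where
  "flux \<kappa> H \<xi> = (\<kappa> \<xi>)\<^sup>2 *\<^sub>R \<xi> + (\<kappa> \<xi> * (norm \<xi>)\<^sup>2) *\<^sub>R H \<xi>"

definition radicand ::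
  "(real^'n \<Rightarrow> real) \<Rightarrow> real \<Rightarrow> real \<Rightarrow> (real^'n \<Rightarrow> real) \<Rightarrow> real^'n \<Rightarrow> real" where
  "radicand \<kappa> \<epsilon> B \<phi> x =
     1/2 * (norm (\<kappa> (wgrad \<phi> x) *\<^sub>R wgrad \<phi> x))\<^sup>2 + 1 / (4 * \<epsilon>\<^sup>2) * well_F (\<phi> x) + B"

definition Z_aniso :: "(real^'n \<Rightarrow> real) \<Rightarrow> (real^'n \<Rightarrow> real^'n) \<Rightarrow> real \<Rightarrow> real \<Rightarrow>
    (real^'n \<Rightarrow> real) \<Rightarrow> real^'n \<Rightarrow> real" where
  "Z_aniso \<kappa> H \<epsilon> B \<phi> x =
     (- wdiv (\<lambda>y. flux \<kappa> H (wgrad \<phi> y)) x + 1 / \<epsilon>\<^sup>2 * well_f (\<phi> x)) / sqrt (radicand \<kappa> \<epsilon> B \<phi> x)"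

section \<open>The variational problem\<close>

text \<open>The functions \<open>\<tau>s\<close>, \<open>Zs\<close>, \<open>dps\<close> are the coefficients \<open>\<tau>(\<phi>\<^sup>\<star>)\<close>, \<open>Z\<^sup>\<star>\<close>, \<open>p'(\<phi>\<^sup>\<star>)\<close>.\<close>

definition solves_variational_problem ::
  "real^'n \<Rightarrow> real^'n \<Rightarrow> real \<Rightarrow> real \<Rightarrow> real \<Rightarrow> real \<Rightarrow> real \<Rightarrow> real \<Rightarrow> real \<Rightarrow>
   (real^'n \<Rightarrow> real) \<Rightarrow> (real^'n \<Rightarrow> real) \<Rightarrow> (real^'n \<Rightarrow> real) \<Rightarrow>
   (real^'n \<Rightarrow> real) \<Rightarrow> (real^'n \<Rightarrow> real) \<Rightarrow>
   (real^'n \<Rightarrow> real) \<Rightarrow> (real^'n \<Rightarrow> real) \<Rightarrow> bool" where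
  "solves_variational_problem a b \<delta>t \<epsilon> lam K D S\<^sub>1 S\<^sub>2 \<tau>s Zs dps f\<^sub>1 f\<^sub>2 \<phi> u \<longleftrightarrow>
     (let \<Omega> = box a b in
      \<phi> \<in> H1per a b \<and> u \<in> H1per a b \<and>
      (\<forall>\<psi> \<in> H1per a b. \<forall>v \<in> H1per a b.
         3 / (2 * \<delta>t) * ip \<Omega> (\<lambda>x. \<tau>s x * \<phi> x) \<psi>
         + S\<^sub>1 / \<epsilon>\<^sup>2 * ip \<Omega> \<phi> \<psi>
         + S\<^sub>2 * ip \<Omega> (wgrad \<phi>) (wgrad \<psi>)
         + 1/2 * ip \<Omega> (\<lambda>x. Zs x * \<phi> x) (\<lambda>x. Zs x * \<psi> x)
         + lam / \<epsilon> * ip \<Omega> (\<lambda>x. dps x * u x) \<psi>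
         = ip \<Omega> f\<^sub>1 \<psi>
       \<and>
         lam / (\<epsilon> * K) * ip \<Omega> u v
         + (2 * \<delta>t / 3) * (lam * D / (\<epsilon> * K)) * ip \<Omega> (wgrad u) (wgrad v)
         - lam / \<epsilon> * ip \<Omega> (\<lambda>x. dps x * \<phi> x) v
         = ip \<Omega> f\<^sub>2 v))"

end

(*
  Writing S for the solution operator of the second equation, u = u0 + S phi, the coupling
  term becomes lam/eps (p'(phi_s) S phi, psi) = g(S phi, S psi), where g is the inner product of
  the second equation. It is symmetric and nonnegative, so both equations are solved by the
  Riesz representation theorem on H1per, which is complete for each of the two energies.

  The forms are defined on all of H1per because p'(phi_s) and tau(phi_s) are bounded: for d <= 3 a
  function phi with two weak derivatives in L2 is bounded. To see this, average phi against
  l^d W(l (y - x)) for a bump W. The l-derivative of this kernel is a divergence, so the average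
  A_l(phi; W) satisfies d/dl A_l(phi; W) = - l^(-2) sum_i A_l(d_i phi; z_i W). Since averages of L2
  functions are O(l^(d/2)), those of first derivatives are O(l^(1/2)), and those of phi stay
  bounded; at almost every point they converge to a multiple of phi. The same convergence shows
  that weak gradients and divergences are unique.
*)

theory Submission
  imports Defs
begin

text \<open>Elements of \<open>H1per\<close> are functions, not classes modulo null sets, so the
  forms are only semidefinite. Representation is therefore proved for semi-inner products, and
  uniqueness means equality almost everywhere. The coefficient \<open>Zs\<close> is known only to
  carry \<open>H1per\<close> into \<open>L2\<close>: no bound by the H1 norm is given, and
  \<open>Zs * A\<close> in the right-hand side is not known to be in \<open>L2\<close>. Both
  difficulties are met by keeping the term with \<open>Zs\<close> inside the energy. The energy then
  bounds the functional psi -> (A, Zs psi), and along an energy-Cauchy sequence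
  \<open>Zs * U n\<close> is Cauchy in \<open>L2\<close>; its limit is identified along a
  subsequence that converges almost everywhere. The dimension enters through exponents. Passing from
  the averages of a gradient to those of the function means integrating l^(-2) times a power of l,
  which lowers the power by one up to constants. Two passages lead from l^(d/2) to l^(d/2 - 2),
  which stays bounded for d <= 3.\<close>

section \<open>Compactly supported product test functions\<close>

text \<open>An algebra closed under differentiation; the \<open>flat\<close> functions make bump functions available.\<close>

inductive_set smooth_algebra :: "(real \<Rightarrow> real) set" where
  poly: "(\<lambda>x. poly q x) \<in> smooth_algebra"
| flat: "(\<lambda>x. if x > 0 then poly q (1 / x) * exp (- (1 / x)) else 0) \<in> smooth_algebra"
| add: "f \<in> smooth_algebra \<Longrightarrow> g \<in> smooth_algebra \<Longrightarrow> (\<lambda>x. f x + g x) \<in> smooth_algebra"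
| mult: "f \<in> smooth_algebra \<Longrightarrow> g \<in> smooth_algebra \<Longrightarrow> (\<lambda>x. f x * g x) \<in> smooth_algebra"
| affine: "f \<in> smooth_algebra \<Longrightarrow> (\<lambda>x. f (c * x + d)) \<in> smooth_algebra"

lemma smooth_algebra_const: "(\<lambda>x. c) \<in> smooth_algebra"
proof -
  have "(\<lambda>x. c) = poly [:c:]" by auto
  then show ?thesis by (metis smooth_algebra.poly)
qed

lemma smooth_algebra_ident: "(\<lambda>x. x) \<in> smooth_algebra"
proof -
  have "(\<lambda>x. x) = poly [:0, 1::real:]" by auto
  then show ?thesis by (metis smooth_algebra.poly)
qed

lemma poly_exp_tendsto_0:
  fixes q :: "real poly"
  shows "((\<lambda>x. poly q x * exp (- x)) \<longlongrightarrow> 0) at_top"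
proof -
  have "((\<lambda>x. \<Sum>i\<le>degree q. coeff q i * (x ^ i / exp x)) \<longlongrightarrow> (\<Sum>i\<le>degree q. coeff q i * 0)) at_top"
    by (intro tendsto_intros tendsto_power_div_exp_0)
  moreover have "poly q x * exp (- x) = (\<Sum>i\<le>degree q. coeff q i * (x ^ i / exp x))" for x
    by (simp add: poly_altdef sum_distrib_right exp_minus divide_inverse mult.assoc)
  ultimately show ?thesis by simp
qed

text \<open>For x > 0 the chain rule contributes (1/x)^2, encoded by \<open>[:0, 0, 1:]\<close>, and
  the two terms of the product rule have opposite signs, hence \<open>q - pderiv q\<close>. The
  derivative is of the same kind with another polynomial, so these functions are smooth across
  0.\<close>

lemma flat_has_derivative:
  fixes q :: "real poly"
  defines "F \<equiv> (\<lambda>q x. if x > 0 then poly q (1 / x) * exp (- (1 / x)) else (0::real))"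
  shows "(F q has_real_derivative F ([:0, 0, 1:] * (q - pderiv q)) x) (at x)"
proof -
  consider "x > 0" | "x < 0" | "x = 0" by linarith
  then show ?thesis
  proof cases
    case 1
    have "((\<lambda>x. poly q (1 / x) * exp (- (1 / x))) has_real_derivative
        F ([:0, 0, 1:] * (q - pderiv q)) x) (at x)"
      using 1 unfolding F_def
      by (auto intro!: derivative_eq_intros DERIV_chain2[OF poly_DERIV]
          simp: field_simps power2_eq_square)
    then show ?thesis
      by (rule has_field_derivative_transform_within_open[of _ _ _ "{0<..}"])
        (use 1 in \<open>auto simp: F_def\<close>)
  next
    case 2
    have "((\<lambda>x. 0) has_real_derivative F ([:0, 0, 1:] * (q - pderiv q)) x) (at x)"
      using 2 unfolding F_def by auto
    then show ?thesis
      by (rule has_field_derivative_transform_within_open[of _ _ _ "{..<0}"])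
        (use 2 in \<open>auto simp: F_def\<close>)
  next
    case 3
    \<comment> \<open>This is the difference quotient at 0 from the right: dividing by y multiplies
      the polynomial in 1/y by its variable.\<close>
    have "((\<lambda>y. poly ([:0, 1:] * q) (1 / y) * exp (- (1 / y))) \<longlongrightarrow> 0) (at_right 0)"
      by (rule filterlim_compose[OF poly_exp_tendsto_0])
        (simp add: filterlim_inverse_at_top_right flip: inverse_eq_divide)
    then have "((\<lambda>y. F q y / y) \<longlongrightarrow> 0) (at_right 0)"
      by (rule tendsto_cong[THEN iffD1, rotated])
        (auto simp: F_def eventually_at_right_field intro!: exI[of _ 1])
    moreover have "((\<lambda>y. F q y / y) \<longlongrightarrow> 0) (at_left 0)"
      by (rule tendsto_cong[THEN iffD1, of "\<lambda>_. 0"])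
        (auto simp: F_def eventually_at_left_field intro!: exI[of _ "-1"])
    ultimately have "((\<lambda>y. F q y / y) \<longlongrightarrow> 0) (at 0)"
      using filterlim_split_at by blast
    then show ?thesis
      using 3 by (simp add: has_field_derivative_iff F_def)
  qed
qed

lemma smooth_algebra_has_derivative:
  assumes "f \<in> smooth_algebra"
  shows "\<exists>f'\<in>smooth_algebra. \<forall>x. (f has_real_derivative f' x) (at x)"
  using assms
proof induction
  case (poly q)
  show ?case
    by (rule bexI[of _ "\<lambda>x. poly (pderiv q) x"]) (auto intro: smooth_algebra.poly)
next
  case (flat q)
  show ?case
    by (rule bexI[OF _ smooth_algebra.flat[of "[:0, 0, 1:] * (q - pderiv q)"]])
      (use flat_has_derivative[of q] in blast)
next
  case (add f g)
  then obtain f' g' where *: "f' \<in> smooth_algebra" "g' \<in> smooth_algebra"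
    "\<And>x. (f has_real_derivative f' x) (at x)" "\<And>x. (g has_real_derivative g' x) (at x)"
    by blast
  show ?case
    by (rule bexI[of _ "\<lambda>x. f' x + g' x"])
      (use * in \<open>auto intro!: derivative_eq_intros smooth_algebra.intros\<close>)
next
  case (mult f g)
  then obtain f' g' where *: "f' \<in> smooth_algebra" "g' \<in> smooth_algebra"
    "\<And>x. (f has_real_derivative f' x) (at x)" "\<And>x. (g has_real_derivative g' x) (at x)"
    by blast
  show ?case
    by (rule bexI[of _ "\<lambda>x. f' x * g x + g' x * f x"])
      (use * mult.hyps in \<open>auto intro!: derivative_eq_intros smooth_algebra.intros\<close>)
next
  case (affine f c d)
  then obtain f' where *: "f' \<in> smooth_algebra" "\<And>x. (f has_real_derivative f' x) (at x)"
    by blast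
  show ?case
  proof (rule bexI[of _ "\<lambda>x. c * f' (c * x + d)"])
    show "\<forall>x. ((\<lambda>x. f (c * x + d)) has_real_derivative c * f' (c * x + d)) (at x)"
    proof
      fix x
      have "((\<lambda>x. c * x + d) has_real_derivative c) (at x)"
        by (auto intro!: derivative_eq_intros)
      from DERIV_chain2[OF *(2) this]
      show "((\<lambda>x. f (c * x + d)) has_real_derivative c * f' (c * x + d)) (at x)"
        by (simp add: mult.commute)
    qed
    show "(\<lambda>x. c * f' (c * x + d)) \<in> smooth_algebra"
      using * by (intro smooth_algebra.mult smooth_algebra_const smooth_algebra.affine)
  qed
qed

lemma smooth_algebra_deriv:
  assumes "f \<in> smooth_algebra"
  shows "deriv f \<in> smooth_algebra" "(f has_real_derivative deriv f x) (at x)"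
proof -
  obtain f' where *: "f' \<in> smooth_algebra" "\<And>x. (f has_real_derivative f' x) (at x)"
    using smooth_algebra_has_derivative[OF assms] by blast
  then have "deriv f = f'"
    by (auto intro: DERIV_imp_deriv)
  with * show "deriv f \<in> smooth_algebra" "(f has_real_derivative deriv f x) (at x)"
    by auto
qed

lemma smooth_algebra_continuous:
  assumes "f \<in> smooth_algebra"
  shows "continuous_on A f"
  using DERIV_continuous_on[of A f "deriv f"] smooth_algebra_deriv(2)[OF assms]
  by (auto intro: has_field_derivative_at_within)

text \<open>Products of one-variable factors keep smoothness a matter of calculus in one variable: a
  partial derivative replaces a single factor by its derivative, which again lies in
  \<open>smooth_algebra\<close>.\<close>

definition tensor :: "('n::finite \<Rightarrow> real \<Rightarrow> real) \<Rightarrow> real^'n \<Rightarrow> real" where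
  "tensor h x = (\<Prod>i\<in>UNIV. h i (x $ i))"

lemma tensor_upd: "tensor (h(j := k)) x = k (x $ j) * (\<Prod>i\<in>UNIV - {j}. h i (x $ i))"
  unfolding tensor_def by (subst prod.remove[of _ j]) (auto intro!: prod.cong)

lemma tensor_has_derivative:
  assumes "\<And>i. h i \<in> smooth_algebra"
  shows "(tensor h has_derivative (\<lambda>y. \<Sum>i\<in>UNIV. y $ i * tensor (h(i := deriv (h i))) x)) (at x)"
proof -
  have 1: "((\<lambda>x. h i (x $ i)) has_derivative (\<lambda>y. deriv (h i) (x $ i) * y $ i)) (at x)" for i x
    using has_derivative_compose[OF bounded_linear.has_derivative[OF bounded_linear_vec_nth has_derivative_ident]
        smooth_algebra_deriv(2)[OF assms, unfolded has_field_derivative_def]]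
    by (simp add: mult.commute)
  show ?thesis
    unfolding tensor_def[of h, abs_def]
    by (rule has_derivative_eq_rhs[OF has_derivative_prod[OF 1]])
      (auto intro!: sum.cong simp: fun_eq_iff tensor_upd)
qed

lemma grad_tensor:
  assumes "\<And>i. h i \<in> smooth_algebra"
  shows "grad (tensor h) x $ j = tensor (h(j := deriv (h j))) x"
proof -
  have "frechet_derivative (tensor h) (at x) = (\<lambda>y. \<Sum>i\<in>UNIV. y $ i * tensor (h(i := deriv (h i))) x)"
    using frechet_derivative_at[OF tensor_has_derivative[of h, OF assms]] by simp
  then show ?thesis
    by (simp add: grad_def axis_def if_distrib[of "\<lambda>x. x * _"] cong: if_cong)
qed

lemma continuous_tensor:
  assumes "\<And>i. h i \<in> smooth_algebra"
  shows "continuous_on A (tensor h)"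
  unfolding tensor_def[abs_def]
  by (intro continuous_on_prod continuous_on_compose2[OF smooth_algebra_continuous[OF assms, of UNIV]]
      continuous_intros) auto

lemma Ck_tensor:
  assumes "\<And>i. h i \<in> smooth_algebra"
  shows "Ck k (tensor h)"
  using assms
proof (induction k arbitrary: h)
  case 0
  then show ?case by (simp add: continuous_tensor)
next
  case (Suc k)
  have "(\<lambda>x. grad (tensor h) x $ i) = tensor (h(i := deriv (h i)))" for i
    using grad_tensor[of h, OF Suc.prems] by auto
  moreover have "tensor h differentiable_on UNIV"
    using tensor_has_derivative[of h, OF Suc.prems] by (auto simp: differentiable_on_def differentiable_def)
  ultimately show ?case
    using Suc by (auto simp: smooth_algebra_deriv)
qed

lemma test_function_tensor:
  assumes "\<And>i. h i \<in> smooth_algebra" and "\<And>x. x \<notin> cbox c d \<Longrightarrow> tensor h x = 0"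
  shows "test_function (tensor h)"
  unfolding test_function_def
proof
  have "closure {x. tensor h x \<noteq> 0} \<subseteq> cbox c d"
    using assms(2) by (intro closure_minimal) auto
  then show "compact (closure {x. tensor h x \<noteq> 0})"
    by (metis bounded_cbox bounded_subset closed_closure compact_eq_bounded_closed)
qed (use Ck_tensor[of h, OF assms(1)] in blast)

text \<open>Neither a sign nor a normalisation is imposed, so that the set is closed under
  differentiating a factor and under multiplying it by its coordinate. Differentiating averages in
  the scale produces exactly these two operations.\<close>

definition unit_bumps :: "('n::finite \<Rightarrow> real \<Rightarrow> real) set" where
  "unit_bumps = {w. \<forall>i. w i \<in> smooth_algebra \<and> (\<forall>s. s \<notin> {0..1} \<longrightarrow> w i s = 0)}"

lemma deriv_eq_0_outside_unit:
  assumes "\<And>s::real. s \<notin> {0..1} \<Longrightarrow> w s = (0::real)" "s \<notin> {0..1}"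
  shows "deriv w s = 0"
proof (rule DERIV_imp_deriv)
  have "open (- {0..1::real})" by (simp add: open_Compl)
  then show "(w has_real_derivative 0) (at s)"
    by (rule has_field_derivative_transform_within_open[of "\<lambda>_. 0" 0 s, rotated])
      (use assms in auto)
qed

lemma unit_bumps_upd_deriv: "w \<in> unit_bumps \<Longrightarrow> w(i := deriv (w i)) \<in> unit_bumps"
  using deriv_eq_0_outside_unit[of "w i"] smooth_algebra_deriv[of "w i"]
  by (auto simp: unit_bumps_def)

lemma unit_bumps_upd_ident: "w \<in> unit_bumps \<Longrightarrow> w(i := \<lambda>s. s * w i s) \<in> unit_bumps"
  by (auto simp: unit_bumps_def intro!: smooth_algebra.mult smooth_algebra_ident)

lemma unit_bumps_outside:
  assumes "w \<in> unit_bumps" "x \<notin> cbox 0 1"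
  shows "tensor w x = 0"
proof -
  obtain i where "x $ i \<notin> {0..1}"
    using assms(2) by (auto simp: mem_box_cart)
  then show ?thesis
    using assms(1) by (auto simp: tensor_def unit_bumps_def intro!: prod_zero bexI[of _ i])
qed

lemma unit_bumps_bounded:
  assumes "w \<in> unit_bumps"
  obtains M where "M > 0" "\<And>x. \<bar>tensor w x\<bar> \<le> M"
proof -
  have "compact (tensor w ` cbox 0 1)"
    using assms by (intro compact_continuous_image continuous_tensor) (auto simp: unit_bumps_def)
  then obtain M where M: "M > 0" "\<And>x. x \<in> cbox 0 1 \<Longrightarrow> \<bar>tensor w x\<bar> \<le> M"
    using compact_imp_bounded bounded_pos by (metis (no_types) image_eqI real_norm_def)
  then show ?thesis
    using that[of M] unit_bumps_outside[OF assms] by (metis abs_zero less_eq_real_def)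
qed

text \<open>The factor E(s) E(1 - s) is positive exactly for 0 < s < 1. All coordinates carry the
  same factor.\<close>

definition std_bump :: "'n::finite \<Rightarrow> real \<Rightarrow> real" where
  "std_bump i s = (let E = (\<lambda>x. if x > 0 then exp (- (1 / x)) else 0) in E s * E (1 - s))"

lemma std_bump_unit_bumps: "(std_bump :: 'n::finite \<Rightarrow> _) \<in> unit_bumps"
proof -
  have E: "(\<lambda>x. if x > 0 then exp (- (1 / x)) else 0) \<in> smooth_algebra"
    using smooth_algebra.flat[of 1] unfolding poly_1 mult_1_left .
  have "(\<lambda>s::real. (if s > 0 then exp (- (1 / s)) else 0) *
      (if -1 * s + 1 > 0 then exp (- (1 / (-1 * s + 1))) else 0)) \<in> smooth_algebra"
    by (rule smooth_algebra.mult[OF E smooth_algebra.affine[OF E]])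
  moreover have "std_bump i = (\<lambda>s::real. (if s > 0 then exp (- (1 / s)) else 0) *
      (if -1 * s + 1 > 0 then exp (- (1 / (-1 * s + 1))) else 0))" for i :: 'n
    by (auto simp: std_bump_def fun_eq_iff)
  ultimately have "std_bump i \<in> smooth_algebra" for i :: 'n
    by simp
  then show ?thesis
    by (auto simp: unit_bumps_def std_bump_def)
qed

lemma tensor_std_bump_nonneg: "tensor std_bump x \<ge> 0"
  by (auto simp: tensor_def std_bump_def intro!: prod_nonneg)

lemma tensor_std_bump_pos: "x \<in> box 0 1 \<Longrightarrow> tensor std_bump x > 0"
  by (auto simp: tensor_def std_bump_def mem_box_cart intro!: prod_pos)

section \<open>Averages over shrinking cubes\<close>

text \<open>A general bounded bilinear product covers real products, \<open>scaleR\<close> and its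
  flip, that is, both sides of the defining identity of a weak gradient. Since \<open>k\<close>
  vanishes off \<open>C\<close>, integrability over \<open>C\<close> already gives it over the whole
  space.\<close>

lemma integrable_bounded_mult:
  fixes f :: "real^'n \<Rightarrow> 'b::euclidean_space" and k :: "real^'n \<Rightarrow> 'c::euclidean_space"
  assumes "bounded_bilinear h" "f absolutely_integrable_on C" "C \<in> sets lebesgue"
    "continuous_on UNIV k" "bounded (k ` C)" "\<And>x. x \<notin> C \<Longrightarrow> k x = 0"
  shows "integrable lebesgue (\<lambda>x. h (k x) (f x) :: 'd::euclidean_space)"
proof -
  have "k \<in> borel_measurable (lebesgue_on C)"
    using assms(3) continuous_on_subset[OF assms(4) subset_UNIV]
    by (rule continuous_imp_measurable_on_sets_lebesgue[rotated])
  from absolutely_integrable_bounded_measurable_product[OF assms(1)[folded bilinear_conv_bounded_bilinear] this assms(3,5,2)]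
  have "(\<lambda>x. h (k x) (f x)) absolutely_integrable_on C" .
  moreover have "indicator C x *\<^sub>R h (k x) (f x) = h (k x) (f x)" for x
    using assms(6)[of x] bounded_bilinear.zero_left[OF assms(1)] by (simp split: split_indicator)
  ultimately show ?thesis
    by (simp add: set_integrable_def)
qed

text \<open>Convergence of the plain means of \<open>f\<close> would not suffice: the kernels used
  below are not constant on the cube, so \<open>f y - f x\<close> must be small in the mean of its
  absolute value. The cubes have \<open>x\<close> as a corner because the bumps live on
  [0, 1].\<close>

lemma lebesgue_points:
  fixes f :: "real^'n \<Rightarrow> real"
  assumes "\<And>a b. f absolutely_integrable_on cbox a b"
  obtains N where "negligible N"
    "\<And>x e. x \<notin> N \<Longrightarrow> 0 < e \<Longrightarrow> \<exists>d>0. \<forall>h. 0 < h \<and> h < d \<longrightarrow>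
       integral (cbox x (x + h *\<^sub>R One)) (\<lambda>y. \<bar>f y - f x\<bar>) \<le> e * h ^ CARD('n)"
proof -
  have int: "(\<lambda>y. \<bar>f y - q\<bar>) integrable_on cbox a b" for q a b
  proof -
    have "(\<lambda>y. f y - q) absolutely_integrable_on cbox a b"
      using assms by (intro set_integral_diff(1)) (auto simp: absolutely_integrable_on_const)
    then show ?thesis
      by (auto simp: absolutely_integrable_on_def)
  qed
  have "\<exists>N. negligible N \<and> (\<forall>x e. x \<notin> N \<longrightarrow> 0 < e \<longrightarrow> (\<exists>d>0. \<forall>h. 0 < h \<and> h < d \<longrightarrow>
       norm (integral (cbox x (x + h *\<^sub>R One)) (\<lambda>y. \<bar>f y - q\<bar>) /\<^sub>R h ^ DIM(real^'n) - \<bar>f x - q\<bar>) < e))" for q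
    by (rule integrable_ccontinuous_explicit[of "\<lambda>y. \<bar>f y - q\<bar>"]) (use int in blast)+
  then obtain NN where NN: "\<And>q. negligible (NN q)"
    "\<And>q x e. x \<notin> NN q \<Longrightarrow> 0 < e \<Longrightarrow> \<exists>d>0. \<forall>h. 0 < h \<and> h < d \<longrightarrow>
       norm (integral (cbox x (x + h *\<^sub>R One)) (\<lambda>y. \<bar>f y - q\<bar>) /\<^sub>R h ^ DIM(real^'n) - \<bar>f x - q\<bar>) < e"
    by metis
  \<comment> \<open>Differentiating the integrals of \<open>\<bar>f - q\<bar>\<close> for rational \<open>q\<close> suffices, since some \<open>q\<close> is close to \<open>f x\<close>.\<close>
  define N where "N = (\<Union>q\<in>\<rat>. NN q)"
  show thesis
  proof
    show "negligible N"
      unfolding N_def using NN(1) by (intro negligible_countable_Union countable_image countable_rat) auto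
    fix x and e :: real
    assume x: "x \<notin> N" and e: "0 < e"
    obtain q where q: "q \<in> \<rat>" "f x - e / 3 < q" "q < f x"
      using Rats_dense_in_real[of "f x - e / 3" "f x"] e by auto
    then have "x \<notin> NN q" using x by (auto simp: N_def)
    then obtain d where d: "d > 0" "\<And>h. 0 < h \<Longrightarrow> h < d \<Longrightarrow>
       norm (integral (cbox x (x + h *\<^sub>R One)) (\<lambda>y. \<bar>f y - q\<bar>) /\<^sub>R h ^ DIM(real^'n) - \<bar>f x - q\<bar>) < e / 3"
      using NN(2)[of x q "e / 3"] e by auto
    show "\<exists>d>0. \<forall>h. 0 < h \<and> h < d \<longrightarrow>
       integral (cbox x (x + h *\<^sub>R One)) (\<lambda>y. \<bar>f y - f x\<bar>) \<le> e * h ^ CARD('n)"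
    proof (intro exI conjI allI impI)
      fix h assume h: "0 < h \<and> h < d"
      let ?C = "cbox x (x + h *\<^sub>R One)"
      have cont: "measure lborel ?C = h ^ CARD('n)"
        using h by (subst content_cbox) (simp_all add: inner_add_left)
      have "integral ?C (\<lambda>y. \<bar>f y - q\<bar>) / h ^ CARD('n) < \<bar>f x - q\<bar> + e / 3"
      proof -
        have "integral ?C (\<lambda>y. \<bar>f y - q\<bar>) /\<^sub>R h ^ DIM(real^'n) =
            integral ?C (\<lambda>y. \<bar>f y - q\<bar>) / h ^ CARD('n)"
          by (simp add: divide_inverse mult.commute)
        with d(2)[of h] h show ?thesis
          unfolding real_norm_def by linarith
      qed
      then have 1: "integral ?C (\<lambda>y. \<bar>f y - q\<bar>) < (\<bar>f x - q\<bar> + e / 3) * h ^ CARD('n)"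
        using h by (subst (asm) pos_divide_less_eq) auto
      have "integral ?C (\<lambda>y. \<bar>f y - f x\<bar>) \<le> integral ?C (\<lambda>y. \<bar>f y - q\<bar> + \<bar>q - f x\<bar>)"
        by (intro integral_le int integrable_add integrable_const) auto
      also have "\<dots> = integral ?C (\<lambda>y. \<bar>f y - q\<bar>) + \<bar>q - f x\<bar> * h ^ CARD('n)"
        using cont by (subst integral_add) (auto intro: int)
      also have "\<dots> \<le> (\<bar>f x - q\<bar> + e / 3 + \<bar>q - f x\<bar>) * h ^ CARD('n)"
        using 1 by (simp add: algebra_simps)
      also have "\<dots> \<le> e * h ^ CARD('n)"
        using q h by (intro mult_right_mono) auto
      finally show "integral ?C (\<lambda>y. \<bar>f y - f x\<bar>) \<le> e * h ^ CARD('n)" .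
    qed (fact d(1))
  qed
qed

text \<open>With W = \<open>tensor w\<close> this averages \<open>f\<close> against l^n W(l (y -
  x)), n the dimension: an approximate identity at scale 1/l that is not normalised and may change
  sign.\<close>

definition smear :: "('n::finite \<Rightarrow> real \<Rightarrow> real) \<Rightarrow> real \<Rightarrow> (real^'n \<Rightarrow> real) \<Rightarrow> real^'n \<Rightarrow> real" where
  "smear w l f x = l ^ CARD('n) * (\<integral>y. f y * tensor w (l *\<^sub>R (y - x)) \<partial>lebesgue)"

lemma One_vec_nth [simp]: "(One :: real^'n) $ i = 1"
proof -
  have "axis i 1 \<in> (Basis :: (real^'n) set)" by simp
  from inner_sum_left_Basis[OF this, of "\<lambda>_. 1"] show ?thesis
    by (simp only: cart_eq_inner_axis[symmetric] scaleR_one)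
qed

lemma sum_Basis_vec_nth [simp]: "(\<Sum>b\<in>(Basis :: (real^'n) set). b $ i) = 1"
  using One_vec_nth[of i] by (simp only: sum_component)

lemma unit_bumps_rescaled_outside:
  fixes x :: "real^'n"
  assumes "w \<in> unit_bumps" "l > 0" "y \<notin> cbox x (x + (1 / l) *\<^sub>R One)"
  shows "tensor w (l *\<^sub>R (y - x)) = 0"
proof (rule unit_bumps_outside[OF assms(1)])
  obtain i where "\<not> (x $ i \<le> y $ i \<and> y $ i \<le> x $ i + 1 / l)"
    using assms(3) by (auto simp: mem_box_cart)
  then have "\<not> (0 \<le> l * (y $ i - x $ i) \<and> l * (y $ i - x $ i) \<le> 1)"
    using assms(2) by (auto simp: field_simps zero_le_mult_iff)
  then show "l *\<^sub>R (y - x) \<notin> cbox 0 1"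
    by (auto simp: mem_box_cart intro!: exI[of _ i])
qed

lemma continuous_rescaled_tensor:
  assumes "w \<in> unit_bumps"
  shows "continuous_on A (\<lambda>y. tensor w (l *\<^sub>R (y - x)))"
proof (rule continuous_on_compose2[OF continuous_tensor[of w UNIV]])
  show "continuous_on A (\<lambda>y. l *\<^sub>R (y - x))"
    by (intro continuous_intros)
qed (use assms in \<open>auto simp: unit_bumps_def\<close>)

lemma integrable_rescaled_tensor:
  fixes f :: "real^'n \<Rightarrow> real"
  assumes "w \<in> unit_bumps" "l > 0" "\<And>a b. f absolutely_integrable_on cbox a b"
  shows "integrable lebesgue (\<lambda>y. f y * tensor w (l *\<^sub>R (y - x)))"
proof -
  obtain M where "\<And>x. \<bar>tensor w x\<bar> \<le> M"
    using unit_bumps_bounded[OF assms(1)] by blast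
  then have "bounded ((\<lambda>y. tensor w (l *\<^sub>R (y - x))) ` A)" for A
    by (auto simp: bounded_iff)
  then have "integrable lebesgue (\<lambda>y. tensor w (l *\<^sub>R (y - x)) * f y)"
    using unit_bumps_rescaled_outside[OF assms(1,2)]
    by (intro integrable_bounded_mult[OF bounded_bilinear_mult assms(3)[of x "x + (1 / l) *\<^sub>R One"]]
        continuous_rescaled_tensor assms(1)) auto
  then show ?thesis by (simp add: mult.commute)
qed

lemma smear_integral:
  fixes f :: "real^'n \<Rightarrow> real"
  assumes "w \<in> unit_bumps" "l > 0" "\<And>a b. f absolutely_integrable_on cbox a b"
  shows "((\<lambda>y. f y * tensor w (l *\<^sub>R (y - x))) has_integral smear w l f x / l ^ CARD('n))
           (cbox x (x + (1 / l) *\<^sub>R One))"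
proof -
  have "((\<lambda>y. f y * tensor w (l *\<^sub>R (y - x))) has_integral smear w l f x / l ^ CARD('n)) UNIV"
    using has_integral_integral_lebesgue[OF integrable_rescaled_tensor[OF assms]] assms(2)
    by (simp add: smear_def)
  moreover have "(\<lambda>y. f y * tensor w (l *\<^sub>R (y - x))) =
      (\<lambda>y. if y \<in> cbox x (x + (1 / l) *\<^sub>R One) then f y * tensor w (l *\<^sub>R (y - x)) else 0)"
    using unit_bumps_rescaled_outside[OF assms(1,2)] by (intro ext) simp
  ultimately have "((\<lambda>y. if y \<in> cbox x (x + (1 / l) *\<^sub>R One) then f y * tensor w (l *\<^sub>R (y - x)) else 0)
      has_integral smear w l f x / l ^ CARD('n)) UNIV"
    by metis
  then show ?thesis
    by (simp only: has_integral_restrict_UNIV)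
qed

lemma smear_const:
  fixes x :: "real^'n"
  assumes "w \<in> unit_bumps" "l > 0"
  shows "smear w l (\<lambda>_. c) x = c * integral (cbox 0 One) (tensor w)"
proof -
  have cont: "continuous_on (cbox 0 One) (tensor w)"
    using assms by (intro continuous_tensor) (auto simp: unit_bumps_def)
  have "(tensor w has_integral integral (cbox 0 One) (tensor w)) (cbox 0 One)"
    using integrable_continuous[OF cont] by (simp add: integrable_integral)
  from has_integral_affinity'[OF this assms(2), of "- (l *\<^sub>R x)"]
  have "((\<lambda>y. tensor w (l *\<^sub>R (y - x))) has_integral
      integral (cbox 0 One) (tensor w) / l ^ CARD('n)) (cbox x (x + (1 / l) *\<^sub>R One))"
    using assms(2) by (simp add: algebra_simps divide_inverse)
  note 1 = has_integral_mult_right[OF this, of c]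
  have "((\<lambda>y. c * tensor w (l *\<^sub>R (y - x))) has_integral smear w l (\<lambda>_. c) x / l ^ CARD('n))
      (cbox x (x + (1 / l) *\<^sub>R One))"
    by (intro smear_integral assms) (simp add: absolutely_integrable_on_const)
  from has_integral_unique[OF this 1] show ?thesis using assms(2) by simp
qed

lemma integral_std_bump_pos: "integral (cbox 0 One) (tensor std_bump :: real^'n \<Rightarrow> real) > 0"
proof -
  let ?W = "tensor std_bump :: real^'n \<Rightarrow> real"
  have cont: "continuous_on (cbox 0 One) ?W"
    using std_bump_unit_bumps by (intro continuous_tensor) (auto simp: unit_bumps_def)
  have "(\<chi> i. 1/2) \<in> box (0::real^'n) 1" "(\<chi> i. 1/2) \<in> cbox (0::real^'n) One"
    by (auto simp: mem_box_cart)
  moreover have "1 = (One :: real^'n)" by (simp add: vec_eq_iff)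
  ultimately have "integral (cbox 0 One) ?W \<noteq> 0"
    using integral_cbox_eq_0_iff[OF cont] tensor_std_bump_nonneg tensor_std_bump_pos
    by (metis empty_iff less_irrefl)
  moreover have "integral (cbox 0 One) ?W \<ge> 0"
    using integrable_continuous[OF cont] tensor_std_bump_nonneg by (intro integral_nonneg) auto
  ultimately show ?thesis by simp
qed

text \<open>At a Lebesgue point the averages tend to c f(x), with c the mass of the standard bump,
  so a bound on all of them passes to f(x). The null set is fixed before \<open>x\<close> and
  \<open>M\<close>, so the bound may depend on the point.\<close>

lemma abs_le_smear_bound:
  fixes f :: "real^'n \<Rightarrow> real"
  assumes "\<And>a b. f absolutely_integrable_on cbox a b"
  obtains c N where "c > 0" "negligible N"
    "\<And>x M. x \<notin> N \<Longrightarrow> (\<And>l. l \<ge> 1 \<Longrightarrow> \<bar>smear std_bump l f x\<bar> \<le> M) \<Longrightarrow> \<bar>f x\<bar> * c \<le> M"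
proof -
  obtain N where N: "negligible N" "\<And>x e. x \<notin> N \<Longrightarrow> 0 < e \<Longrightarrow> \<exists>d>0. \<forall>h. 0 < h \<and> h < d \<longrightarrow>
       integral (cbox x (x + h *\<^sub>R One)) (\<lambda>y. \<bar>f y - f x\<bar>) \<le> e * h ^ CARD('n)"
    by (rule lebesgue_points[OF assms]) blast
  define c where "c = integral (cbox 0 One) (tensor std_bump :: real^'n \<Rightarrow> real)"
  note ub = std_bump_unit_bumps
  obtain K where K: "K > 0" "\<And>x::real^'n. \<bar>tensor std_bump x\<bar> \<le> K"
    using unit_bumps_bounded[OF ub] by blast
  show thesis
  proof
    show "c > 0" using integral_std_bump_pos by (simp add: c_def)
    show "negligible N" by fact
    fix x M assume x: "x \<notin> N" and M: "\<And>l. l \<ge> 1 \<Longrightarrow> \<bar>smear std_bump l f x\<bar> \<le> M"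
    show "\<bar>f x\<bar> * c \<le> M"
    proof (rule field_le_epsilon)
      fix e :: real assume "e > 0"
      \<comment> \<open>The accuracy e / K makes up for the bound K of the bump: the error over a
        cube of volume l^(-n) is at most e l^(-n), and \<open>smear\<close> carries the factor
        l^n.\<close>
      then obtain d where d: "d > 0" "\<And>h. 0 < h \<Longrightarrow> h < d \<Longrightarrow>
          integral (cbox x (x + h *\<^sub>R One)) (\<lambda>y. \<bar>f y - f x\<bar>) \<le> e / K * h ^ CARD('n)"
        using N(2)[OF x, of "e / K"] K by auto
      \<comment> \<open>The 2 makes the inequality 1 / l < d strict, and the maximum keeps l in the
        range where the bound \<open>M\<close> is available.\<close>
      define l where "l = max 1 (2 / d)"
      have l: "l \<ge> 1" "l > 0" "1 / l < d"
        using d(1) by (auto simp: l_def field_simps max_def)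
      let ?C = "cbox x (x + (1 / l) *\<^sub>R One)"
      let ?k = "\<lambda>y. tensor std_bump (l *\<^sub>R (y - x))"
      have ai: "(\<lambda>y. f y - f x) absolutely_integrable_on cbox u v" for u v
        using assms by (intro set_integral_diff(1)) (auto simp: absolutely_integrable_on_const)
      have "((\<lambda>y. f y * ?k y - f x * ?k y) has_integral
          smear std_bump l f x / l ^ CARD('n) - f x * c / l ^ CARD('n)) ?C"
        using has_integral_diff[OF smear_integral[OF ub l(2) assms] smear_integral[OF ub l(2), of "\<lambda>_. f x" x]]
        by (simp add: smear_const[OF ub l(2)] c_def absolutely_integrable_on_const)
      then have hi: "((\<lambda>y. (f y - f x) * ?k y) has_integral
          (smear std_bump l f x - f x * c) / l ^ CARD('n)) ?C"
        by (simp add: algebra_simps diff_divide_distrib)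
      have "norm (integral ?C (\<lambda>y. (f y - f x) * ?k y)) \<le> integral ?C (\<lambda>y. K * \<bar>f y - f x\<bar>)"
        using hi ai[of x "x + (1 / l) *\<^sub>R One"] K(2)
        by (intro integral_norm_bound_integral)
          (auto simp: abs_mult mult.commute[of K] absolutely_integrable_on_def has_integral_integrable
            intro!: mult_left_mono integrable_on_mult_left)
      also have "\<dots> \<le> K * (e / K * (1 / l) ^ CARD('n))"
        using d(2)[of "1 / l"] l K by (simp add: pos_le_divide_eq mult.commute)
      also have "\<dots> = e / l ^ CARD('n)"
        using K(1) by (simp add: power_one_over)
      finally have "\<bar>smear std_bump l f x - f x * c\<bar> / l ^ CARD('n) \<le> e / l ^ CARD('n)"
        using integral_unique[OF hi] l by (simp add: abs_divide)
      then have "\<bar>smear std_bump l f x - f x * c\<bar> \<le> e"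
        using l by (simp add: divide_le_cancel)
      moreover have "\<bar>f x\<bar> * c = \<bar>f x * c\<bar>"
        using \<open>c > 0\<close> by (simp add: abs_mult)
      ultimately show "\<bar>f x\<bar> * c \<le> M + e"
        using M[OF l(1)] by linarith
    qed
  qed
qed

section \<open>Weak gradients and divergences\<close>

lemma test_function_support:
  fixes \<psi> :: "real^'n \<Rightarrow> real"
  assumes "test_function \<psi>"
  defines "C \<equiv> closure {x. \<psi> x \<noteq> 0}"
  shows "compact C" "continuous_on UNIV \<psi>" "continuous_on UNIV (grad \<psi>)"
    "\<And>x. x \<notin> C \<Longrightarrow> \<psi> x = 0" "\<And>x. x \<notin> C \<Longrightarrow> grad \<psi> x = 0"
    "bounded (\<psi> ` C)" "bounded (grad \<psi> ` C)"
proof -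
  show C: "compact C" using assms by (simp add: test_function_def C_def)
  have "Ck 0 \<psi>" "Ck 1 \<psi>" using assms by (auto simp: test_function_def)
  then have cont: "continuous_on UNIV \<psi>" "\<And>i. continuous_on UNIV (\<lambda>x. grad \<psi> x $ i)" by auto
  show "continuous_on UNIV \<psi>" by fact
  have "continuous_on UNIV (\<lambda>x. \<chi> i. grad \<psi> x $ i)"
    by (intro continuous_on_vec_lambda cont)
  then show contg: "continuous_on UNIV (grad \<psi>)" by simp
  show 0: "\<psi> x = 0" if "x \<notin> C" for x
    using that closure_subset[of "{x. \<psi> x \<noteq> 0}"] by (auto simp: C_def)
  show "grad \<psi> x = 0" if "x \<notin> C" for x
  proof -
    have "(\<psi> has_derivative (\<lambda>_. 0)) (at x)"
      by (rule has_derivative_transform_within_open[of "\<lambda>_. 0" _ _ _ "- C"])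
        (use that 0 C in \<open>auto simp: compact_imp_closed open_Compl\<close>)
    then have "frechet_derivative \<psi> (at x) = (\<lambda>_. 0)"
      by (rule frechet_derivative_at[symmetric])
    then show ?thesis by (simp add: grad_def vec_eq_iff)
  qed
  show "bounded (\<psi> ` C)" "bounded (grad \<psi> ` C)"
    by (rule compact_imp_bounded[OF compact_continuous_image[OF continuous_on_subset C]],
        rule cont(1) contg, rule subset_UNIV)+
qed

lemma integrable_test_scaleR:
  fixes g :: "real^'n \<Rightarrow> 'b::euclidean_space"
  assumes "test_function \<psi>" "locally_integrable g"
  shows "integrable lebesgue (\<lambda>x. \<psi> x *\<^sub>R g x)"
proof -
  define C where "C = closure {x. \<psi> x \<noteq> 0}"
  note C = test_function_support[OF assms(1), folded C_def]
  have "g absolutely_integrable_on C" "C \<in> sets lebesgue"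
    using assms(2) C(1) by (simp_all add: locally_integrable_def compact_imp_closed)
  then show ?thesis
    by (intro integrable_bounded_mult[OF bounded_bilinear_scaleR, where f = g and C = C and k = \<psi>] C)
qed

lemma integrable_scaleR_grad:
  fixes \<phi> :: "real^'n \<Rightarrow> real"
  assumes "test_function \<psi>" "locally_integrable \<phi>"
  shows "integrable lebesgue (\<lambda>x. \<phi> x *\<^sub>R grad \<psi> x)"
proof -
  define C where "C = closure {x. \<psi> x \<noteq> 0}"
  note C = test_function_support[OF assms(1), folded C_def]
  have "\<phi> absolutely_integrable_on C" "C \<in> sets lebesgue"
    using assms(2) C(1) by (simp_all add: locally_integrable_def compact_imp_closed)
  then show ?thesis
    by (intro integrable_bounded_mult[OF bounded_bilinear.flip[OF bounded_bilinear_scaleR], where f = \<phi> and C = C and k = "grad \<psi>"] C)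
qed

lemma locally_integrable_cbox: "locally_integrable f \<Longrightarrow> f absolutely_integrable_on cbox a b"
  by (simp add: locally_integrable_def)

lemma locally_integrable_add_scaled:
  fixes f g :: "real^'n \<Rightarrow> 'b::euclidean_space"
  assumes "locally_integrable f" "locally_integrable g"
  shows "locally_integrable (\<lambda>x. f x + c *\<^sub>R g x)"
  using assms unfolding locally_integrable_def
  by (auto intro!: set_integral_add(1) absolutely_integrable_scaleR_left)

lemma locally_integrable_nth:
  fixes g :: "real^'n \<Rightarrow> real^'m"
  assumes "locally_integrable g"
  shows "locally_integrable (\<lambda>x. g x $ i)"
  using assms unfolding locally_integrable_def
  by (auto simp: cart_eq_inner_axis intro: absolutely_integrable_component)

lemma set_integrable_AE_cong:
  fixes f g :: "real^'n \<Rightarrow> 'b::euclidean_space"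
  assumes "f absolutely_integrable_on C" "AE x in lebesgue. f x = g x"
  shows "g absolutely_integrable_on C"
proof -
  have "(\<lambda>x. indicator C x *\<^sub>R f x) \<in> borel_measurable lebesgue"
    using assms(1) by (auto simp: set_integrable_def)
  moreover have *: "AE x in lebesgue. indicator C x *\<^sub>R f x = indicator C x *\<^sub>R g x"
    using assms(2) by eventually_elim simp
  ultimately have "(\<lambda>x. indicator C x *\<^sub>R g x) \<in> borel_measurable lebesgue"
    by (rule borel_measurable_AE)
  from integrable_cong_AE_imp[OF assms(1)[unfolded set_integrable_def] this *]
  show ?thesis
    unfolding set_integrable_def .
qed

lemma locally_integrable_AE_cong:
  assumes "locally_integrable f" "AE x in lebesgue. f x = g x"
  shows "locally_integrable g"
  using assms set_integrable_AE_cong unfolding locally_integrable_def by blast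

lemma integral_AE_cong_lebesgue:
  fixes f g :: "real^'n \<Rightarrow> 'b::euclidean_space"
  assumes "integrable lebesgue f" "AE x in lebesgue. f x = g x"
  shows "integral\<^sup>L lebesgue f = integral\<^sup>L lebesgue g"
  using borel_measurable_AE[of f g] assms by (intro integral_cong_AE) auto

lemma is_weak_grad_AE_cong:
  fixes \<phi> :: "real^'n \<Rightarrow> real"
  assumes "is_weak_grad \<phi> g" "AE x in lebesgue. \<phi> x = \<phi>' x" "AE x in lebesgue. g x = g' x"
  shows "is_weak_grad \<phi>' g'"
  unfolding is_weak_grad_def
proof (intro conjI allI impI)
  have li: "locally_integrable \<phi>" "locally_integrable g"
    using assms(1) by (auto simp: is_weak_grad_def)
  show "locally_integrable \<phi>'" "locally_integrable g'"
    using li assms(2,3) by (auto intro: locally_integrable_AE_cong)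
  fix \<psi> :: "real^'n \<Rightarrow> real" assume \<psi>: "test_function \<psi>"
  have "(\<integral>x. \<phi>' x *\<^sub>R grad \<psi> x \<partial>lebesgue) = (\<integral>x. \<phi> x *\<^sub>R grad \<psi> x \<partial>lebesgue)"
    using assms(2)
    by (intro integral_AE_cong_lebesgue[symmetric] integrable_scaleR_grad \<psi> li) (erule eventually_mono, simp)
  also have "\<dots> = - (\<integral>x. \<psi> x *\<^sub>R g x \<partial>lebesgue)"
    using assms(1) \<psi> by (simp add: is_weak_grad_def)
  also have "(\<integral>x. \<psi> x *\<^sub>R g x \<partial>lebesgue) = (\<integral>x. \<psi> x *\<^sub>R g' x \<partial>lebesgue)"
    using assms(3)
    by (intro integral_AE_cong_lebesgue integrable_test_scaleR \<psi> li) (erule eventually_mono, simp)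
  finally show "(\<integral>x. \<phi>' x *\<^sub>R grad \<psi> x \<partial>lebesgue) = - (\<integral>x. \<psi> x *\<^sub>R g' x \<partial>lebesgue)" .
qed

lemma is_weak_grad_add_scaled:
  fixes \<phi> \<phi>' :: "real^'n \<Rightarrow> real"
  assumes "is_weak_grad \<phi> g" "is_weak_grad \<phi>' g'"
  shows "is_weak_grad (\<lambda>x. \<phi> x + c * \<phi>' x) (\<lambda>x. g x + c *\<^sub>R g' x)"
  unfolding is_weak_grad_def
proof (intro conjI allI impI)
  show "locally_integrable (\<lambda>x. \<phi> x + c * \<phi>' x)" "locally_integrable (\<lambda>x. g x + c *\<^sub>R g' x)"
    using assms locally_integrable_add_scaled[of \<phi> \<phi>' c] locally_integrable_add_scaled[of g g' c]
    by (auto simp: is_weak_grad_def)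
  fix \<psi> :: "real^'n \<Rightarrow> real" assume \<psi>: "test_function \<psi>"
  have 1: "integrable lebesgue (\<lambda>x. \<phi> x *\<^sub>R grad \<psi> x)" "integrable lebesgue (\<lambda>x. \<phi>' x *\<^sub>R grad \<psi> x)"
    "integrable lebesgue (\<lambda>x. \<psi> x *\<^sub>R g x)" "integrable lebesgue (\<lambda>x. \<psi> x *\<^sub>R g' x)"
    using \<psi> assms by (auto simp: is_weak_grad_def intro: integrable_test_scaleR integrable_scaleR_grad)
  have "(\<integral>x. (\<phi> x + c * \<phi>' x) *\<^sub>R grad \<psi> x \<partial>lebesgue)
      = (\<integral>x. \<phi> x *\<^sub>R grad \<psi> x + c *\<^sub>R (\<phi>' x *\<^sub>R grad \<psi> x) \<partial>lebesgue)"
    by (simp add: algebra_simps)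
  also have "\<dots> = (\<integral>x. \<phi> x *\<^sub>R grad \<psi> x \<partial>lebesgue) + c *\<^sub>R (\<integral>x. \<phi>' x *\<^sub>R grad \<psi> x \<partial>lebesgue)"
    using 1 by (simp del: scaleR_scaleR)
  also have "\<dots> = - ((\<integral>x. \<psi> x *\<^sub>R g x \<partial>lebesgue) + c *\<^sub>R (\<integral>x. \<psi> x *\<^sub>R g' x \<partial>lebesgue))"
    using assms \<psi> by (simp add: is_weak_grad_def)
  also have "\<dots> = - (\<integral>x. \<psi> x *\<^sub>R g x + c *\<^sub>R (\<psi> x *\<^sub>R g' x) \<partial>lebesgue)"
    using 1 by (simp del: scaleR_scaleR)
  also have "\<dots> = - (\<integral>x. \<psi> x *\<^sub>R (g x + c *\<^sub>R g' x) \<partial>lebesgue)"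
    by (simp add: algebra_simps)
  finally show "(\<integral>x. (\<phi> x + c * \<phi>' x) *\<^sub>R grad \<psi> x \<partial>lebesgue)
      = - (\<integral>x. \<psi> x *\<^sub>R (g x + c *\<^sub>R g' x) \<partial>lebesgue)" .
qed

text \<open>Rescaling and translating act on each factor by an affine substitution, so the kernels
  of \<open>smear\<close> are again tensor products of functions in
  \<open>smooth_algebra\<close>.\<close>

lemma rescaled_tensor_eq:
  "tensor w (l *\<^sub>R (y - x)) = tensor (\<lambda>i s. w i (l * s + - (l * x $ i))) y"
  by (simp add: tensor_def algebra_simps)

lemma smooth_algebra_rescaled:
  "w \<in> unit_bumps \<Longrightarrow> (\<lambda>s. w i (l * s + - (l * x $ i))) \<in> smooth_algebra"
  by (rule smooth_algebra.affine) (simp add: unit_bumps_def)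

lemma test_function_rescaled_tensor:
  fixes x :: "real^'n"
  assumes "w \<in> unit_bumps" "l > 0"
  shows "test_function (\<lambda>y. tensor w (l *\<^sub>R (y - x)))"
proof -
  have "test_function (tensor (\<lambda>i s. w i (l * s + - (l * x $ i))))"
    using unit_bumps_rescaled_outside[OF assms, of _ x] smooth_algebra_rescaled[OF assms(1)]
    unfolding rescaled_tensor_eq
    by (rule test_function_tensor[of _ x "x + (1 / l) *\<^sub>R One", rotated])
  then show ?thesis
    by (simp add: rescaled_tensor_eq[abs_def])
qed

lemma grad_rescaled_tensor:
  fixes x :: "real^'n"
  assumes "w \<in> unit_bumps"
  shows "grad (\<lambda>y. tensor w (l *\<^sub>R (y - x))) y $ j = l * tensor (w(j := deriv (w j))) (l *\<^sub>R (y - x))"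
proof -
  let ?h = "\<lambda>i s. w i (l * s + - (l * x $ i))"
  have d: "deriv (?h j) = (\<lambda>s. l * deriv (w j) (l * s + - (l * x $ j)))"
  proof (rule ext, rule DERIV_imp_deriv)
    fix s
    have "((\<lambda>s. l * s + - (l * x $ j)) has_real_derivative l) (at s)"
      by (auto intro!: derivative_eq_intros)
    from DERIV_chain2[OF smooth_algebra_deriv(2) this, of "w j"] assms
    show "(?h j has_real_derivative l * deriv (w j) (l * s + - (l * x $ j))) (at s)"
      by (simp add: unit_bumps_def mult.commute)
  qed
  have "grad (tensor ?h) y $ j = tensor (?h(j := deriv (?h j))) y"
    using smooth_algebra_rescaled[OF assms] by (intro grad_tensor) auto
  also have "\<dots> = l * tensor (w(j := deriv (w j))) (l *\<^sub>R (y - x))"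
    unfolding d by (simp add: tensor_upd algebra_simps)
  finally show ?thesis
    by (simp add: rescaled_tensor_eq[abs_def])
qed

text \<open>Integration by parts for averages: the kernel itself is a test function, and the chain
  rule in its j-th variable produces the factor l.\<close>

lemma smear_weak_grad:
  fixes x :: "real^'n"
  assumes "is_weak_grad \<phi> g" "w \<in> unit_bumps" "l > 0"
  shows "l * smear (w(j := deriv (w j))) l \<phi> x = - smear w l (\<lambda>y. g y $ j) x"
proof -
  let ?k = "\<lambda>y. tensor w (l *\<^sub>R (y - x))"
  have tf: "test_function ?k" by (rule test_function_rescaled_tensor) fact+
  have li: "locally_integrable \<phi>" "locally_integrable g" using assms(1) by (auto simp: is_weak_grad_def)
  have "l * (\<integral>y. \<phi> y * tensor (w(j := deriv (w j))) (l *\<^sub>R (y - x)) \<partial>lebesgue)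
      = (\<integral>y. (\<phi> y *\<^sub>R grad ?k y) $ j \<partial>lebesgue)"
    by (simp add: grad_rescaled_tensor[OF assms(2)] mult.left_commute del: integral_mult_right_zero
        flip: integral_mult_right_zero)
  also have "\<dots> = (\<integral>y. \<phi> y *\<^sub>R grad ?k y \<partial>lebesgue) $ j"
    by (rule integral_bounded_linear[OF bounded_linear_vec_nth integrable_scaleR_grad[OF tf li(1)]])
  also have "\<dots> = - (\<integral>y. ?k y *\<^sub>R g y \<partial>lebesgue) $ j"
    using assms(1) tf by (simp add: is_weak_grad_def)
  also have "\<dots> = - (\<integral>y. (?k y *\<^sub>R g y) $ j \<partial>lebesgue)"
    by (subst integral_bounded_linear[OF bounded_linear_vec_nth integrable_test_scaleR[OF tf li(2)]]) simp
  finally have *: "l * (\<integral>y. \<phi> y * tensor (w(j := deriv (w j))) (l *\<^sub>R (y - x)) \<partial>lebesgue) =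
      - (\<integral>y. g y $ j * tensor w (l *\<^sub>R (y - x)) \<partial>lebesgue)"
    by (simp add: mult.commute)
  show ?thesis
    unfolding smear_def mult.left_commute[of l] * by simp
qed

text \<open>A form of the fundamental lemma of the calculus of variations: translates and rescalings
  of one bump already suffice, because almost every value is controlled by the averages at that
  point.\<close>

lemma AE_zero_if_smear_zero:
  fixes f :: "real^'n \<Rightarrow> real"
  assumes "locally_integrable f" "\<And>l x. l \<ge> 1 \<Longrightarrow> smear std_bump l f x = 0"
  shows "AE x in lebesgue. f x = 0"
proof -
  obtain c N where *: "c > 0" "negligible N"
    "\<And>x M. x \<notin> N \<Longrightarrow> (\<And>l. l \<ge> 1 \<Longrightarrow> \<bar>smear std_bump l f x\<bar> \<le> M) \<Longrightarrow> \<bar>f x\<bar> * c \<le> M"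
    by (rule abs_le_smear_bound[of f]) (use assms(1) locally_integrable_cbox in blast)+
  have "\<bar>f x\<bar> * c \<le> 0" if "x \<notin> N" for x
    using *(3)[OF that, of 0] assms(2) by simp
  then have "f x = 0" if "x \<notin> N" for x
    using that *(1) by (force simp: mult_le_0_iff)
  then show ?thesis
    using *(2) by (intro AE_I'[of N]) (auto simp: negligible_iff_null_sets)
qed

lemma AE_zero_if_test_integrals_zero:
  fixes f :: "real^'n \<Rightarrow> real"
  assumes "locally_integrable f" "\<And>\<psi>. test_function \<psi> \<Longrightarrow> (\<integral>x. \<psi> x * f x \<partial>lebesgue) = 0"
  shows "AE x in lebesgue. f x = 0"
proof (rule AE_zero_if_smear_zero[OF assms(1)])
  fix l :: real and x :: "real^'n" assume "l \<ge> 1"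
  then show "smear std_bump l f x = 0"
    using assms(2)[OF test_function_rescaled_tensor[OF std_bump_unit_bumps, of l x]]
    by (simp add: smear_def mult.commute)
qed

lemma is_weak_grad_unique:
  fixes g :: "real^'n \<Rightarrow> real^'n"
  assumes "is_weak_grad \<phi> g" "is_weak_grad \<phi> g'"
  shows "AE x in lebesgue. g x = g' x"
proof -
  have "AE x in lebesgue. g x $ i + -1 *\<^sub>R g' x $ i = 0" for i
  proof (rule AE_zero_if_test_integrals_zero)
    have li: "locally_integrable g" "locally_integrable g'" using assms by (auto simp: is_weak_grad_def)
    then show "locally_integrable (\<lambda>x. g x $ i + -1 *\<^sub>R g' x $ i)"
      by (intro locally_integrable_add_scaled locally_integrable_nth)
    fix \<psi> :: "real^'n \<Rightarrow> real" assume \<psi>: "test_function \<psi>"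
    note int = integrable_test_scaleR[OF \<psi> li(1)] integrable_test_scaleR[OF \<psi> li(2)]
    have "(\<integral>x. (\<psi> x *\<^sub>R g x) $ i \<partial>lebesgue) = (\<integral>x. (\<psi> x *\<^sub>R g' x) $ i \<partial>lebesgue)"
      using assms \<psi> int[THEN integral_bounded_linear[OF bounded_linear_vec_nth]]
      by (simp add: is_weak_grad_def)
    moreover have "integrable lebesgue (\<lambda>x. (\<psi> x *\<^sub>R g x) $ i)" "integrable lebesgue (\<lambda>x. (\<psi> x *\<^sub>R g' x) $ i)"
      by (intro integrable_bounded_linear[OF bounded_linear_vec_nth] int)+
    ultimately show "(\<integral>x. \<psi> x * (g x $ i + -1 *\<^sub>R g' x $ i) \<partial>lebesgue) = 0"
      by (simp add: algebra_simps)
  qed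
  then have "AE x in lebesgue. \<forall>i\<in>UNIV. g x $ i + -1 *\<^sub>R g' x $ i = 0"
    by (intro AE_finite_allI) auto
  then show ?thesis
    by eventually_elim (simp add: vec_eq_iff)
qed

lemma is_weak_div_unique:
  fixes q :: "real^'n \<Rightarrow> real"
  assumes "is_weak_div w q" "is_weak_div w q'"
  shows "AE x in lebesgue. q x = q' x"
proof -
  have "AE x in lebesgue. q x + -1 *\<^sub>R q' x = 0"
  proof (rule AE_zero_if_test_integrals_zero)
    have li: "locally_integrable q" "locally_integrable q'" using assms by (auto simp: is_weak_div_def)
    then show "locally_integrable (\<lambda>x. q x + -1 *\<^sub>R q' x)"
      by (intro locally_integrable_add_scaled)
    fix \<psi> :: "real^'n \<Rightarrow> real" assume \<psi>: "test_function \<psi>"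
    have "(\<integral>x. q x * \<psi> x \<partial>lebesgue) = (\<integral>x. q' x * \<psi> x \<partial>lebesgue)"
      using assms \<psi> by (simp add: is_weak_div_def)
    with integrable_test_scaleR[OF \<psi> li(1)] integrable_test_scaleR[OF \<psi> li(2)]
    show "(\<integral>x. \<psi> x * (q x + -1 *\<^sub>R q' x) \<partial>lebesgue) = 0"
      by (simp add: algebra_simps)
  qed
  then show ?thesis
    by eventually_elim simp
qed

section \<open>Boundedness in dimension at most three\<close>

text \<open>The mean value theorem bounds every difference quotient by \<open>B\<close>, so
  dominated convergence applies along any sequence tending to \<open>s\<close>.\<close>

lemma has_real_derivative_integral:
  fixes F :: "real \<Rightarrow> 'a \<Rightarrow> real"
  assumes s: "a < s" "s < b"
    and int: "\<And>t. a < t \<Longrightarrow> t < b \<Longrightarrow> integrable M (F t)"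
    and der: "\<And>t y. a < t \<Longrightarrow> t < b \<Longrightarrow> ((\<lambda>t. F t y) has_real_derivative F' t y) (at t)"
    and meas: "F' s \<in> borel_measurable M"
    and bd: "\<And>t y. a < t \<Longrightarrow> t < b \<Longrightarrow> \<bar>F' t y\<bar> \<le> B y" "integrable M B"
  shows "((\<lambda>t. \<integral>y. F t y \<partial>M) has_real_derivative (\<integral>y. F' s y \<partial>M)) (at s)"
proof -
  have "((\<lambda>t. ((\<integral>y. F t y \<partial>M) - (\<integral>y. F s y \<partial>M)) / (t - s)) \<longlongrightarrow> (\<integral>y. F' s y \<partial>M))
      (at s within {a<..<b})"
    unfolding tendsto_at_iff_sequentially
  proof (intro allI impI)
    fix X assume X: "\<forall>i. X i \<in> {a<..<b} - {s}" "X \<longlonglongrightarrow> s"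
    have "(\<lambda>i. \<integral>y. (F (X i) y - F s y) / (X i - s) \<partial>M) \<longlonglongrightarrow> (\<integral>y. F' s y \<partial>M)"
    proof (rule integral_dominated_convergence[where w = B])
      show "F' s \<in> borel_measurable M" "integrable M B" by fact+
      show "(\<lambda>y. (F (X i) y - F s y) / (X i - s)) \<in> borel_measurable M" for i
        using int[of "X i"] int[of s] X s by auto
      show "AE y in M. (\<lambda>i. (F (X i) y - F s y) / (X i - s)) \<longlonglongrightarrow> F' s y"
      proof (rule AE_I2)
        fix y
        have "((\<lambda>t. (F t y - F s y) / (t - s)) \<longlongrightarrow> F' s y) (at s within {a<..<b})"
          using has_field_derivative_at_within[OF der[OF s, of y], of "{a<..<b}"]
          by (simp add: has_field_derivative_iff)
        then show "(\<lambda>i. (F (X i) y - F s y) / (X i - s)) \<longlonglongrightarrow> F' s y"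
          unfolding tendsto_at_iff_sequentially using X by (auto simp: comp_def)
      qed
      show "AE y in M. norm ((F (X i) y - F s y) / (X i - s)) \<le> B y" for i
      proof (rule AE_I2)
        fix y
        have "norm (F (X i) y - F s y) \<le> B y * norm (X i - s)"
        proof (rule field_differentiable_bound[of "{a<..<b}" "\<lambda>t. F t y" "\<lambda>t. F' t y"])
          fix t assume "t \<in> {a<..<b}"
          then show "((\<lambda>t. F t y) has_real_derivative F' t y) (at t within {a<..<b})"
            using der by (auto intro: has_field_derivative_at_within)
        qed (use X s bd in auto)
        moreover have "X i \<noteq> s" using X by auto
        ultimately show "norm ((F (X i) y - F s y) / (X i - s)) \<le> B y"
          by (simp add: abs_divide pos_divide_le_eq)
      qed
    qed
    moreover have "(\<integral>y. (F (X i) y - F s y) / (X i - s) \<partial>M) =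
        ((\<integral>y. F (X i) y \<partial>M) - (\<integral>y. F s y \<partial>M)) / (X i - s)" for i
      using int[of "X i"] int[of s] X s by (simp add: Bochner_Integration.integral_diff)
    ultimately show "((\<lambda>t. ((\<integral>y. F t y \<partial>M) - (\<integral>y. F s y \<partial>M)) / (t - s)) \<circ> X)
        \<longlonglongrightarrow> (\<integral>y. F' s y \<partial>M)"
      by (simp only: comp_def)
  qed
  then show ?thesis
    using s by (simp add: has_field_derivative_iff at_within_open[of s "{a<..<b}"])
qed

text \<open>The derivative of \<open>t \<mapsto> t\<^sup>n w (t u)\<close> is \<open>t\<^sup>n\<^sup>-\<^sup>1\<close> times the divergence of
  \<open>z \<mapsto> w z *\<^sub>R z\<close> at \<open>t u\<close>; the summands of this divergence are again tensor products.\<close>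

lemma unit_bumps_upd_radial: "w \<in> unit_bumps \<Longrightarrow> w(i := deriv (\<lambda>s. s * w i s)) \<in> unit_bumps"
  using unit_bumps_upd_deriv[OF unit_bumps_upd_ident, of w i i] by simp

lemma tensor_upd_radial:
  assumes "w \<in> unit_bumps"
  shows "tensor (w(i := deriv (\<lambda>s. s * w i s))) z = tensor w z + z $ i * tensor (w(i := deriv (w i))) z"
proof -
  have "deriv (\<lambda>s. s * w i s) t = w i t + t * deriv (w i) t" for t
    using assms by (intro DERIV_imp_deriv) (auto simp: unit_bumps_def intro!: derivative_eq_intros
        smooth_algebra_deriv(2))
  moreover have "tensor w z = w i (z $ i) * (\<Prod>j\<in>UNIV - {i}. w j (z $ j))"
    using tensor_upd[of w i "w i" z] by simp
  ultimately show ?thesis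
    by (simp add: tensor_upd algebra_simps)
qed

text \<open>Each of the n radial summands contains one copy of \<open>tensor w\<close>; together
  these account for the derivative of t^n, and the remaining terms are the derivative of W(t u) in
  t.\<close>

lemma rescaled_tensor_has_derivative:
  fixes u :: "real^'n"
  assumes "w \<in> unit_bumps" "t > 0"
  shows "((\<lambda>t. t ^ CARD('n) * tensor w (t *\<^sub>R u)) has_real_derivative
     t ^ CARD('n) / t * (\<Sum>i\<in>UNIV. tensor (w(i := deriv (\<lambda>s. s * w i s))) (t *\<^sub>R u))) (at t)"
proof -
  have "((\<lambda>t. t *\<^sub>R u) has_derivative (\<lambda>h. h *\<^sub>R u)) (at t)"
    by (auto intro!: derivative_eq_intros)
  from has_derivative_compose[OF this tensor_has_derivative, of w] assms(1)
  have "((\<lambda>t. tensor w (t *\<^sub>R u)) has_real_derivative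
      (\<Sum>i\<in>UNIV. u $ i * tensor (w(i := deriv (w i))) (t *\<^sub>R u))) (at t)"
    by (simp add: unit_bumps_def has_field_derivative_def mult.assoc mult_commute_abs flip: sum_distrib_left)
  from DERIV_mult'[OF DERIV_pow[of "CARD('n)"] this]
  have "((\<lambda>t. t ^ CARD('n) * tensor w (t *\<^sub>R u)) has_real_derivative
      t ^ CARD('n) * (\<Sum>i\<in>UNIV. u $ i * tensor (w(i := deriv (w i))) (t *\<^sub>R u))
      + real CARD('n) * t ^ (CARD('n) - Suc 0) * tensor w (t *\<^sub>R u)) (at t)" .
  \<comment> \<open>The power rule leaves a truncated subtraction in the exponent; positivity of the
    dimension makes it harmless.\<close>
  moreover have "t ^ CARD('n) = t * t ^ (CARD('n) - Suc 0)"
    by (metis One_nat_def Suc_pred power_Suc zero_less_card_finite)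
  ultimately show ?thesis
    using assms(2) by (simp add: tensor_upd_radial[OF assms(1)] sum.distrib sum_distrib_left algebra_simps)
qed

lemma smear_has_derivative:
  fixes f :: "real^'n \<Rightarrow> real"
  assumes w: "w \<in> unit_bumps" and l: "l > 0" and f: "\<And>a b. f absolutely_integrable_on cbox a b"
  shows "((\<lambda>l. smear w l f x) has_real_derivative
     (\<Sum>i\<in>UNIV. smear (w(i := deriv (\<lambda>s. s * w i s))) l f x) / l) (at l)"
proof -
  let ?V = "\<lambda>i. tensor (w(i := deriv (\<lambda>s. s * w i s)))"
  let ?F' = "\<lambda>t y. f y * (t ^ CARD('n) / t * (\<Sum>i\<in>UNIV. ?V i (t *\<^sub>R (y - x))))"
  have "\<exists>M>0. \<forall>z. \<bar>?V i z\<bar> \<le> M" for i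
    by (rule unit_bumps_bounded[OF unit_bumps_upd_radial[OF w, of i]]) blast
  then obtain M where M: "\<And>i. M i > 0" "\<And>i z. \<bar>?V i z\<bar> \<le> M i"
    by metis
  \<comment> \<open>For t > l / 2 the kernel lives on a cube of side 1 / t < 2 / l, so
    \<open>?C\<close> contains the supports for all t in (l / 2, 2 l). The constant in
    \<open>?B\<close> bounds t^n / t and the sum of the kernels over the same range.\<close>
  let ?C = "cbox x (x + (2 / l) *\<^sub>R One)"
  let ?B = "\<lambda>y. (2 * l) ^ CARD('n) / (l / 2) * sum M UNIV * (indicator ?C y *\<^sub>R \<bar>f y\<bar>)"
  have intV: "integrable lebesgue (\<lambda>y. f y * ?V i (t *\<^sub>R (y - x)))" if "t > 0" for t i
    by (intro integrable_rescaled_tensor unit_bumps_upd_radial w that f)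
  have "((\<lambda>t. \<integral>y. f y * (t ^ CARD('n) * tensor w (t *\<^sub>R (y - x))) \<partial>lebesgue) has_real_derivative
      (\<integral>y. ?F' l y \<partial>lebesgue)) (at l)"
  proof (rule has_real_derivative_integral[where a = "l / 2" and b = "2 * l" and B = ?B])
    show "l / 2 < l" "l < 2 * l" using l by auto
    fix t :: real assume t: "l / 2 < t" "t < 2 * l"
    then have "t > 0" using l by simp
    show "integrable lebesgue (\<lambda>y. f y * (t ^ CARD('n) * tensor w (t *\<^sub>R (y - x))))"
      unfolding mult.left_commute[of "f _"]
      by (intro integrable_mult_right integrable_rescaled_tensor w \<open>t > 0\<close> f)
    fix y
    show "((\<lambda>t. f y * (t ^ CARD('n) * tensor w (t *\<^sub>R (y - x)))) has_real_derivative ?F' t y) (at t)"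
      by (intro DERIV_cmult rescaled_tensor_has_derivative w \<open>t > 0\<close>)
    show "\<bar>?F' t y\<bar> \<le> ?B y"
    proof (cases "y \<in> ?C")
      case True
      have "\<bar>\<Sum>i\<in>UNIV. ?V i (t *\<^sub>R (y - x))\<bar> \<le> (\<Sum>i\<in>UNIV. M i)"
        by (rule order_trans[OF sum_abs sum_mono]) (rule M(2))
      moreover have "t ^ CARD('n) / t \<le> (2 * l) ^ CARD('n) / (l / 2)"
        using t l by (intro frac_le power_mono) auto
      ultimately have "(t ^ CARD('n) / t) * \<bar>\<Sum>i\<in>UNIV. ?V i (t *\<^sub>R (y - x))\<bar>
          \<le> (2 * l) ^ CARD('n) / (l / 2) * (\<Sum>i\<in>UNIV. M i)"
        using l t \<open>t > 0\<close> by (intro mult_mono) auto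
      then have "\<bar>f y\<bar> * ((t ^ CARD('n) / t) * \<bar>\<Sum>i\<in>UNIV. ?V i (t *\<^sub>R (y - x))\<bar>)
          \<le> \<bar>f y\<bar> * ((2 * l) ^ CARD('n) / (l / 2) * (\<Sum>i\<in>UNIV. M i))"
        by (rule mult_left_mono) simp
      moreover have "\<bar>?F' t y\<bar> = \<bar>f y\<bar> * ((t ^ CARD('n) / t) * \<bar>\<Sum>i\<in>UNIV. ?V i (t *\<^sub>R (y - x))\<bar>)"
        using \<open>t > 0\<close> by (simp add: abs_mult)
      ultimately show ?thesis
        using True by (simp only: indicator_simps scaleR_one mult.commute)
    next
      case False
      have "1 / t \<le> 2 / l" using t l by (simp add: field_simps)
      have "cbox x (x + (1 / t) *\<^sub>R One) \<subseteq> ?C"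
      proof
        fix z assume z: "z \<in> cbox x (x + (1 / t) *\<^sub>R One)"
        have "x $ i \<le> z $ i \<and> z $ i \<le> x $ i + 2 / l" for i
        proof -
          have "x $ i \<le> z $ i" "z $ i \<le> x $ i + 1 / t" using z by (simp_all add: mem_box_cart)
          with \<open>1 / t \<le> 2 / l\<close> show ?thesis by linarith
        qed
        then show "z \<in> ?C" by (simp add: mem_box_cart)
      qed
      with False have "y \<notin> cbox x (x + (1 / t) *\<^sub>R One)" by blast
      then have "?V i (t *\<^sub>R (y - x)) = 0" for i
        by (rule unit_bumps_rescaled_outside[OF unit_bumps_upd_radial[OF w] \<open>t > 0\<close>])
      with False show ?thesis by simp
    qed
  next
    have eq: "?F' l = (\<lambda>y. l ^ CARD('n) / l * (\<Sum>i\<in>UNIV. f y * ?V i (l *\<^sub>R (y - x))))"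
      by (simp add: sum_distrib_left algebra_simps)
    show "?F' l \<in> borel_measurable lebesgue"
      unfolding eq
      by (rule borel_measurable_integrable)
        (intro integrable_mult_right Bochner_Integration.integrable_sum intV l)
    have "set_integrable lebesgue ?C (\<lambda>y. \<bar>f y\<bar>)"
      by (rule set_integrable_abs[OF f])
    then show "integrable lebesgue ?B"
      unfolding set_integrable_def by (rule integrable_mult_right)
  qed
  moreover have "(\<integral>y. f y * (t ^ CARD('n) * tensor w (t *\<^sub>R (y - x))) \<partial>lebesgue) = smear w t f x" for t
    unfolding smear_def mult.left_commute[of "f _"] by simp
  moreover have "(\<integral>y. ?F' l y \<partial>lebesgue) =
      (\<integral>y. l ^ CARD('n) / l * (\<Sum>i\<in>UNIV. f y * ?V i (l *\<^sub>R (y - x))) \<partial>lebesgue)"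
    by (simp add: sum_distrib_left algebra_simps)
  moreover have "\<dots> = (\<Sum>i\<in>UNIV. smear (w(i := deriv (\<lambda>s. s * w i s))) l f x) / l"
    using intV[OF l] by (simp add: smear_def sum_distrib_left sum_divide_distrib)
  ultimately show ?thesis by (simp only:)
qed

text \<open>One factor 1 / l comes from differentiating the rescaled kernel, the other from moving
  its divergence onto \<open>f\<close>. These two powers drive the gain of exponents below.\<close>

lemma smear_weak_grad_has_derivative:
  fixes f :: "real^'n \<Rightarrow> real"
  assumes "w \<in> unit_bumps" "l > 0" "is_weak_grad f g"
  shows "((\<lambda>l. smear w l f x) has_real_derivative
     - (\<Sum>i\<in>UNIV. smear (w(i := \<lambda>s. s * w i s)) l (\<lambda>y. g y $ i) x) / l\<^sup>2) (at l)"
proof -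
  have "smear (w(i := deriv (\<lambda>s. s * w i s))) l f x =
      - smear (w(i := \<lambda>s. s * w i s)) l (\<lambda>y. g y $ i) x / l" for i
    using smear_weak_grad[OF assms(3) unit_bumps_upd_ident[OF assms(1)] assms(2), of i i x] assms(2)
    by (simp add: field_simps)
  then have "(\<Sum>i\<in>UNIV. smear (w(i := deriv (\<lambda>s. s * w i s))) l f x) / l
      = - (\<Sum>i\<in>UNIV. smear (w(i := \<lambda>s. s * w i s)) l (\<lambda>y. g y $ i) x) / l\<^sup>2"
    by (simp add: power2_eq_square sum_divide_distrib sum_negf)
  moreover have "f absolutely_integrable_on cbox a b" for a b
    using assms(3) by (simp add: is_weak_grad_def locally_integrable_cbox)
  ultimately show ?thesis
    using smear_has_derivative[OF assms(1,2), of f x] by simp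
qed

lemma smear_abs_le:
  fixes f :: "real^'n \<Rightarrow> real"
  assumes "w \<in> unit_bumps" "\<And>a b. f absolutely_integrable_on cbox a b"
  obtains K where "K > 0" "\<And>x l. l > 0 \<Longrightarrow>
    \<bar>smear w l f x\<bar> \<le> K * l ^ CARD('n) * integral (cbox x (x + (1 / l) *\<^sub>R One)) (\<lambda>y. \<bar>f y\<bar>)"
proof -
  obtain K where K: "K > 0" "\<And>x. \<bar>tensor w x\<bar> \<le> K"
    using unit_bumps_bounded[OF assms(1)] by blast
  have "\<bar>smear w l f x\<bar> \<le> K * l ^ CARD('n) * integral (cbox x (x + (1 / l) *\<^sub>R One)) (\<lambda>y. \<bar>f y\<bar>)"
    if "l > 0" for x l
  proof -
    let ?C = "cbox x (x + (1 / l) *\<^sub>R One)"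
    have fi: "(\<lambda>y. \<bar>f y\<bar>) integrable_on ?C"
      using assms(2)[of x "x + (1 / l) *\<^sub>R One"] by (auto simp: absolutely_integrable_on_def)
    note hi = smear_integral[OF assms(1) that assms(2), of x]
    have "\<bar>smear w l f x / l ^ CARD('n)\<bar> = norm (integral ?C (\<lambda>y. f y * tensor w (l *\<^sub>R (y - x))))"
      using integral_unique[OF hi] by simp
    also have "\<dots> \<le> integral ?C (\<lambda>y. K * \<bar>f y\<bar>)"
    proof (rule integral_norm_bound_integral)
      show "(\<lambda>y. f y * tensor w (l *\<^sub>R (y - x))) integrable_on ?C" using hi by blast
      show "(\<lambda>y. K * \<bar>f y\<bar>) integrable_on ?C" using integrable_on_cmult_left[OF fi, of K] by simp
      show "norm (f y * tensor w (l *\<^sub>R (y - x))) \<le> K * \<bar>f y\<bar>" for y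
        using mult_right_mono[OF K(2)[of "l *\<^sub>R (y - x)"], of "\<bar>f y\<bar>"] by (simp add: abs_mult mult.commute)
    qed
    also have "\<dots> = K * integral ?C (\<lambda>y. \<bar>f y\<bar>)" by simp
    finally show ?thesis
      using that by (simp add: abs_divide pos_divide_le_eq mult_ac)
  qed
  with K(1) show thesis using that by blast
qed

text \<open>The averaging cubes extend from their corner by at most 1 in each positive direction.
  This is the origin of the enlarged corner \<open>b + One\<close> in the bounds on
  averages.\<close>

lemma sub_cube_subset:
  fixes x :: "real^'n"
  assumes "x \<in> cbox a b" "l \<ge> 1"
  shows "cbox x (x + (1 / l) *\<^sub>R One) \<subseteq> cbox a (b + One)"
proof
  fix y assume y: "y \<in> cbox x (x + (1 / l) *\<^sub>R One)"
  have "a $ i \<le> y $ i \<and> y $ i \<le> b $ i + 1" for i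
  proof -
    have "a $ i \<le> x $ i" "x $ i \<le> b $ i" "x $ i \<le> y $ i" "y $ i \<le> x $ i + 1 / l"
      using y assms(1) by (auto simp: mem_box_cart)
    moreover have "1 / l \<le> 1" using assms(2) by simp
    ultimately show ?thesis by linarith
  qed
  then show "y \<in> cbox a (b + One)" by (simp add: mem_box_cart)
qed

text \<open>The cube has volume l^(-n), so the mean of |f| over it costs only half of the factor l^n
  once the square integral is bounded. A weighted pointwise inequality takes the place of
  Cauchy-Schwarz.\<close>

lemma smear_bound_square_integrable:
  fixes f :: "real^'n \<Rightarrow> real"
  assumes w: "w \<in> unit_bumps" and f: "\<And>a b. f absolutely_integrable_on cbox a b"
    and f2: "(\<lambda>y. (f y)\<^sup>2) integrable_on cbox a (b + One)"
  shows "\<exists>C. \<forall>x\<in>cbox a b. \<forall>l\<ge>1. \<bar>smear w l f x\<bar> \<le> C * l powr (CARD('n) / 2)"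
proof -
  obtain K where K: "K > 0" "\<And>x l. l > 0 \<Longrightarrow>
    \<bar>smear w l f x\<bar> \<le> K * l ^ CARD('n) * integral (cbox x (x + (1 / l) *\<^sub>R One)) (\<lambda>y. \<bar>f y\<bar>)"
    using smear_abs_le[OF w f] by blast
  define G where "G = integral (cbox a (b + One)) (\<lambda>y. (f y)\<^sup>2)"
  have "\<bar>smear w l f x\<bar> \<le> K * (G + 1) / 2 * l powr (CARD('n) / 2)" if x: "x \<in> cbox a b" and l: "l \<ge> 1" for x l
  proof -
    let ?C = "cbox x (x + (1 / l) *\<^sub>R One)"
    \<comment> \<open>This weight balances f^2 / (2 q) against q / 2: since q^2 is the reciprocal of
      the volume, both integrals are of order 1 / q.\<close>
    define q where "q = l powr (CARD('n) / 2)"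
    have q: "q > 0" "l ^ CARD('n) = q * q"
      using l by (auto simp: q_def simp flip: powr_add powr_realpow)
    have sub: "?C \<subseteq> cbox a (b + One)" by (rule sub_cube_subset[OF x l])
    have fi: "(\<lambda>y. \<bar>f y\<bar>) integrable_on ?C"
      using f[of x "x + (1 / l) *\<^sub>R One"] by (auto simp: absolutely_integrable_on_def)
    have f2i: "(\<lambda>y. (f y)\<^sup>2) integrable_on ?C"
      using integrable_on_subcbox[OF f2 sub] .
    have cont: "measure lborel ?C = 1 / (q * q)"
      using l by (subst content_cbox) (simp_all add: inner_add_left power_one_over flip: q(2))
    have "integral ?C (\<lambda>y. \<bar>f y\<bar>) \<le> integral ?C (\<lambda>y. (1 / (2 * q)) * (f y)\<^sup>2 + q / 2)"
    proof (rule integral_le[OF fi])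
      show "(\<lambda>y. 1 / (2 * q) * (f y)\<^sup>2 + q / 2) integrable_on ?C"
        using integrable_on_cmult_left[OF f2i, of "1 / (2 * q)"] by (intro integrable_add integrable_const) simp
      fix y
      have "0 \<le> (\<bar>f y\<bar> - q)\<^sup>2" by simp
      then show "\<bar>f y\<bar> \<le> 1 / (2 * q) * (f y)\<^sup>2 + q / 2"
        using q(1) by (simp add: power2_diff field_simps power2_eq_square)
    qed
    also have "\<dots> = 1 / (2 * q) * integral ?C (\<lambda>y. (f y)\<^sup>2) + q / 2 * (1 / (q * q))"
      using cont integrable_on_cmult_left[OF f2i, of "1 / (2 * q)"]
      by (subst integral_add) (auto simp: integrable_const)
    also have "\<dots> \<le> 1 / (2 * q) * G + q / 2 * (1 / (q * q))"
      unfolding G_def using q(1)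
      by (intro add_mono mult_left_mono integral_subset_le[OF sub f2i f2]) auto
    finally have "K * (q * q) * integral ?C (\<lambda>y. \<bar>f y\<bar>) \<le> K * (q * q) * (1 / (2 * q) * G + q / 2 * (1 / (q * q)))"
      using K(1) by (intro mult_left_mono) auto
    also have "\<dots> = K * (G + 1) / 2 * q"
      using q(1) by (simp add: field_simps)
    finally show ?thesis
      using K(2)[of l x] l q(2) by (simp add: q_def)
  qed
  then show ?thesis by blast
qed

text \<open>The l-derivative of the averages of \<open>f\<close> is of order l^(p - 2), so
  integrating it from 1 gives a constant plus a multiple of l^(p - 1). For p = 1 a logarithm would
  appear.\<close>

lemma smear_bound_from_weak_grad:
  fixes f :: "real^'n \<Rightarrow> real"
  assumes fg: "is_weak_grad f g" and p: "p \<noteq> 1"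
    and g: "\<And>w i. w \<in> unit_bumps \<Longrightarrow>
      \<exists>C. \<forall>x\<in>cbox a b. \<forall>l\<ge>1. \<bar>smear w l (\<lambda>y. g y $ i) x\<bar> \<le> C * l powr p"
    and w: "w \<in> unit_bumps"
  shows "\<exists>C. \<forall>x\<in>cbox a b. \<forall>l\<ge>1. \<bar>smear w l f x\<bar> \<le> C * (1 + l powr (p - 1))"
proof -
  have f: "f absolutely_integrable_on cbox a b" for a b
    using fg by (simp add: is_weak_grad_def locally_integrable_cbox)
  obtain K where K: "K > 0" "\<And>x l. l > 0 \<Longrightarrow>
    \<bar>smear w l f x\<bar> \<le> K * l ^ CARD('n) * integral (cbox x (x + (1 / l) *\<^sub>R One)) (\<lambda>y. \<bar>f y\<bar>)"
    using smear_abs_le[OF w f] by blast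
  have fi: "(\<lambda>y. \<bar>f y\<bar>) integrable_on cbox c d" for c d
    using f[of c d] by (auto simp: absolutely_integrable_on_def)
  \<comment> \<open>A bound at the starting scale l = 1, uniform in x: the unit cubes issuing from
    \<open>cbox a b\<close> all lie in one bounded box.\<close>
  define C0 where "C0 = K * integral (cbox a (b + One)) (\<lambda>y. \<bar>f y\<bar>)"
  have C0: "\<bar>smear w 1 f x\<bar> \<le> C0" if "x \<in> cbox a b" for x
  proof -
    have "integral (cbox x (x + (1 / 1) *\<^sub>R One)) (\<lambda>y. \<bar>f y\<bar>) \<le> integral (cbox a (b + One)) (\<lambda>y. \<bar>f y\<bar>)"
      by (intro integral_subset_le sub_cube_subset that fi) auto
    then have "K * integral (cbox x (x + (1 / 1) *\<^sub>R One)) (\<lambda>y. \<bar>f y\<bar>) \<le> C0"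
      unfolding C0_def using K(1) by (intro mult_left_mono) auto
    with K(2)[of 1 x] show ?thesis by simp
  qed
  have "\<forall>i. \<exists>C. \<forall>x\<in>cbox a b. \<forall>l\<ge>1.
      \<bar>smear (w(i := \<lambda>s. s * w i s)) l (\<lambda>y. g y $ i) x\<bar> \<le> C * l powr p"
    by (intro allI g unit_bumps_upd_ident w)
  from choice[OF this] obtain C where C: "\<forall>i. \<forall>x\<in>cbox a b. \<forall>l\<ge>1.
      \<bar>smear (w(i := \<lambda>s. s * w i s)) l (\<lambda>y. g y $ i) x\<bar> \<le> C i * l powr p"
    by blast
  define D where "D = (\<Sum>i\<in>UNIV. \<bar>C i\<bar>)"
  have "\<bar>smear w l f x\<bar> \<le> (C0 + D / \<bar>p - 1\<bar>) * (1 + l powr (p - 1))" if x: "x \<in> cbox a b" and l: "l \<ge> 1" for x l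
  proof -
    let ?A = "\<lambda>l. smear w l f x"
    let ?A' = "\<lambda>l. - (\<Sum>i\<in>UNIV. smear (w(i := \<lambda>s. s * w i s)) l (\<lambda>y. g y $ i) x) / l\<^sup>2"
    \<comment> \<open>A primitive of D t^(p - 2), which dominates the derivative of
      \<open>?A\<close>. Both \<open>?P - ?A\<close> and \<open>?P + ?A\<close> are then
      nondecreasing, and this controls \<open>?A\<close> without integrating its derivative.\<close>
    let ?P = "\<lambda>l. D * (l powr (p - 1) / (p - 1))"
    have A: "(?A has_real_derivative ?A' t) (at t)" if "t \<ge> 1" for t
      using that by (intro smear_weak_grad_has_derivative w fg) simp
    have A': "\<bar>?A' t\<bar> \<le> D * t powr (p - 2)" if t: "t \<ge> 1" for t
    proof -
      have "\<bar>\<Sum>i\<in>UNIV. smear (w(i := \<lambda>s. s * w i s)) t (\<lambda>y. g y $ i) x\<bar> \<le> (\<Sum>i\<in>UNIV. \<bar>C i\<bar> * t powr p)"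
      proof (rule order_trans[OF sum_abs sum_mono])
        fix i
        show "\<bar>smear (w(i := \<lambda>s. s * w i s)) t (\<lambda>y. g y $ i) x\<bar> \<le> \<bar>C i\<bar> * t powr p"
          using C[rule_format, OF x t, of i] mult_right_mono[OF abs_ge_self[of "C i"], of "t powr p"] by simp
      qed
      then have "\<bar>?A' t\<bar> \<le> D * t powr p / t\<^sup>2"
        by (simp add: abs_divide divide_right_mono D_def sum_distrib_right)
      also have "D * t powr p / t\<^sup>2 = D * t powr (p - 2)" using t by (simp add: powr_diff)
      finally show ?thesis .
    qed
    have P: "(?P has_real_derivative D * t powr (p - 2)) (at t)" if "t \<ge> 1" for t
    proof -
      have "((\<lambda>t. t powr (p - 1)) has_real_derivative (p - 1) * t powr (p - 1 - 1)) (at t)"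
        using that by (intro has_real_derivative_powr) simp
      from DERIV_cmult[OF DERIV_cdivide[OF this, of "p - 1"], of D]
      show ?thesis
        using p by simp
    qed
    have "?P 1 - ?A 1 \<le> ?P l - ?A l"
    proof (rule DERIV_nonneg_imp_nondecreasing[OF l])
      fix t assume t: "1 \<le> t" "t \<le> l"
      show "\<exists>y. ((\<lambda>t. ?P t - ?A t) has_real_derivative y) (at t) \<and> 0 \<le> y"
        by (rule exI, rule conjI, rule DERIV_diff[OF P[OF t(1)] A[OF t(1)]])
          (use A'[OF t(1)] in linarith)
    qed
    moreover have "?P 1 + ?A 1 \<le> ?P l + ?A l"
    proof (rule DERIV_nonneg_imp_nondecreasing[OF l])
      fix t assume t: "1 \<le> t" "t \<le> l"
      show "\<exists>y. ((\<lambda>t. ?P t + ?A t) has_real_derivative y) (at t) \<and> 0 \<le> y"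
        by (rule exI, rule conjI, rule DERIV_add[OF P[OF t(1)] A[OF t(1)]])
          (use A'[OF t(1)] in linarith)
    qed
    ultimately have "\<bar>?A l\<bar> \<le> \<bar>?A 1\<bar> + (\<bar>?P l\<bar> + \<bar>?P 1\<bar>)"
      by linarith
    also have "\<bar>?P l\<bar> + \<bar>?P 1\<bar> = D / \<bar>p - 1\<bar> * (1 + l powr (p - 1))"
      by (simp add: D_def abs_mult abs_divide sum_nonneg algebra_simps add_divide_distrib)
    also have "\<bar>?A 1\<bar> \<le> C0" by (rule C0[OF x])
    also have "C0 \<le> C0 * (1 + l powr (p - 1))"
      using C0[OF x] abs_ge_zero[of "?A 1"] by (simp add: algebra_simps)
    finally show ?thesis by (simp add: algebra_simps)
  qed
  then show ?thesis by blast
qed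

text \<open>The exponents run 3/2, 1/2, -1/2 for second derivatives, first derivatives and the
  function. Starting at 3/2 also in dimension 2 avoids the exceptional exponent 1, which n / 2 would
  hit.\<close>

lemma weak_second_derivatives_imp_bounded:
  fixes f :: "real^'n \<Rightarrow> real"
  assumes dim: "CARD('n) \<le> 3" and fg: "is_weak_grad f g" and gG: "\<And>i. is_weak_grad (\<lambda>x. g x $ i) (G i)"
    and G2: "\<And>i j. (\<lambda>x. (G i x $ j)\<^sup>2) integrable_on cbox a (b + One)"
  shows "\<exists>M. AE x in lebesgue. x \<in> cbox a b \<longrightarrow> \<bar>f x\<bar> \<le> M"
proof -
  have 1: "\<exists>C. \<forall>x\<in>cbox a b. \<forall>l\<ge>1. \<bar>smear w l (\<lambda>y. G i y $ j) x\<bar> \<le> C * l powr (3/2)"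
    if w: "w \<in> unit_bumps" for w i j
  proof -
    have "(\<lambda>y. G i y $ j) absolutely_integrable_on cbox c d" for c d
      using gG[of i] by (simp add: is_weak_grad_def locally_integrable_cbox locally_integrable_nth)
    then obtain C where C: "\<And>x l. x\<in>cbox a b \<Longrightarrow> l\<ge>1 \<Longrightarrow> \<bar>smear w l (\<lambda>y. G i y $ j) x\<bar> \<le> C * l powr (CARD('n) / 2)"
      using smear_bound_square_integrable[OF w, of "\<lambda>y. G i y $ j" a b] G2 by blast
    have "\<bar>smear w l (\<lambda>y. G i y $ j) x\<bar> \<le> \<bar>C\<bar> * l powr (3/2)" if "x \<in> cbox a b" "l \<ge> 1" for x l
    proof -
      have "C * l powr (CARD('n) / 2) \<le> \<bar>C\<bar> * l powr (3/2)"
        using that(2) dim by (intro mult_mono powr_mono) auto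
      with C[OF that] show ?thesis by linarith
    qed
    then show ?thesis by blast
  qed
  have 2: "\<exists>C. \<forall>x\<in>cbox a b. \<forall>l\<ge>1. \<bar>smear w l (\<lambda>y. g y $ i) x\<bar> \<le> C * l powr (1/2)"
    if w: "w \<in> unit_bumps" for w i
  proof -
    obtain C where C: "\<And>x l. x\<in>cbox a b \<Longrightarrow> l\<ge>1 \<Longrightarrow> \<bar>smear w l (\<lambda>y. g y $ i) x\<bar> \<le> C * (1 + l powr (3/2 - 1))"
      using smear_bound_from_weak_grad[OF gG[of i] _ 1 w] by force
    \<comment> \<open>For l >= 1 the constant part is absorbed into l^(1/2), so the next integration
      starts from a pure power.\<close>
    have "\<bar>smear w l (\<lambda>y. g y $ i) x\<bar> \<le> (2 * \<bar>C\<bar>) * l powr (1/2)" if "x \<in> cbox a b" "l \<ge> 1" for x l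
    proof -
      have "1 \<le> l powr (1/2)" using that(2) by (simp add: ge_one_powr_ge_zero)
      then have "C * (1 + l powr (1/2)) \<le> \<bar>C\<bar> * (2 * l powr (1/2))"
        by (intro mult_mono) auto
      with C[OF that] show ?thesis by simp
    qed
    then show ?thesis by blast
  qed
  obtain C where C: "\<And>x l. x\<in>cbox a b \<Longrightarrow> l\<ge>1 \<Longrightarrow> \<bar>smear std_bump l f x\<bar> \<le> C * (1 + l powr (1/2 - 1))"
    using smear_bound_from_weak_grad[OF fg _ 2 std_bump_unit_bumps] by force
  have C2: "\<bar>smear std_bump l f x\<bar> \<le> 2 * \<bar>C\<bar>" if "x \<in> cbox a b" "l \<ge> 1" for x l
  proof -
    have "l powr (1/2 - 1) \<le> l powr 0" using that(2) by (intro powr_mono) auto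
    then have "C * (1 + l powr (1/2 - 1)) \<le> \<bar>C\<bar> * 2"
      using that(2) by (intro mult_mono) auto
    with C[OF that] show ?thesis by simp
  qed
  have f: "f absolutely_integrable_on cbox a b" for a b
    using fg by (simp add: is_weak_grad_def locally_integrable_cbox)
  obtain c N where *: "c > 0" "negligible N"
    "\<And>x M. x \<notin> N \<Longrightarrow> (\<And>l. l \<ge> 1 \<Longrightarrow> \<bar>smear std_bump l f x\<bar> \<le> M) \<Longrightarrow> \<bar>f x\<bar> * c \<le> M"
    by (rule abs_le_smear_bound[OF f]) blast
  have "\<bar>f x\<bar> \<le> 2 * \<bar>C\<bar> / c" if "x \<notin> N" "x \<in> cbox a b" for x
    using *(3)[OF that(1) C2[OF that(2)]] *(1) by (simp add: pos_le_divide_eq)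
  then have "AE x in lebesgue. x \<in> cbox a b \<longrightarrow> \<bar>f x\<bar> \<le> 2 * \<bar>C\<bar> / c"
    using *(2) by (intro AE_I'[of N]) (auto simp: negligible_iff_null_sets)
  then show ?thesis by blast
qed

section \<open>Symmetric forms and skew-coupled systems\<close>

text \<open>Definiteness is left out because null functions have zero form. The single operation u +
  c v encodes the vector space structure, and general values in a real vector space admit gradients
  as well as scalar functions.\<close>

locale semi_inner =
  fixes V :: "('x \<Rightarrow> 'b::real_vector) set" and a :: "('x \<Rightarrow> 'b) \<Rightarrow> ('x \<Rightarrow> 'b) \<Rightarrow> real"
  assumes closed: "u \<in> V \<Longrightarrow> v \<in> V \<Longrightarrow> (\<lambda>x. u x + c *\<^sub>R v x) \<in> V"
    and lin: "u \<in> V \<Longrightarrow> v \<in> V \<Longrightarrow> w \<in> V \<Longrightarrow> a (\<lambda>x. u x + c *\<^sub>R v x) w = a u w + c * a v w"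
    and sym: "u \<in> V \<Longrightarrow> v \<in> V \<Longrightarrow> a u v = a v u"
    and nonneg: "u \<in> V \<Longrightarrow> a u u \<ge> 0"
begin

lemma lin_right:
  assumes "u \<in> V" "v \<in> V" "w \<in> V"
  shows "a w (\<lambda>x. u x + c *\<^sub>R v x) = a w u + c * a w v"
  using lin[OF assms, of c] sym[OF assms(3) closed[OF assms(1,2)], of c] sym[OF assms(3)] assms by simp

lemma closed_diff: "u \<in> V \<Longrightarrow> v \<in> V \<Longrightarrow> (\<lambda>x. u x - v x) \<in> V"
  using closed[of u v "-1"] by simp

lemma lin_diff: "u \<in> V \<Longrightarrow> v \<in> V \<Longrightarrow> w \<in> V \<Longrightarrow> a (\<lambda>x. u x - v x) w = a u w - a v w"
  using lin[of u v w "-1"] by simp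

lemma expand_square:
  assumes "u \<in> V" "v \<in> V"
  shows "a (\<lambda>x. u x + c *\<^sub>R v x) (\<lambda>x. u x + c *\<^sub>R v x) = a u u + 2 * c * a u v + c\<^sup>2 * a v v"
  using assms closed[OF assms, of c]
  by (simp add: lin lin_right sym[of v u] power2_eq_square algebra_simps)

lemma cauchy_schwarz:
  assumes "u \<in> V" "v \<in> V"
  shows "(a u v)\<^sup>2 \<le> a u u * a v v"
proof -
  have *: "0 \<le> a u u + 2 * c * a u v + c\<^sup>2 * a v v" for c
    using nonneg[OF closed[OF assms, of c]] expand_square[OF assms, of c] by simp
  show ?thesis
  proof (cases "a v v = 0")
    case True
    have "a u v = 0"
    proof (rule ccontr)
      assume "a u v \<noteq> 0"
      then show False
        \<comment> \<open>With \<open>a v v = 0\<close> the quadratic is affine in c, and this c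
          gives it the value -1.\<close>
        using *[of "- (a u u + 1) / (2 * a u v)"] True by (simp add: field_simps)
    qed
    with True show ?thesis by simp
  next
    case False
    then have "a v v > 0" using nonneg[OF assms(2)] by simp
    then have "0 \<le> a u u - (a u v)\<^sup>2 / a v v"
      using *[of "- a u v / a v v"] by (simp add: power2_eq_square field_simps)
    with \<open>a v v > 0\<close> show ?thesis by (simp add: field_simps)
  qed
qed

end

text \<open>Distances are measured by the form itself, the square of the seminorm, which avoids
  square roots.\<close>

definition form_Cauchy :: "(('x \<Rightarrow> 'b::real_vector) \<Rightarrow> ('x \<Rightarrow> 'b) \<Rightarrow> real) \<Rightarrow> (nat \<Rightarrow> 'x \<Rightarrow> 'b) \<Rightarrow> bool" where
  "form_Cauchy a U \<longleftrightarrow> (\<forall>e>0. \<exists>N. \<forall>m\<ge>N. \<forall>n\<ge>N. a (\<lambda>x. U m x - U n x) (\<lambda>x. U m x - U n x) < e)"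

definition form_complete :: "('x \<Rightarrow> 'b::real_vector) set \<Rightarrow> (('x \<Rightarrow> 'b) \<Rightarrow> ('x \<Rightarrow> 'b) \<Rightarrow> real) \<Rightarrow> bool" where
  "form_complete V a \<longleftrightarrow> (\<forall>U. (\<forall>n. U n \<in> V) \<longrightarrow> form_Cauchy a U \<longrightarrow>
     (\<exists>u\<in>V. (\<lambda>n. a (\<lambda>x. U n x - u x) (\<lambda>x. U n x - u x)) \<longlonglongrightarrow> 0))"

text \<open>Dirichlet's principle: the bound on \<open>l\<close> makes the functional
  \<open>J\<close> bounded below, a minimising sequence is Cauchy, and its limit satisfies the Euler
  equation. The bound also forces \<open>l\<close> to vanish on null vectors, so semidefiniteness
  does no harm.\<close>

lemma (in semi_inner) riesz_representation:
  assumes ne: "V \<noteq> {}" and complete: "form_complete V a"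
    and l_lin: "\<And>u v c. u \<in> V \<Longrightarrow> v \<in> V \<Longrightarrow> l (\<lambda>x. u x + c *\<^sub>R v x) = l u + c * l v"
    and l_bd: "\<And>v. v \<in> V \<Longrightarrow> (l v)\<^sup>2 \<le> C * a v v"
  shows "\<exists>u\<in>V. \<forall>v\<in>V. a u v = l v"
proof -
  define J where "J u = a u u - 2 * l u" for u
  have J_expand: "J (\<lambda>x. u x + c *\<^sub>R v x) = J u + 2 * c * (a u v - l v) + c\<^sup>2 * a v v"
    if "u \<in> V" "v \<in> V" for u v c
    using that by (simp add: J_def expand_square l_lin algebra_simps)
  have J_lower: "- \<bar>C\<bar> \<le> J u" if u: "u \<in> V" for u
  proof -
    have "(2 * l u)\<^sup>2 \<le> 4 * (\<bar>C\<bar> * a u u)"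
      using l_bd[OF u] mult_right_mono[OF abs_ge_self[of C] nonneg[OF u]] by (simp add: power_mult_distrib)
    also have "\<dots> \<le> (\<bar>C\<bar> + a u u)\<^sup>2"
      using zero_le_power2[of "\<bar>C\<bar> - a u u"] by (simp add: power2_eq_square algebra_simps)
    finally have "2 * l u \<le> \<bar>C\<bar> + a u u"
      by (rule power2_le_imp_le) (simp add: nonneg[OF u])
    then show ?thesis by (simp add: J_def)
  qed
  define m where "m = Inf (J ` V)"
  have bdd: "bdd_below (J ` V)" using J_lower by (auto intro!: bdd_belowI2)
  have m: "m \<le> J u" if "u \<in> V" for u
    unfolding m_def using that bdd by (intro cInf_lower) auto
  have "\<exists>u\<in>V. J u < m + 1 / real (Suc n)" for n
    using cInf_lessD[of "J ` V" "m + 1 / real (Suc n)"] ne by (auto simp: m_def)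
  then obtain U where U: "\<And>n. U n \<in> V" "\<And>n. J (U n) < m + 1 / real (Suc n)"
    by metis
  have dist: "a (\<lambda>x. U i x - U j x) (\<lambda>x. U i x - U j x) \<le> 2 / real (Suc i) + 2 / real (Suc j)" for i j
  proof -
    let ?d = "\<lambda>x. U i x - U j x"
    have d: "?d \<in> V" by (intro closed_diff U)
    have "J (\<lambda>x. U j x + 1 *\<^sub>R ?d x) = J (U i)" by simp
    then have 1: "J (U i) = J (U j) + 2 * (a (U j) ?d - l ?d) + a ?d ?d"
      using J_expand[OF U(1) d, of j 1] by simp
    \<comment> \<open>The midpoint of \<open>U i\<close> and \<open>U j\<close> has a value of J at
      least m. Together with the expansion along the full difference this is the parallelogram
      argument.\<close>
    have "m \<le> J (U j) + (a (U j) ?d - l ?d) + a ?d ?d / 4"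
      using m[OF closed[OF U(1) d, of j "1/2"]] J_expand[OF U(1) d, of j "1/2"]
      by (simp add: power2_eq_square)
    moreover have "d \<le> 2 * \<alpha> + 2 * \<beta>"
      if "Ji = Jj + 2 * X + d" "Jj < m + \<beta>" "m \<le> Jj + X + d / 4" "Ji < m + \<alpha>" for Ji Jj X d \<alpha> \<beta> :: real
      using that by linarith
    ultimately have "a ?d ?d \<le> 2 * (1 / real (Suc i)) + 2 * (1 / real (Suc j))"
      using 1 U(2)[of i] U(2)[of j] by blast
    then show ?thesis by simp
  qed
  have "form_Cauchy a U"
    unfolding form_Cauchy_def
  proof (intro allI impI)
    fix e :: real assume "e > 0"
    then obtain N where N: "4 / e < real N" using reals_Archimedean2 by blast
    have "a (\<lambda>x. U i x - U j x) (\<lambda>x. U i x - U j x) < e" if "i \<ge> N" "j \<ge> N" for i j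
    proof -
      have "2 / real (Suc k) < e / 2" if "k \<ge> N" for k
      proof -
        have "4 / e < real (Suc k)" using N that by simp
        then show ?thesis using \<open>e > 0\<close> by (simp add: field_simps)
      qed
      from this[OF that(1)] this[OF that(2)] dist[of i j] show ?thesis by linarith
    qed
    then show "\<exists>N. \<forall>m\<ge>N. \<forall>n\<ge>N. a (\<lambda>x. U m x - U n x) (\<lambda>x. U m x - U n x) < e" by blast
  qed
  with complete U(1) obtain u where u: "u \<in> V" "(\<lambda>n. a (\<lambda>x. U n x - u x) (\<lambda>x. U n x - u x)) \<longlonglongrightarrow> 0"
    unfolding form_complete_def by blast
  have "a u v = l v" if v: "v \<in> V" for v
  proof -
    have "(\<lambda>n. (a (\<lambda>x. U n x - u x) v)\<^sup>2) \<longlonglongrightarrow> 0"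
    proof (rule tendsto_sandwich[OF _ _ tendsto_const])
      show "\<forall>\<^sub>F n in sequentially. (a (\<lambda>x. U n x - u x) v)\<^sup>2
          \<le> a (\<lambda>x. U n x - u x) (\<lambda>x. U n x - u x) * a v v"
        using cauchy_schwarz[OF closed_diff[OF U(1) u(1)] v] by simp
      show "(\<lambda>n. a (\<lambda>x. U n x - u x) (\<lambda>x. U n x - u x) * a v v) \<longlonglongrightarrow> 0"
        using tendsto_mult_left_zero[OF u(2)] .
    qed auto
    from tendsto_real_sqrt[OF this] have "(\<lambda>n. a (\<lambda>x. U n x - u x) v) \<longlonglongrightarrow> 0"
      by (simp add: tendsto_rabs_zero_iff)
    then have "(\<lambda>n. a (U n) v - a u v) \<longlonglongrightarrow> 0"
      by (simp add: lin_diff U(1) u(1) v)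
    then have lim: "(\<lambda>n. a (U n) v) \<longlonglongrightarrow> a u v"
      by (rule LIM_zero_cancel)
    define r where "r = a u v - l v"
    \<comment> \<open>\<open>U n\<close> is within 1 / (n + 1) of the infimum, so adding t v lowers
      J by at most that much. The inequality is the limit of this, with no appeal to continuity of
      J.\<close>
    have *: "0 \<le> 2 * t * r + t\<^sup>2 * a v v" for t
    proof (rule LIMSEQ_le)
      show "(\<lambda>n. - (1 / real (Suc n))) \<longlonglongrightarrow> 0"
        using tendsto_minus[OF lim_1_over_n[THEN LIMSEQ_Suc]] by simp
      show "(\<lambda>n. 2 * t * (a (U n) v - l v) + t\<^sup>2 * a v v) \<longlonglongrightarrow> 2 * t * r + t\<^sup>2 * a v v"
        unfolding r_def by (intro tendsto_intros lim)
      have "- (1 / real (Suc n)) \<le> 2 * t * (a (U n) v - l v) + t\<^sup>2 * a v v" for n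
        using m[OF closed[OF U(1) v, of n t]] J_expand[OF U(1) v, of n t] U(2)[of n] by linarith
      then show "\<exists>N. \<forall>n\<ge>N. - (1 / real (Suc n)) \<le> 2 * t * (a (U n) v - l v) + t\<^sup>2 * a v v"
        by blast
    qed
    have p: "a v v + 1 > 0" using nonneg[OF v] by simp
    \<comment> \<open>The minimiser would be -r / a v v; the added 1 keeps the choice meaningful for
      null vectors v and still makes the value negative unless r = 0.\<close>
    have "0 \<le> 2 * (- r / (a v v + 1)) * r + (- r / (a v v + 1))\<^sup>2 * a v v" by (rule *)
    also have "\<dots> = - (r\<^sup>2 * (a v v + 2) / (a v v + 1)\<^sup>2)"
      using p by (simp add: power2_eq_square divide_simps) (simp add: algebra_simps)
    finally have "r\<^sup>2 * (a v v + 2) / (a v v + 1)\<^sup>2 \<le> 0" by simp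
    then have "r\<^sup>2 * (a v v + 2) \<le> 0" using p by (simp add: divide_le_0_iff)
    then have "r = 0" using nonneg[OF v] by (simp add: mult_le_0_iff)
    then show ?thesis by (simp add: r_def)
  qed
  with u(1) show ?thesis by blast
qed

text \<open>Eliminating \<open>u = u\<^sub>0 + R \<phi>\<close>, where \<open>g (R \<phi>) v = b \<phi> v\<close>, turns the skew-symmetric coupling into the
  symmetric nonnegative perturbation \<open>b (R \<phi>) \<psi> = g (R \<phi>) (R \<psi>)\<close> of \<open>a\<close>.\<close>

lemma skew_coupled_system_solvable:
  assumes "semi_inner V a" "semi_inner V g" and ne: "V \<noteq> {}"
    and ca: "form_complete V a" and cg: "form_complete V g"
    and b_lin: "\<And>u v w c. u \<in> V \<Longrightarrow> v \<in> V \<Longrightarrow> w \<in> V \<Longrightarrow> b (\<lambda>x. u x + c *\<^sub>R v x) w = b u w + c * b v w"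
    and b_sym: "\<And>u v. u \<in> V \<Longrightarrow> v \<in> V \<Longrightarrow> b u v = b v u"
    and b_bd: "\<And>u v. u \<in> V \<Longrightarrow> v \<in> V \<Longrightarrow> (b u v)\<^sup>2 \<le> C * a u u * g v v"
    and l1_lin: "\<And>u v c. u \<in> V \<Longrightarrow> v \<in> V \<Longrightarrow> l1 (\<lambda>x. u x + c *\<^sub>R v x) = l1 u + c * l1 v"
    and l1_bd: "\<And>v. v \<in> V \<Longrightarrow> (l1 v)\<^sup>2 \<le> C1 * a v v"
    and l2_lin: "\<And>u v c. u \<in> V \<Longrightarrow> v \<in> V \<Longrightarrow> l2 (\<lambda>x. u x + c *\<^sub>R v x) = l2 u + c * l2 v"
    and l2_bd: "\<And>v. v \<in> V \<Longrightarrow> (l2 v)\<^sup>2 \<le> C2 * g v v"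
  shows "\<exists>\<phi>\<in>V. \<exists>u\<in>V. \<forall>\<psi>\<in>V. a \<phi> \<psi> + b u \<psi> = l1 \<psi> \<and> g u \<psi> - b \<phi> \<psi> = l2 \<psi>"
proof -
  interpret a: semi_inner V a by fact
  interpret g: semi_inner V g by fact
  have b_lin_right: "b w (\<lambda>x. u x + c *\<^sub>R v x) = b w u + c * b w v" if "u \<in> V" "v \<in> V" "w \<in> V" for u v w c
    using b_lin[OF that, of c] b_sym[OF that(3) g.closed[OF that(1,2)], of c] b_sym that by simp
  have "\<exists>u\<in>V. \<forall>v\<in>V. g u v = b \<phi> v" if "\<phi> \<in> V" for \<phi>
    by (rule g.riesz_representation[OF ne cg, where C = "C * a \<phi> \<phi>"]) (use that b_lin_right b_bd in auto)
  then obtain R where R: "\<And>\<phi>. \<phi> \<in> V \<Longrightarrow> R \<phi> \<in> V" "\<And>\<phi> v. \<phi> \<in> V \<Longrightarrow> v \<in> V \<Longrightarrow> g (R \<phi>) v = b \<phi> v"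
    by metis
  obtain u0 where u0: "u0 \<in> V" "\<And>v. v \<in> V \<Longrightarrow> g u0 v = l2 v"
    using g.riesz_representation[OF ne cg, of l2 C2] l2_lin l2_bd by blast
  have bR: "b (R u) w = g (R u) (R w)" if "u \<in> V" "w \<in> V" for u w
    using R(2)[OF that(2) R(1)[OF that(1)]] b_sym[OF R(1)[OF that(1)] that(2)]
      g.sym[OF R(1)[OF that(1)] R(1)[OF that(2)]] by simp
  have bR_swap: "b (R u) w = b u (R w)" if "u \<in> V" "w \<in> V" for u w
    using bR[OF that] R(2)[OF that(1) R(1)[OF that(2)]] by simp
  define a' where "a' \<phi> \<psi> = a \<phi> \<psi> + b (R \<phi>) \<psi>" for \<phi> \<psi>
  have a'_ge: "a u u \<le> a' u u" if "u \<in> V" for u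
    using bR[OF that that] g.nonneg[OF R(1)[OF that]] by (simp add: a'_def)
  \<comment> \<open>With q = g (R u) (R u) = b u (R u) the bound on \<open>b\<close> reads q^2 <= C
    a(u, u) q, and q cancels. Hence \<open>a'\<close> and \<open>a\<close> are equivalent, and
    completeness carries over from \<open>a\<close> to \<open>a'\<close>.\<close>
  have a'_le: "a' u u \<le> (1 + \<bar>C\<bar>) * a u u" if u: "u \<in> V" for u
  proof -
    let ?q = "b (R u) u"
    have q: "?q = g (R u) (R u)" "?q = b u (R u)" using bR[OF u u] bR_swap[OF u u] by auto
    then have "?q \<ge> 0" using g.nonneg[OF R(1)[OF u]] by simp
    have "?q * ?q \<le> (C * a u u) * ?q"
      using b_bd[OF u R(1)[OF u]] q by (simp add: power2_eq_square)
    then have "?q \<le> \<bar>C\<bar> * a u u"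
    proof (cases "?q = 0")
      case False
      with \<open>?q \<ge> 0\<close> \<open>?q * ?q \<le> (C * a u u) * ?q\<close> have "?q \<le> C * a u u" by simp
      also have "\<dots> \<le> \<bar>C\<bar> * a u u" by (intro mult_right_mono a.nonneg u) simp
      finally show ?thesis .
    qed (use a.nonneg[OF u] in simp)
    then show ?thesis by (simp add: a'_def algebra_simps)
  qed
  interpret a': semi_inner V a'
  proof
    fix u v w c assume uvw: "u \<in> V" "v \<in> V" "w \<in> V"
    \<comment> \<open>\<open>R\<close> selects representatives and need not be linear. Moving it to
      the other argument shows that the form is linear all the same.\<close>
    have "b (R (\<lambda>x. u x + c *\<^sub>R v x)) w = b u (R w) + c * b v (R w)"
      using uvw R by (simp add: bR_swap a.closed b_lin)
    then show "a' (\<lambda>x. u x + c *\<^sub>R v x) w = a' u w + c * a' v w"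
      using uvw by (simp add: a'_def a.lin bR_swap algebra_simps)
  next
    fix u v assume uv: "u \<in> V" "v \<in> V"
    show "a' u v = a' v u"
      using bR[OF uv] bR[OF uv(2,1)] a.sym[OF uv] g.sym[OF R(1)[OF uv(1)] R(1)[OF uv(2)]]
      by (simp add: a'_def)
    show "(\<lambda>x. u x + c *\<^sub>R v x) \<in> V" for c using uv by (rule a.closed)
    show "0 \<le> a' u u" using a'_ge[OF uv(1)] a.nonneg[OF uv(1)] by simp
  qed
  have "form_complete V a'"
    unfolding form_complete_def
  proof (intro allI impI)
    fix U assume U: "\<forall>n. U n \<in> V" and "form_Cauchy a' U"
    then have "form_Cauchy a U"
      unfolding form_Cauchy_def using a'_ge[OF a.closed_diff] by (meson le_less_trans)
    with ca U obtain u where u: "u \<in> V" "(\<lambda>n. a (\<lambda>x. U n x - u x) (\<lambda>x. U n x - u x)) \<longlonglongrightarrow> 0"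
      unfolding form_complete_def by blast
    have "(\<lambda>n. a' (\<lambda>x. U n x - u x) (\<lambda>x. U n x - u x)) \<longlonglongrightarrow> 0"
    proof (rule tendsto_sandwich[OF _ _ tendsto_const])
      show "(\<lambda>n. (1 + \<bar>C\<bar>) * a (\<lambda>x. U n x - u x) (\<lambda>x. U n x - u x)) \<longlonglongrightarrow> 0"
        using tendsto_mult_right_zero[OF u(2)] .
    qed (use U u(1) a'_le a'.nonneg a.closed_diff in auto)
    with u(1) show "\<exists>u\<in>V. (\<lambda>n. a' (\<lambda>x. U n x - u x) (\<lambda>x. U n x - u x)) \<longlonglongrightarrow> 0" by blast
  qed
  moreover have "l1 (\<lambda>x. u x + c *\<^sub>R v x) - b u0 (\<lambda>x. u x + c *\<^sub>R v x)
      = (l1 u - b u0 u) + c * (l1 v - b u0 v)" if "u \<in> V" "v \<in> V" for u v c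
    using that u0(1) by (simp add: l1_lin b_lin_right algebra_simps)
  moreover have "(l1 v - b u0 v)\<^sup>2 \<le> (2 * \<bar>C1\<bar> + 2 * \<bar>C * g u0 u0\<bar>) * a' v v" if v: "v \<in> V" for v
  proof -
    have "(l1 v - b u0 v)\<^sup>2 \<le> 2 * (l1 v)\<^sup>2 + 2 * (b u0 v)\<^sup>2"
      using zero_le_power2[of "l1 v + b u0 v"] by (simp add: power2_eq_square algebra_simps)
    also have "\<dots> \<le> 2 * (C1 * a v v) + 2 * ((C * g u0 u0) * a v v)"
      using l1_bd[OF v] b_bd[OF v u0(1)] b_sym[OF v u0(1)] by (simp add: mult_ac)
    also have "\<dots> \<le> 2 * (\<bar>C1\<bar> * a v v) + 2 * (\<bar>C * g u0 u0\<bar> * a v v)"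
      by (intro add_mono mult_left_mono mult_right_mono a.nonneg v) auto
    also have "\<dots> = (2 * \<bar>C1\<bar> + 2 * \<bar>C * g u0 u0\<bar>) * a v v" by (simp add: algebra_simps)
    also have "\<dots> \<le> (2 * \<bar>C1\<bar> + 2 * \<bar>C * g u0 u0\<bar>) * a' v v"
      by (intro mult_left_mono a'_ge v) auto
    finally show ?thesis .
  qed
  ultimately obtain \<phi> where \<phi>: "\<phi> \<in> V" "\<And>v. v \<in> V \<Longrightarrow> a' \<phi> v = l1 v - b u0 v"
    using a'.riesz_representation[OF ne, of "\<lambda>v. l1 v - b u0 v"] by blast
  show ?thesis
  proof (intro bexI ballI)
    show "(\<lambda>x. u0 x + 1 *\<^sub>R R \<phi> x) \<in> V" by (intro g.closed u0 R \<phi>)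
    fix \<psi> assume \<psi>: "\<psi> \<in> V"
    show "a \<phi> \<psi> + b (\<lambda>x. u0 x + 1 *\<^sub>R R \<phi> x) \<psi> = l1 \<psi> \<and>
        g (\<lambda>x. u0 x + 1 *\<^sub>R R \<phi> x) \<psi> - b \<phi> \<psi> = l2 \<psi>"
      using \<phi>(2)[OF \<psi>] b_lin[OF u0(1) R(1)[OF \<phi>(1)] \<psi>, of 1] g.lin[OF u0(1) R(1)[OF \<phi>(1)] \<psi>, of 1]
        u0(2)[OF \<psi>] R(2)[OF \<phi>(1) \<psi>]
      by (simp add: a'_def)
  qed fact
qed

section \<open>Completeness of \<open>L2\<close> and periodicity\<close>

lemma L2_inner_integrable:
  fixes f g :: "real^'n \<Rightarrow> 'b::euclidean_space"
  assumes "f \<in> L2 \<Omega>" "g \<in> L2 \<Omega>"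
  shows "integrable (lebesgue_on \<Omega>) (\<lambda>x. f x \<bullet> g x)"
proof (rule Bochner_Integration.integrable_bound)
  show "integrable (lebesgue_on \<Omega>) (\<lambda>x. (norm (f x))\<^sup>2 + (norm (g x))\<^sup>2)"
    using assms by (simp add: L2_def)
  show "(\<lambda>x. f x \<bullet> g x) \<in> borel_measurable (lebesgue_on \<Omega>)"
    using assms by (intro borel_measurable_inner) (simp_all add: L2_def)
  have "\<bar>f x \<bullet> g x\<bar> \<le> (norm (f x))\<^sup>2 + (norm (g x))\<^sup>2" for x
  proof -
    have "\<bar>f x \<bullet> g x\<bar> \<le> norm (f x) * norm (g x)" by (rule Cauchy_Schwarz_ineq2)
    also have "\<dots> \<le> (norm (f x))\<^sup>2 + (norm (g x))\<^sup>2"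
    proof -
      have "0 \<le> (norm (f x))\<^sup>2 + (norm (g x))\<^sup>2 - 2 * (norm (f x) * norm (g x))"
        using zero_le_power2[of "norm (f x) - norm (g x)"] by (simp add: power2_diff mult.assoc)
      moreover have "0 \<le> norm (f x) * norm (g x)" by simp
      ultimately show ?thesis by linarith
    qed
    finally show ?thesis .
  qed
  then show "AE x in lebesgue_on \<Omega>. norm (f x \<bullet> g x) \<le> norm ((norm (f x))\<^sup>2 + (norm (g x))\<^sup>2)"
    by simp
qed

lemma L2_add_scaled:
  fixes f g :: "real^'n \<Rightarrow> 'b::euclidean_space"
  assumes "f \<in> L2 \<Omega>" "g \<in> L2 \<Omega>"
  shows "(\<lambda>x. f x + c *\<^sub>R g x) \<in> L2 \<Omega>"
proof -
  have m: "f \<in> borel_measurable (lebesgue_on \<Omega>)" "g \<in> borel_measurable (lebesgue_on \<Omega>)"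
    using assms by (simp_all add: L2_def)
  have "(norm (f x + c *\<^sub>R g x))\<^sup>2 = (norm (f x))\<^sup>2 + 2 * c * (f x \<bullet> g x) + c\<^sup>2 * (norm (g x))\<^sup>2" for x
    unfolding power2_norm_eq_inner
    by (simp add: inner_add_left inner_add_right inner_commute[of "g x" "f x"] power2_eq_square algebra_simps)
  moreover have "integrable (lebesgue_on \<Omega>) (\<lambda>x. (norm (f x))\<^sup>2 + 2 * c * (f x \<bullet> g x) + c\<^sup>2 * (norm (g x))\<^sup>2)"
    using assms L2_inner_integrable[OF assms]
    by (intro Bochner_Integration.integrable_add integrable_mult_right) (simp_all add: L2_def)
  ultimately show ?thesis
    using m by (simp add: L2_def)
qed

lemma L2_diff: "f \<in> L2 \<Omega> \<Longrightarrow> g \<in> L2 \<Omega> \<Longrightarrow> (\<lambda>x. f x - g x) \<in> L2 \<Omega>"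
  using L2_add_scaled[of f \<Omega> g "-1"] by simp

lemma semi_inner_L2: "semi_inner (L2 \<Omega> :: (real^'n \<Rightarrow> 'b::euclidean_space) set) (ip \<Omega>)"
proof
  fix u v w :: "real^'n \<Rightarrow> 'b" and c
  assume uv: "u \<in> L2 \<Omega>" "v \<in> L2 \<Omega>"
  show "(\<lambda>x. u x + c *\<^sub>R v x) \<in> L2 \<Omega>" by (rule L2_add_scaled[OF uv])
  show "ip \<Omega> u v = ip \<Omega> v u" by (simp add: ip_def inner_commute)
  assume w: "w \<in> L2 \<Omega>"
  show "ip \<Omega> (\<lambda>x. u x + c *\<^sub>R v x) w = ip \<Omega> u w + c * ip \<Omega> v w"
    using L2_inner_integrable[OF uv(1) w] L2_inner_integrable[OF uv(2) w]
    by (simp add: ip_def inner_add_left)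
next
  fix u :: "real^'n \<Rightarrow> 'b"
  show "0 \<le> ip \<Omega> u u" by (simp add: ip_def)
qed

lemma nn_integral_L2:
  assumes "f \<in> L2 \<Omega>"
  shows "(\<integral>\<^sup>+x. ennreal ((norm (f x))\<^sup>2) \<partial>lebesgue_on \<Omega>) = ennreal (ip \<Omega> f f)"
  unfolding ip_def dot_square_norm
  using assms by (intro nn_integral_eq_integral) (simp_all add: L2_def)

lemma L2_iff_nn_integral:
  assumes "f \<in> borel_measurable (lebesgue_on \<Omega>)"
  shows "f \<in> L2 \<Omega> \<longleftrightarrow> (\<integral>\<^sup>+x. ennreal ((norm (f x))\<^sup>2) \<partial>lebesgue_on \<Omega>) < \<infinity>"
  using assms by (simp add: L2_def integrable_iff_bounded)

text \<open>Pointwise convergence is kept apart from convergence in mean because functions,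
  gradients and products with \<open>Z\<close> have to share one subsequence later.\<close>

lemma L2_convergent_subseq:
  fixes F :: "nat \<Rightarrow> real^'n \<Rightarrow> 'b::euclidean_space"
  assumes F: "\<And>n. F n \<in> L2 \<Omega>" and "form_Cauchy (ip \<Omega>) F"
  shows "\<exists>r. strict_mono r \<and> (AE x in lebesgue_on \<Omega>. convergent (\<lambda>k. F (r k) x))"
proof -
  have "\<forall>k. \<exists>N. \<forall>m\<ge>N. \<forall>n\<ge>N. ip \<Omega> (\<lambda>x. F m x - F n x) (\<lambda>x. F m x - F n x) < (1/4) ^ k"
    using assms(2) by (simp add: form_Cauchy_def)
  from choice[OF this] obtain N :: "nat \<Rightarrow> nat" where
    N: "\<forall>k. \<forall>m\<ge>N k. \<forall>n\<ge>N k. ip \<Omega> (\<lambda>x. F m x - F n x) (\<lambda>x. F m x - F n x) < (1/4) ^ k"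
    by blast
  \<comment> \<open>The sum of all earlier thresholds makes r k at least \<open>N k\<close>, and the
    added k makes it strictly increasing.\<close>
  define r where "r k = (\<Sum>j\<le>k. N j) + k" for k
  have "strict_mono r" by (rule strict_monoI_Suc) (simp add: r_def)
  have rN: "N k \<le> r k" "N k \<le> r (Suc k)" for k
  proof -
    show "N k \<le> r k" unfolding r_def by (intro trans_le_add1 member_le_sum) auto
    also have "r k \<le> r (Suc k)" by (simp add: r_def)
    finally show "N k \<le> r (Suc k)" .
  qed
  define d where "d k x = F (r (Suc k)) x - F (r k) x" for k x
  have dL2: "d k \<in> L2 \<Omega>" for k
    unfolding d_def by (intro L2_diff F)
  have [measurable]: "d k \<in> borel_measurable (lebesgue_on \<Omega>)" for k
    using dL2 by (simp add: L2_def)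
  have d: "ip \<Omega> (d k) (d k) \<le> (1/4) ^ k" for k
    using N rN[of k] unfolding d_def by (meson less_imp_le)
  \<comment> \<open>With these weights the squares are summable, and \<open>2 * norm d \<le> 2 ^ k * (norm d)\<^sup>2 + (1/2) ^ k\<close>.\<close>
  have "(\<integral>\<^sup>+x. (\<Sum>k. ennreal (2 ^ k * (norm (d k x))\<^sup>2)) \<partial>lebesgue_on \<Omega>)
      = (\<Sum>k. \<integral>\<^sup>+x. ennreal (2 ^ k * (norm (d k x))\<^sup>2) \<partial>lebesgue_on \<Omega>)"
    by (rule nn_integral_suminf) measurable
  also have "\<dots> = (\<Sum>k. ennreal (2 ^ k * ip \<Omega> (d k) (d k)))"
    by (simp add: ennreal_mult nn_integral_cmult nn_integral_L2[OF dL2] ip_def)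
  also have "\<dots> \<le> (\<Sum>k. ennreal ((1/2) ^ k))"
  proof (rule suminf_le)
    fix k
    have "2 ^ k * ip \<Omega> (d k) (d k) \<le> 2 ^ k * (1/4) ^ k"
      using d[of k] by (intro mult_left_mono) auto
    also have "\<dots> = (1/2) ^ k" by (simp flip: power_mult_distrib)
    finally show "ennreal (2 ^ k * ip \<Omega> (d k) (d k)) \<le> ennreal ((1/2) ^ k)" by (rule ennreal_leI)
  qed auto
  also have "\<dots> = ennreal (\<Sum>k. (1/2) ^ k)"
    by (rule suminf_ennreal2) (auto intro: summable_geometric)
  finally have "(\<integral>\<^sup>+x. (\<Sum>k. ennreal (2 ^ k * (norm (d k x))\<^sup>2)) \<partial>lebesgue_on \<Omega>) \<noteq> \<infinity>"
    by (auto simp: top_unique)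
  then have "AE x in lebesgue_on \<Omega>. (\<Sum>k. ennreal (2 ^ k * (norm (d k x))\<^sup>2)) \<noteq> \<infinity>"
    by (intro nn_integral_PInf_AE) measurable
  then have "AE x in lebesgue_on \<Omega>. convergent (\<lambda>k. F (r k) x)"
  proof (rule eventually_mono)
    fix x assume "(\<Sum>k. ennreal (2 ^ k * (norm (d k x))\<^sup>2)) \<noteq> \<infinity>"
    then have "summable (\<lambda>k. 2 ^ k * (norm (d k x))\<^sup>2)"
      by (intro summable_suminf_not_top) auto
    then have "summable (\<lambda>k. 2 ^ k * (norm (d k x))\<^sup>2 + (1/2) ^ k)"
      by (intro summable_add summable_geometric) auto
    then have "summable (\<lambda>k. d k x)"
    proof (rule summable_comparison_test'[where N = 0])
      fix k
      have "0 \<le> (2 ^ k * norm (d k x) - 1)\<^sup>2 / 2 ^ k" by simp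
      also have "\<dots> = 2 ^ k * (norm (d k x))\<^sup>2 - 2 * norm (d k x) + (1/2) ^ k"
        by (simp add: power2_eq_square field_simps power_one_over)
      finally show "norm (d k x) \<le> 2 ^ k * (norm (d k x))\<^sup>2 + (1/2) ^ k"
        using norm_ge_zero[of "d k x"] by linarith
    qed
    then have "convergent (\<lambda>k. F (r 0) x + (\<Sum>i<k. d i x))"
      by (intro convergent_add convergent_const) (simp add: summable_iff_convergent)
    moreover have "F (r 0) x + (\<Sum>i<k. d i x) = F (r k) x" for k
      using sum_lessThan_telescope[of "\<lambda>i. F (r i) x" k] by (simp add: d_def)
    ultimately show "convergent (\<lambda>k. F (r k) x)" by simp
  qed
  with \<open>strict_mono r\<close> show ?thesis by blast
qed

text \<open>Fatou's lemma along the subsequence, with \<open>m\<close> fixed, turns the Cauchy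
  estimate into one for the distance from \<open>F m\<close> to \<open>G\<close>. So the whole
  sequence converges, not only the subsequence.\<close>

lemma L2_limit:
  fixes F :: "nat \<Rightarrow> real^'n \<Rightarrow> 'b::euclidean_space"
  assumes F: "\<And>n. F n \<in> L2 \<Omega>" and C: "form_Cauchy (ip \<Omega>) F" and r: "strict_mono r"
    and lim: "AE x in lebesgue_on \<Omega>. (\<lambda>k. F (r k) x) \<longlonglongrightarrow> G x"
    and G[measurable]: "G \<in> borel_measurable (lebesgue_on \<Omega>)"
  shows "G \<in> L2 \<Omega>" "(\<lambda>n. ip \<Omega> (\<lambda>x. F n x - G x) (\<lambda>x. F n x - G x)) \<longlonglongrightarrow> 0"
proof -
  have [measurable]: "F n \<in> borel_measurable (lebesgue_on \<Omega>)" for n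
    using F by (simp add: L2_def)
  have est: "(\<lambda>x. F m x - G x) \<in> L2 \<Omega> \<and> ip \<Omega> (\<lambda>x. F m x - G x) (\<lambda>x. F m x - G x) \<le> e"
    if "e > 0" and N: "\<forall>m\<ge>N. \<forall>n\<ge>N. ip \<Omega> (\<lambda>x. F m x - F n x) (\<lambda>x. F m x - F n x) < e" and m: "m \<ge> N" for e N m
  proof -
    have "(\<integral>\<^sup>+x. ennreal ((norm (F m x - G x))\<^sup>2) \<partial>lebesgue_on \<Omega>)
        = (\<integral>\<^sup>+x. liminf (\<lambda>k. ennreal ((norm (F m x - F (r k) x))\<^sup>2)) \<partial>lebesgue_on \<Omega>)"
      using lim
    proof (intro nn_integral_cong_AE, elim eventually_mono)
      fix x assume "(\<lambda>k. F (r k) x) \<longlonglongrightarrow> G x"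
      then have "(\<lambda>k. ennreal ((norm (F m x - F (r k) x))\<^sup>2)) \<longlonglongrightarrow> ennreal ((norm (F m x - G x))\<^sup>2)"
        by (intro tendsto_ennrealI tendsto_intros)
      from lim_imp_Liminf[OF sequentially_bot this]
      show "ennreal ((norm (F m x - G x))\<^sup>2) = liminf (\<lambda>k. ennreal ((norm (F m x - F (r k) x))\<^sup>2))" by simp
    qed
    also have "\<dots> \<le> liminf (\<lambda>k. \<integral>\<^sup>+x. ennreal ((norm (F m x - F (r k) x))\<^sup>2) \<partial>lebesgue_on \<Omega>)"
      by (rule nn_integral_liminf) measurable
    also have "\<dots> \<le> ennreal e"
    proof (rule Liminf_le[OF sequentially_bot])
      have "(\<integral>\<^sup>+x. ennreal ((norm (F m x - F (r k) x))\<^sup>2) \<partial>lebesgue_on \<Omega>) \<le> ennreal e" if "k \<ge> N" for k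
      proof -
        have "r k \<ge> N" using that seq_suble[OF r, of k] by simp
        with N m have "ip \<Omega> (\<lambda>x. F m x - F (r k) x) (\<lambda>x. F m x - F (r k) x) < e" by blast
        then show ?thesis
          by (simp add: nn_integral_L2[OF L2_diff[OF F F]] ennreal_leI)
      qed
      then show "\<forall>\<^sub>F k in sequentially. (\<integral>\<^sup>+x. ennreal ((norm (F m x - F (r k) x))\<^sup>2) \<partial>lebesgue_on \<Omega>) \<le> ennreal e"
        using eventually_sequentially by blast
    qed
    finally have le: "(\<integral>\<^sup>+x. ennreal ((norm (F m x - G x))\<^sup>2) \<partial>lebesgue_on \<Omega>) \<le> ennreal e" .
    have L: "(\<lambda>x. F m x - G x) \<in> L2 \<Omega>"
      using le by (subst L2_iff_nn_integral) (auto simp: order_le_less_trans)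
    moreover have "ip \<Omega> (\<lambda>x. F m x - G x) (\<lambda>x. F m x - G x) \<le> e"
      using le \<open>e > 0\<close> by (simp add: nn_integral_L2[OF L])
    ultimately show ?thesis ..
  qed
  obtain N1 where "\<forall>m\<ge>N1. \<forall>n\<ge>N1. ip \<Omega> (\<lambda>x. F m x - F n x) (\<lambda>x. F m x - F n x) < 1"
    using C unfolding form_Cauchy_def by (meson zero_less_one)
  from est[OF zero_less_one this, of N1] have "(\<lambda>x. F N1 x - G x) \<in> L2 \<Omega>" by simp
  from L2_diff[OF F this, of N1] show "G \<in> L2 \<Omega>" by simp
  show "(\<lambda>n. ip \<Omega> (\<lambda>x. F n x - G x) (\<lambda>x. F n x - G x)) \<longlonglongrightarrow> 0"
  proof (rule LIMSEQ_I)
    fix e :: real assume "e > 0"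
    then have "e / 2 > 0" by simp
    then obtain N where N: "\<forall>m\<ge>N. \<forall>n\<ge>N. ip \<Omega> (\<lambda>x. F m x - F n x) (\<lambda>x. F m x - F n x) < e / 2"
      using C unfolding form_Cauchy_def by blast
    have "norm (ip \<Omega> (\<lambda>x. F n x - G x) (\<lambda>x. F n x - G x) - 0) < e" if "n \<ge> N" for n
      using est[OF \<open>e / 2 > 0\<close> N that] semi_inner.nonneg[OF semi_inner_L2, of "\<lambda>x. F n x - G x" \<Omega>] \<open>e > 0\<close>
      by (simp only: real_norm_def diff_0_right abs_of_nonneg) linarith
    then show "\<exists>N. \<forall>n\<ge>N. norm (ip \<Omega> (\<lambda>x. F n x - G x) (\<lambda>x. F n x - G x) - 0) < e" by blast
  qed
qed

section \<open>Translations and functions periodic almost everywhere\<close>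

lemma lebesgue_translation:
  fixes t :: "real^'n"
  shows measurable_translate: "(\<lambda>x. x + t) \<in> lebesgue \<rightarrow>\<^sub>M lebesgue"
    and distr_lebesgue_translate: "distr lebesgue lebesgue (\<lambda>x. x + t) = lebesgue"
proof -
  have T: "(\<lambda>x. t + (\<Sum>j\<in>Basis. (1 * (x \<bullet> j)) *\<^sub>R j)) = (\<lambda>x. x + t)"
    by (simp add: euclidean_representation add.commute)
  show "(\<lambda>x. x + t) \<in> lebesgue \<rightarrow>\<^sub>M lebesgue"
    using lebesgue_affine_measurable[of "\<lambda>_. 1" t] unfolding T by simp
  show "distr lebesgue lebesgue (\<lambda>x. x + t) = lebesgue"
    using lebesgue_affine_euclidean[of "\<lambda>_. 1" t] unfolding T by (simp add: density_1)
qed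

lemma AE_translate:
  fixes t :: "real^'n"
  assumes "AE x in lebesgue. P x"
  shows "AE x in lebesgue. P (x + t)"
  by (rule AE_distrD[OF measurable_translate[of t]]) (simp only: distr_lebesgue_translate assms)

lemma nn_integral_translate:
  fixes t :: "real^'n"
  assumes "f \<in> borel_measurable lebesgue"
  shows "(\<integral>\<^sup>+x. f (x + t) \<partial>lebesgue) = (\<integral>\<^sup>+x. f x \<partial>lebesgue)"
  using nn_integral_distr[OF measurable_translate[of t], of f] assms by (simp add: distr_lebesgue_translate)

lemma integral_translate:
  fixes t :: "real^'n" and f :: "real^'n \<Rightarrow> 'b::euclidean_space"
  assumes "f \<in> borel_measurable lebesgue"
  shows "(\<integral>x. f (x + t) \<partial>lebesgue) = (\<integral>x. f x \<partial>lebesgue)"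
  using integral_distr[OF measurable_translate[of t], of f] assms by (simp add: distr_lebesgue_translate)

lemma integrable_translate:
  fixes t :: "real^'n" and f :: "real^'n \<Rightarrow> 'b::euclidean_space"
  assumes "integrable lebesgue f"
  shows "integrable lebesgue (\<lambda>x. f (x + t))"
  using integrable_distr_eq[OF measurable_translate[of t], of f] assms
  by (simp add: distr_lebesgue_translate)

lemma AE_period_add:
  fixes f :: "real^'n \<Rightarrow> 'b"
  assumes "AE x in lebesgue. f (x + s) = f x" "AE x in lebesgue. f (x + t) = f x"
  shows "AE x in lebesgue. f (x + (s + t)) = f x"
  using AE_translate[OF assms(2), of s] assms(1)
  by eventually_elim (simp add: add.assoc)

lemma AE_period_minus:
  fixes f :: "real^'n \<Rightarrow> 'b"
  assumes "AE x in lebesgue. f (x + s) = f x"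
  shows "AE x in lebesgue. f (x + - s) = f x"
  using AE_translate[OF assms, of "- s"] by eventually_elim simp

lemma AE_period_multiple:
  fixes f :: "real^'n \<Rightarrow> 'b"
  assumes "AE x in lebesgue. f (x + s) = f x"
  shows "AE x in lebesgue. f (x + of_int k *\<^sub>R s) = f x"
proof (induction k rule: int_induct[where k = 0])
  case base
  show ?case by simp
next
  case (step1 i)
  from AE_period_add[OF step1(2) assms] show ?case by (simp add: algebra_simps)
next
  case (step2 i)
  from AE_period_add[OF step2(2) AE_period_minus[OF assms]] show ?case by (simp add: algebra_simps)
qed

definition lattice :: "real^'n \<Rightarrow> ('n \<Rightarrow> int) \<Rightarrow> real^'n" where
  "lattice l k = (\<chi> i. of_int (k i) * l $ i)"

lemma AE_period_lattice:
  fixes f :: "real^'n \<Rightarrow> 'b"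
  assumes "\<And>i. AE x in lebesgue. f (x + (l $ i) *\<^sub>R axis i 1) = f x"
  shows "AE x in lebesgue. f (x + lattice l k) = f x"
proof -
  have "AE x in lebesgue. f (x + (\<Sum>i\<in>A. of_int (k i) *\<^sub>R ((l $ i) *\<^sub>R axis i 1))) = f x" if "finite A" for A
    using that
  proof induction
    case empty
    show ?case by simp
  next
    case (insert i A)
    from AE_period_add[OF AE_period_multiple[OF assms[of i], of "k i"] insert(3)] insert(1,2)
    show ?case by simp
  qed
  from this[of UNIV] have "AE x in lebesgue. f (x + (\<Sum>i\<in>UNIV. of_int (k i) *\<^sub>R ((l $ i) *\<^sub>R axis i 1))) = f x"
    by simp
  moreover have "(\<Sum>i\<in>UNIV. of_int (k i) *\<^sub>R ((l $ i) *\<^sub>R axis i 1)) = lattice l k"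
    using basis_expansion[of "lattice l k"] by (simp add: lattice_def scalar_mult_eq_scaleR)
  ultimately show ?thesis by simp
qed

lemma translate_into_cell:
  fixes a b :: "real^'n"
  assumes "\<And>i. a $ i < b $ i"
  defines "k x i \<equiv> \<lfloor>(x $ i - a $ i) / (b $ i - a $ i)\<rfloor>"
  shows "x + lattice (b - a) (\<lambda>i. - k x i) \<in> cbox a b"
proof -
  have "a $ i \<le> x $ i - of_int (k x i) * (b $ i - a $ i)" "x $ i - of_int (k x i) * (b $ i - a $ i) \<le> b $ i" for i
  proof -
    have p: "b $ i - a $ i > 0" using assms(1)[of i] by simp
    have "of_int (k x i) \<le> (x $ i - a $ i) / (b $ i - a $ i)"
      "(x $ i - a $ i) / (b $ i - a $ i) \<le> of_int (k x i) + 1"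
      unfolding k_def by linarith+
    then have "of_int (k x i) * (b $ i - a $ i) \<le> x $ i - a $ i"
      "x $ i - a $ i \<le> (of_int (k x i) + 1) * (b $ i - a $ i)"
      using p by (simp_all add: pos_le_divide_eq pos_divide_le_eq)
    then show "a $ i \<le> x $ i - of_int (k x i) * (b $ i - a $ i)"
      "x $ i - of_int (k x i) * (b $ i - a $ i) \<le> b $ i"
      by (simp_all add: algebra_simps)
  qed
  then show ?thesis by (simp add: mem_box_cart lattice_def)
qed

lemma AE_box_imp_AE_cbox:
  fixes a b :: "real^'n"
  assumes "AE x in lebesgue. x \<in> box a b \<longrightarrow> P x"
  shows "AE x in lebesgue. x \<in> cbox a b \<longrightarrow> P x"
proof -
  have "AE x in lebesgue. x \<notin> cbox a b - box a b"
    using negligible_frontier_interval[of a b] by (intro AE_not_in) (simp add: negligible_iff_null_sets)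
  with assms show ?thesis by eventually_elim blast
qed

text \<open>There are countably many lattice vectors, so the exceptional sets of all translates form
  one null set. Off it, each point is moved into the closed cell, whose boundary is null.\<close>

lemma AE_periodic_extend:
  fixes a b :: "real^'n"
  assumes cell: "\<And>i. a $ i < b $ i" and box: "AE x in lebesgue. x \<in> box a b \<longrightarrow> P x"
    and per: "\<And>i. AE x in lebesgue. P (x + ((b - a) $ i) *\<^sub>R axis i 1) = P x"
  shows "AE x in lebesgue. P x"
proof -
  have "AE x in lebesgue. (x + lattice (b - a) k \<in> cbox a b \<longrightarrow> P (x + lattice (b - a) k)) \<and>
      P (x + lattice (b - a) k) = P x" for k
    using AE_translate[OF AE_box_imp_AE_cbox[OF box], of "lattice (b - a) k"] AE_period_lattice[OF per, of k]
    by eventually_elim blast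
  then have "AE x in lebesgue. \<forall>k. (x + lattice (b - a) k \<in> cbox a b \<longrightarrow> P (x + lattice (b - a) k)) \<and>
      P (x + lattice (b - a) k) = P x"
    by (simp add: AE_all_countable)
  then show ?thesis
  proof (rule eventually_mono)
    fix x assume "\<forall>k. (x + lattice (b - a) k \<in> cbox a b \<longrightarrow> P (x + lattice (b - a) k)) \<and>
      P (x + lattice (b - a) k) = P x"
    with translate_into_cell[OF cell, of x] show "P x" by blast
  qed
qed

text \<open>The number \<open>N\<close> counts the lattice translates needed to cover
  \<open>cbox c d\<close> and is chosen before \<open>F\<close>. This uniformity lets Cauchy
  sequences on the cell remain Cauchy on every box.\<close>

lemma nn_integral_periodic_le:
  fixes a b c d :: "real^'n"
  assumes cell: "\<And>i. a $ i < b $ i"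
  shows "\<exists>N::nat. \<forall>F \<in> borel_measurable lebesgue.
    (\<forall>i. AE x in lebesgue. F (x + ((b - a) $ i) *\<^sub>R axis i 1) = F x) \<longrightarrow>
    (\<integral>\<^sup>+x. F x * indicator (cbox c d) x \<partial>lebesgue) \<le> of_nat N * (\<integral>\<^sup>+x. F x * indicator (box a b) x \<partial>lebesgue)"
proof -
  \<comment> \<open>Monotonicity of the floor bounds the coordinates of all shifts that bring a
    point of \<open>cbox c d\<close> into the cell. The minus sign swaps the roles of
    \<open>c\<close> and \<open>d\<close>.\<close>
  define K where "K = (\<Pi>\<^sub>E i\<in>UNIV. {- \<lfloor>(d $ i - a $ i) / (b $ i - a $ i)\<rfloor> .. - \<lfloor>(c $ i - a $ i) / (b $ i - a $ i)\<rfloor>})"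
  have finK: "finite K" unfolding K_def by (intro finite_PiE) auto
  have cover: "\<exists>k\<in>K. x + lattice (b - a) k \<in> cbox a b" if "x \<in> cbox c d" for x
  proof (rule bexI)
    show "x + lattice (b - a) (\<lambda>i. - \<lfloor>(x $ i - a $ i) / (b $ i - a $ i)\<rfloor>) \<in> cbox a b"
      by (rule translate_into_cell[OF cell])
    have "\<lfloor>(c $ i - a $ i) / (b $ i - a $ i)\<rfloor> \<le> \<lfloor>(x $ i - a $ i) / (b $ i - a $ i)\<rfloor>"
      "\<lfloor>(x $ i - a $ i) / (b $ i - a $ i)\<rfloor> \<le> \<lfloor>(d $ i - a $ i) / (b $ i - a $ i)\<rfloor>" for i
      using that cell[of i] by (auto intro!: floor_mono divide_right_mono simp: mem_box_cart)
    then show "(\<lambda>i. - \<lfloor>(x $ i - a $ i) / (b $ i - a $ i)\<rfloor>) \<in> K"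
      by (auto simp: K_def PiE_iff)
  qed
  have "(\<integral>\<^sup>+x. F x * indicator (cbox c d) x \<partial>lebesgue) \<le> of_nat (card K) * (\<integral>\<^sup>+x. F x * indicator (box a b) x \<partial>lebesgue)"
    if F[measurable]: "F \<in> borel_measurable lebesgue"
      and per: "\<forall>i. AE x in lebesgue. F (x + ((b - a) $ i) *\<^sub>R axis i 1) = F x" for F
  proof -
    define G where "G x = F x * indicator (cbox a b) x" for x
    have [measurable]: "G \<in> borel_measurable lebesgue"
      unfolding G_def by (intro borel_measurable_times_ennreal F borel_measurable_indicator) simp
    have G_trans: "(\<lambda>x. G (x + t)) \<in> borel_measurable lebesgue" for t
      using measurable_compose[OF measurable_translate] \<open>G \<in> borel_measurable lebesgue\<close> by blast
    have "AE x in lebesgue. \<forall>k. F (x + lattice (b - a) k) = F x"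
      using AE_period_lattice[of F "b - a"] per by (simp add: AE_all_countable)
    then have "(\<integral>\<^sup>+x. F x * indicator (cbox c d) x \<partial>lebesgue) \<le> (\<integral>\<^sup>+x. (\<Sum>k\<in>K. G (x + lattice (b - a) k)) \<partial>lebesgue)"
    proof (intro nn_integral_mono_AE, elim eventually_mono)
      fix x assume x: "\<forall>k. F (x + lattice (b - a) k) = F x"
      show "F x * indicator (cbox c d) x \<le> (\<Sum>k\<in>K. G (x + lattice (b - a) k))"
      proof (cases "x \<in> cbox c d")
        case True
        then obtain k where k: "k \<in> K" "x + lattice (b - a) k \<in> cbox a b" using cover by blast
        then have "F x * indicator (cbox c d) x = G (x + lattice (b - a) k)"
          using x True by (simp add: G_def)
        also have "\<dots> \<le> (\<Sum>k\<in>K. G (x + lattice (b - a) k))"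
          using k(1) finK by (intro member_le_sum) auto
        finally show ?thesis .
      qed simp
    qed
    also have "\<dots> = (\<Sum>k\<in>K. \<integral>\<^sup>+x. G (x + lattice (b - a) k) \<partial>lebesgue)"
      by (rule nn_integral_sum) (rule G_trans)
    also have "\<dots> = of_nat (card K) * (\<integral>\<^sup>+x. G x \<partial>lebesgue)"
      by (simp add: nn_integral_translate)
    also have "(\<integral>\<^sup>+x. G x \<partial>lebesgue) = (\<integral>\<^sup>+x. F x * indicator (box a b) x \<partial>lebesgue)"
    proof (rule nn_integral_cong_AE)
      have "AE x in lebesgue. x \<in> cbox a b \<longrightarrow> x \<in> box a b"
        by (rule AE_box_imp_AE_cbox) simp
      then show "AE x in lebesgue. G x = F x * indicator (box a b) x"
        by (rule eventually_mono) (use box_subset_cbox[of a b] in \<open>auto simp: G_def split: split_indicator\<close>)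
    qed
    finally show ?thesis .
  qed
  then show ?thesis by blast
qed

section \<open>The periodic Sobolev space\<close>

lemma locally_integrable_measurable:
  fixes f :: "real^'n \<Rightarrow> 'b::euclidean_space"
  assumes "locally_integrable f"
  shows "f \<in> borel_measurable lebesgue"
proof (rule borel_measurable_LIMSEQ_metric)
  show "(\<lambda>x. indicator (cball 0 (real n)) x *\<^sub>R f x) \<in> borel_measurable lebesgue" for n
    using assms by (simp add: locally_integrable_def set_integrable_def borel_measurable_integrable)
  fix x :: "real^'n"
  obtain N where N: "norm x \<le> real N" using real_arch_simple by blast
  have "indicator (cball 0 (real n)) x *\<^sub>R f x = f x" if "n \<ge> N" for n
    using N that by (simp add: indicator_def)
  then show "(\<lambda>n. indicator (cball 0 (real n)) x *\<^sub>R f x) \<longlonglongrightarrow> f x"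
    using eventually_sequentially by (intro tendsto_eventually) auto
qed

lemma locally_integrable_translate:
  fixes f :: "real^'n \<Rightarrow> 'b::euclidean_space"
  assumes "locally_integrable f"
  shows "locally_integrable (\<lambda>x. f (x + s))"
  unfolding locally_integrable_def
proof (intro allI impI)
  fix C :: "(real^'n) set" assume "compact C"
  then have "compact ((+) s ` C)" by (rule compact_translation)
  then have "integrable lebesgue (\<lambda>x. indicator ((+) s ` C) x *\<^sub>R f x)"
    using assms by (simp add: locally_integrable_def set_integrable_def)
  from integrable_translate[OF this, of s]
  have "integrable lebesgue (\<lambda>x. indicator ((+) s ` C) (x + s) *\<^sub>R f (x + s))" .
  moreover have "indicator ((+) s ` C) (x + s) = (indicator C x :: real)" for x
    by (auto simp: indicator_def add.commute)
  ultimately show "(\<lambda>x. f (x + s)) absolutely_integrable_on C"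
    by (simp add: set_integrable_def)
qed

lemma smear_translate:
  fixes f :: "real^'n \<Rightarrow> real"
  assumes "w \<in> unit_bumps" "l > 0" "locally_integrable f"
  shows "smear w l (\<lambda>y. f (y + s)) x = smear w l f (x + s)"
proof -
  have "(\<integral>y. f (y + s) * tensor w (l *\<^sub>R ((y + s) - (x + s))) \<partial>lebesgue)
      = (\<integral>y. f y * tensor w (l *\<^sub>R (y - (x + s))) \<partial>lebesgue)"
    by (rule integral_translate, rule borel_measurable_integrable, rule integrable_rescaled_tensor)
      (use assms in \<open>auto intro: locally_integrable_cbox\<close>)
  then show ?thesis by (simp add: smear_def)
qed

lemma smear_AE_cong:
  fixes f :: "real^'n \<Rightarrow> real"
  assumes "w \<in> unit_bumps" "l > 0" "locally_integrable f" "AE x in lebesgue. f x = f' x"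
  shows "smear w l f x = smear w l f' x"
proof -
  have "(\<integral>y. f y * tensor w (l *\<^sub>R (y - x)) \<partial>lebesgue) = (\<integral>y. f' y * tensor w (l *\<^sub>R (y - x)) \<partial>lebesgue)"
  proof (rule integral_AE_cong_lebesgue)
    show "integrable lebesgue (\<lambda>y. f y * tensor w (l *\<^sub>R (y - x)))"
      by (intro integrable_rescaled_tensor assms locally_integrable_cbox)
    show "AE y in lebesgue. f y * tensor w (l *\<^sub>R (y - x)) = f' y * tensor w (l *\<^sub>R (y - x))"
      using assms(4) by eventually_elim simp
  qed
  then show ?thesis by (simp add: smear_def)
qed

text \<open>The averages of \<open>g\<close> are, up to a factor, averages of \<open>\<phi>\<close>
  against a differentiated bump, and these do not change under a period of \<open>\<phi>\<close>.
  Functions with equal averages agree almost everywhere.\<close>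

lemma weak_grad_periodic:
  fixes \<phi> :: "real^'n \<Rightarrow> real"
  assumes wg: "is_weak_grad \<phi> g" and per: "AE x in lebesgue. \<phi> (x + s) = \<phi> x"
  shows "AE x in lebesgue. g (x + s) = g x"
proof -
  have li: "locally_integrable \<phi>" "locally_integrable g"
    using wg by (auto simp: is_weak_grad_def)
  have "AE x in lebesgue. g (x + s) $ i + -1 *\<^sub>R g x $ i = 0" for i
  proof (rule AE_zero_if_smear_zero)
    have lii: "locally_integrable (\<lambda>x. g (x + s) $ i)" "locally_integrable (\<lambda>x. g x $ i)"
      by (intro locally_integrable_nth locally_integrable_translate li)+
    then show "locally_integrable (\<lambda>x. g (x + s) $ i + -1 *\<^sub>R g x $ i)"
      by (rule locally_integrable_add_scaled)
    fix l :: real and x assume "l \<ge> 1"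
    then have l: "l > 0" by simp
    note ub = std_bump_unit_bumps
    let ?w = "std_bump(i := deriv (std_bump i))"
    have "smear std_bump l (\<lambda>x. g (x + s) $ i) x = smear std_bump l (\<lambda>x. g x $ i) (x + s)"
      by (rule smear_translate[OF ub l lii(2)])
    also have "\<dots> = - (l * smear ?w l \<phi> (x + s))"
      using smear_weak_grad[OF wg ub l, of i "x + s"] by simp
    also have "smear ?w l \<phi> (x + s) = smear ?w l (\<lambda>x. \<phi> (x + s)) x"
      by (rule smear_translate[symmetric, OF unit_bumps_upd_deriv[OF ub] l li(1)])
    also have "\<dots> = smear ?w l \<phi> x"
      by (rule smear_AE_cong[OF unit_bumps_upd_deriv[OF ub] l locally_integrable_translate[OF li(1)] per])
    also have "- (l * smear ?w l \<phi> x) = smear std_bump l (\<lambda>x. g x $ i) x"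
      using smear_weak_grad[OF wg ub l, of i x] by simp
    finally have eq: "smear std_bump l (\<lambda>x. g (x + s) $ i) x = smear std_bump l (\<lambda>x. g x $ i) x" .
    have "integrable lebesgue (\<lambda>y. g (y + s) $ i * tensor std_bump (l *\<^sub>R (y - x)))"
      "integrable lebesgue (\<lambda>y. g y $ i * tensor std_bump (l *\<^sub>R (y - x)))"
      by (intro integrable_rescaled_tensor ub l locally_integrable_cbox lii)+
    then have "smear std_bump l (\<lambda>x. g (x + s) $ i + -1 *\<^sub>R g x $ i) x
        = smear std_bump l (\<lambda>x. g (x + s) $ i) x - smear std_bump l (\<lambda>x. g x $ i) x"
      by (simp add: smear_def algebra_simps)
    with eq show "smear std_bump l (\<lambda>x. g (x + s) $ i + -1 *\<^sub>R g x $ i) x = 0" by simp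
  qed
  then have "AE x in lebesgue. \<forall>i\<in>UNIV. g (x + s) $ i + -1 *\<^sub>R g x $ i = 0"
    by (intro AE_finite_allI) auto
  then show ?thesis
    by eventually_elim (simp add: vec_eq_iff)
qed

lemma AE_lebesgue_on:
  assumes "\<Omega> \<in> sets lebesgue" "AE x in lebesgue. x \<in> \<Omega> \<longrightarrow> P x"
  shows "AE x in lebesgue_on \<Omega>. P x"
  using assms by (simp add: AE_restrict_space_iff)

lemma L2_cong_AE:
  fixes f g :: "real^'n \<Rightarrow> 'b::euclidean_space"
  assumes "f \<in> L2 \<Omega>" "g \<in> borel_measurable (lebesgue_on \<Omega>)" "AE x in lebesgue_on \<Omega>. f x = g x"
  shows "g \<in> L2 \<Omega>"
proof -
  have "integrable (lebesgue_on \<Omega>) (\<lambda>x. (norm (g x))\<^sup>2)"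
  proof (rule integrable_cong_AE_imp)
    show "integrable (lebesgue_on \<Omega>) (\<lambda>x. (norm (f x))\<^sup>2)" using assms(1) by (simp add: L2_def)
    show "(\<lambda>x. (norm (g x))\<^sup>2) \<in> borel_measurable (lebesgue_on \<Omega>)" using assms(2) by simp
    show "AE x in lebesgue_on \<Omega>. (norm (f x))\<^sup>2 = (norm (g x))\<^sup>2"
      using assms(3) by eventually_elim simp
  qed
  with assms(2) show ?thesis by (simp add: L2_def)
qed

lemma ip_cong_AE:
  fixes f f' g g' :: "real^'n \<Rightarrow> 'b::euclidean_space"
  assumes "f \<in> L2 \<Omega>" "f' \<in> L2 \<Omega>" "g \<in> L2 \<Omega>" "g' \<in> L2 \<Omega>"
    "AE x in lebesgue_on \<Omega>. f x = f' x" "AE x in lebesgue_on \<Omega>. g x = g' x"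
  shows "ip \<Omega> f g = ip \<Omega> f' g'"
  unfolding ip_def
proof (rule integral_cong_AE)
  show "AE x in lebesgue_on \<Omega>. f x \<bullet> g x = f' x \<bullet> g' x"
    using assms(5,6) by eventually_elim simp
qed (rule borel_measurable_integrable, rule L2_inner_integrable, fact+)+

lemma L2_periodic_cbox:
  fixes a b c d :: "real^'n"
  assumes cell: "\<And>i. a $ i < b $ i"
  shows "\<exists>N::nat. \<forall>f :: real^'n \<Rightarrow> 'b::euclidean_space. f \<in> borel_measurable lebesgue \<longrightarrow> f \<in> L2 (box a b) \<longrightarrow>
    (\<forall>i. AE x in lebesgue. f (x + ((b - a) $ i) *\<^sub>R axis i 1) = f x) \<longrightarrow>
    f \<in> L2 (cbox c d) \<and> ip (cbox c d) f f \<le> real N * ip (box a b) f f"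
proof -
  obtain N :: nat where N: "\<forall>F \<in> borel_measurable lebesgue.
    (\<forall>i. AE x in lebesgue. F (x + ((b - a) $ i) *\<^sub>R axis i 1) = F x) \<longrightarrow>
    (\<integral>\<^sup>+x. F x * indicator (cbox c d) x \<partial>lebesgue) \<le> of_nat N * (\<integral>\<^sup>+x. F x * indicator (box a b) x \<partial>lebesgue)"
    using nn_integral_periodic_le[OF cell] by blast
  have "f \<in> L2 (cbox c d) \<and> ip (cbox c d) f f \<le> real N * ip (box a b) f f"
    if f: "f \<in> borel_measurable lebesgue" "f \<in> L2 (box a b)"
      and per: "\<forall>i. AE x in lebesgue. f (x + ((b - a) $ i) *\<^sub>R axis i 1) = f x" for f :: "real^'n \<Rightarrow> 'b"
  proof -
    let ?F = "\<lambda>x. ennreal ((norm (f x))\<^sup>2)"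
    have [simp]: "?F \<in> borel_measurable lebesgue" using f(1) by simp
    have "AE x in lebesgue. ?F (x + ((b - a) $ i) *\<^sub>R axis i 1) = ?F x" for i
      using per[rule_format, of i] by eventually_elim simp
    then have "(\<integral>\<^sup>+x. ?F x * indicator (cbox c d) x \<partial>lebesgue) \<le> of_nat N * (\<integral>\<^sup>+x. ?F x * indicator (box a b) x \<partial>lebesgue)"
      by (intro N[rule_format]) auto
    then have le: "(\<integral>\<^sup>+x. ?F x \<partial>lebesgue_on (cbox c d)) \<le> of_nat N * (\<integral>\<^sup>+x. ?F x \<partial>lebesgue_on (box a b))"
      by (simp add: nn_integral_restrict_space)
    also have "\<dots> = of_nat N * ennreal (ip (box a b) f f)"
      by (simp add: nn_integral_L2[OF f(2)])
    also have "\<dots> = ennreal (real N * ip (box a b) f f)"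
      by (simp add: ennreal_mult ennreal_of_nat_eq_real_of_nat ip_def)
    finally have le: "(\<integral>\<^sup>+x. ?F x \<partial>lebesgue_on (cbox c d)) \<le> ennreal (real N * ip (box a b) f f)" .
    have L: "f \<in> L2 (cbox c d)"
    proof (subst L2_iff_nn_integral)
      show "f \<in> borel_measurable (lebesgue_on (cbox c d))"
        using f(1) by (rule measurable_restrict_space1)
      show "(\<integral>\<^sup>+x. ?F x \<partial>lebesgue_on (cbox c d)) < \<infinity>"
        using le by (rule order_le_less_trans) simp
    qed
    moreover have "0 \<le> real N * ip (box a b) f f" by (simp add: ip_def)
    ultimately show ?thesis using le by (simp add: nn_integral_L2[OF L])
  qed
  then show ?thesis by blast
qed

text \<open>Membership provides some square integrable weak gradient, whereas \<open>wgrad\<close>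
  is another choice. Uniqueness almost everywhere carries the properties over.\<close>

lemma H1per_weak_grad:
  fixes a b :: "real^'n"
  assumes "\<phi> \<in> H1per a b"
  shows "is_weak_grad \<phi> (wgrad \<phi>)" "wgrad \<phi> \<in> L2 (box a b)" "\<phi> \<in> L2 (box a b)"
    "\<phi> \<in> borel_measurable lebesgue" "wgrad \<phi> \<in> borel_measurable lebesgue"
    "AE x in lebesgue. \<phi> (x + ((b - a) $ i) *\<^sub>R axis i 1) = \<phi> x"
    "AE x in lebesgue. wgrad \<phi> (x + ((b - a) $ i) *\<^sub>R axis i 1) = wgrad \<phi> x"
proof -
  obtain g where g: "is_weak_grad \<phi> g" "g \<in> L2 (box a b)" using assms by (auto simp: H1per_def)
  show wg: "is_weak_grad \<phi> (wgrad \<phi>)"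
    unfolding wgrad_def by (rule someI[of "is_weak_grad \<phi>", OF g(1)])
  then show "\<phi> \<in> borel_measurable lebesgue" and m: "wgrad \<phi> \<in> borel_measurable lebesgue"
    by (auto simp: is_weak_grad_def intro: locally_integrable_measurable)
  show "wgrad \<phi> \<in> L2 (box a b)"
  proof (rule L2_cong_AE[OF g(2)])
    show "wgrad \<phi> \<in> borel_measurable (lebesgue_on (box a b))" using m by (rule measurable_restrict_space1)
    show "AE x in lebesgue_on (box a b). g x = wgrad \<phi> x"
      using is_weak_grad_unique[OF g(1) wg] by (intro AE_lebesgue_on) auto
  qed
  show "\<phi> \<in> L2 (box a b)" using assms by (simp add: H1per_def)
  show per: "AE x in lebesgue. \<phi> (x + ((b - a) $ i) *\<^sub>R axis i 1) = \<phi> x"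
    using assms by (simp add: H1per_def periodic_def)
  show "AE x in lebesgue. wgrad \<phi> (x + ((b - a) $ i) *\<^sub>R axis i 1) = wgrad \<phi> x"
    by (rule weak_grad_periodic[OF wg per])
qed

lemma wgrad_AE_eq:
  assumes "is_weak_grad \<phi> g"
  shows "AE x in lebesgue. wgrad \<phi> x = g x"
  using is_weak_grad_unique[OF someI[of "is_weak_grad \<phi>", OF assms] assms] by (simp add: wgrad_def)

lemma H1per_add_scaled:
  fixes a b :: "real^'n"
  assumes "\<phi> \<in> H1per a b" "\<psi> \<in> H1per a b"
  shows "(\<lambda>x. \<phi> x + c *\<^sub>R \<psi> x) \<in> H1per a b"
    "AE x in lebesgue. wgrad (\<lambda>x. \<phi> x + c *\<^sub>R \<psi> x) x = wgrad \<phi> x + c *\<^sub>R wgrad \<psi> x"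
proof -
  note 1 = H1per_weak_grad[OF assms(1)] and 2 = H1per_weak_grad[OF assms(2)]
  have wg: "is_weak_grad (\<lambda>x. \<phi> x + c *\<^sub>R \<psi> x) (\<lambda>x. wgrad \<phi> x + c *\<^sub>R wgrad \<psi> x)"
    using is_weak_grad_add_scaled[OF 1(1) 2(1), of c] by simp
  have "AE x in lebesgue. \<phi> (x + ((b - a) $ i) *\<^sub>R axis i 1) + c *\<^sub>R \<psi> (x + ((b - a) $ i) *\<^sub>R axis i 1) = \<phi> x + c *\<^sub>R \<psi> x" for i
    using 1(6)[of i] 2(6)[of i] by eventually_elim simp
  then have "periodic (b - a) (\<lambda>x. \<phi> x + c *\<^sub>R \<psi> x)"
    unfolding periodic_def by blast
  with wg L2_add_scaled[OF 1(3) 2(3), of c] L2_add_scaled[OF 1(2) 2(2), of c]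
  show "(\<lambda>x. \<phi> x + c *\<^sub>R \<psi> x) \<in> H1per a b" unfolding H1per_def by blast
  show "AE x in lebesgue. wgrad (\<lambda>x. \<phi> x + c *\<^sub>R \<psi> x) x = wgrad \<phi> x + c *\<^sub>R wgrad \<psi> x"
    by (rule wgrad_AE_eq[OF wg])
qed

lemma H1per_diff:
  fixes a b :: "real^'n"
  assumes "\<phi> \<in> H1per a b" "\<psi> \<in> H1per a b"
  shows "(\<lambda>x. \<phi> x - \<psi> x) \<in> H1per a b"
    "AE x in lebesgue. wgrad (\<lambda>x. \<phi> x - \<psi> x) x = wgrad \<phi> x - wgrad \<psi> x"
  using H1per_add_scaled[OF assms, of "-1"] by simp_all

lemma H1per_cong_AE:
  fixes a b :: "real^'n"
  assumes "\<phi> \<in> H1per a b" "AE x in lebesgue. \<phi> x = \<psi> x"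
  shows "\<psi> \<in> H1per a b"
proof -
  note 1 = H1per_weak_grad[OF assms(1)]
  have "is_weak_grad \<psi> (wgrad \<phi>)"
    by (rule is_weak_grad_AE_cong[OF 1(1) assms(2)]) simp
  moreover have "\<psi> \<in> L2 (box a b)"
  proof (rule L2_cong_AE[OF 1(3)])
    show "\<psi> \<in> borel_measurable (lebesgue_on (box a b))"
      by (rule measurable_restrict_space1) (rule borel_measurable_AE[OF 1(4) assms(2)])
    show "AE x in lebesgue_on (box a b). \<phi> x = \<psi> x"
      using assms(2) by (intro AE_lebesgue_on) auto
  qed
  moreover have "AE x in lebesgue. \<psi> (x + ((b - a) $ i) *\<^sub>R axis i 1) = \<psi> x" for i
    using 1(6)[of i] assms(2) AE_translate[OF assms(2), of "((b - a) $ i) *\<^sub>R axis i 1"]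
    by eventually_elim simp
  ultimately show ?thesis
    using 1(2) unfolding H1per_def periodic_def by blast
qed

lemma zero_in_H1per: "(\<lambda>x. 0) \<in> H1per a b"
proof -
  have "is_weak_grad (\<lambda>x. 0) (\<lambda>x. 0)"
    by (simp add: is_weak_grad_def locally_integrable_def set_integrable_def)
  then show ?thesis
    unfolding H1per_def by (auto simp: periodic_def L2_def intro!: exI[of _ "\<lambda>x. 0"])
qed

section \<open>Limits of periodic functions and completeness of \<open>H1per\<close>\<close>

lemma L2_imp_integrable:
  fixes f :: "real^'n \<Rightarrow> 'b::euclidean_space"
  assumes "f \<in> L2 \<Omega>" "\<Omega> \<in> lmeasurable"
  shows "integrable (lebesgue_on \<Omega>) f"
    "(\<integral>x. norm (f x) \<partial>lebesgue_on \<Omega>)\<^sup>2 \<le> ip \<Omega> f f * measure lebesgue \<Omega>"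
proof -
  have S: "\<Omega> \<in> sets lebesgue" using assms(2) by auto
  have 1: "(\<lambda>x. 1::real) \<in> L2 \<Omega>"
    using assms(2) by (simp add: L2_def finite_measure.integrable_const finite_measure_lebesgue_on)
  have m: "f \<in> borel_measurable (lebesgue_on \<Omega>)" using assms(1) by (simp add: L2_def)
  have n: "(\<lambda>x. norm (f x)) \<in> L2 \<Omega>"
    using assms(1) measurable_compose[OF m borel_measurable_norm] by (simp add: L2_def)
  have "integrable (lebesgue_on \<Omega>) (\<lambda>x. norm (f x))"
    using L2_inner_integrable[OF n 1] by simp
  then show "integrable (lebesgue_on \<Omega>) f" using m by (simp add: integrable_norm_iff)
  have "(ip \<Omega> (\<lambda>x. norm (f x)) (\<lambda>x. 1))\<^sup>2 \<le> ip \<Omega> (\<lambda>x. norm (f x)) (\<lambda>x. norm (f x)) * ip \<Omega> (\<lambda>x. 1) (\<lambda>x. 1::real)"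
    by (rule semi_inner.cauchy_schwarz[OF semi_inner_L2 n 1])
  moreover have "ip \<Omega> (\<lambda>x. 1) (\<lambda>x. 1::real) = measure lebesgue \<Omega>"
    using S by (simp add: ip_def measure_restrict_space)
  ultimately show "(\<integral>x. norm (f x) \<partial>lebesgue_on \<Omega>)\<^sup>2 \<le> ip \<Omega> f f * measure lebesgue \<Omega>"
    by (simp add: ip_def dot_square_norm power2_eq_square)
qed

lemma L2_imp_absolutely_integrable:
  fixes f :: "real^'n \<Rightarrow> 'b::euclidean_space"
  assumes "f \<in> L2 \<Omega>" "\<Omega> \<in> lmeasurable"
  shows "f absolutely_integrable_on \<Omega>"
  using L2_imp_integrable(1)[OF assms] assms(2) by (simp add: integrable_restrict_space set_integrable_def)

lemma locally_L2_imp_locally_integrable: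
  fixes f :: "real^'n \<Rightarrow> 'b::euclidean_space"
  assumes "\<And>c d. f \<in> L2 (cbox c d)"
  shows "locally_integrable f"
  unfolding locally_integrable_def
proof (intro allI impI)
  fix C :: "(real^'n) set" assume C: "compact C"
  then obtain c where c: "C \<subseteq> cbox (- c) c"
    using bounded_subset_cbox_symmetric[OF compact_imp_bounded] by blast
  have "f absolutely_integrable_on cbox (- c) c"
    by (rule L2_imp_absolutely_integrable[OF assms]) simp
  then show "f absolutely_integrable_on C"
    by (rule set_integrable_subset) (use c C in \<open>auto simp: compact_imp_closed\<close>)
qed

text \<open>Convergence in \<open>L2\<close> over a set of finite measure implies convergence in the
  mean there, and \<open>k\<close> is bounded and vanishes outside it. Both sides of the weak
  gradient identity are instances.\<close>

lemma integral_test_tendsto: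
  fixes F :: "nat \<Rightarrow> real^'n \<Rightarrow> 'b::euclidean_space" and k :: "real^'n \<Rightarrow> 'c::euclidean_space"
    and h :: "'c \<Rightarrow> 'b \<Rightarrow> 'd::euclidean_space"
  assumes h: "bounded_bilinear h" and hn: "\<And>x y. norm (h x y) \<le> norm x * norm y"
    and C: "C \<in> lmeasurable"
    and F: "\<And>n. F n \<in> L2 C" and G: "G \<in> L2 C"
    and lim: "(\<lambda>n. ip C (\<lambda>x. F n x - G x) (\<lambda>x. F n x - G x)) \<longlonglongrightarrow> 0"
    and k: "continuous_on UNIV k" "bounded (k ` C)" "\<And>x. x \<notin> C \<Longrightarrow> k x = 0"
  shows "(\<lambda>n. \<integral>x. h (k x) (F n x) \<partial>lebesgue) \<longlonglongrightarrow> (\<integral>x. h (k x) (G x) \<partial>lebesgue)"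
proof -
  have S: "C \<in> sets lebesgue" using C by auto
  obtain M where M: "M > 0" "\<And>x. x \<in> C \<Longrightarrow> norm (k x) \<le> M"
    using k(2) unfolding bounded_pos by auto
  have int: "integrable lebesgue (\<lambda>x. h (k x) (f x))" if "f \<in> L2 C" for f
    by (rule integrable_bounded_mult[OF h L2_imp_absolutely_integrable[OF that C] S k])
  have bound: "norm ((\<integral>x. h (k x) (F n x) \<partial>lebesgue) - (\<integral>x. h (k x) (G x) \<partial>lebesgue))
      \<le> M * sqrt (ip C (\<lambda>x. F n x - G x) (\<lambda>x. F n x - G x) * measure lebesgue C)" for n
  proof -
    let ?D = "\<lambda>x. F n x - G x"
    have D: "?D \<in> L2 C" by (rule L2_diff[OF F G])
    have Dn: "integrable (lebesgue_on C) (\<lambda>x. norm (?D x))"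
      using L2_imp_integrable(1)[OF D C] by (rule integrable_norm)
    have "(\<integral>x. h (k x) (F n x) \<partial>lebesgue) - (\<integral>x. h (k x) (G x) \<partial>lebesgue) = (\<integral>x. h (k x) (?D x) \<partial>lebesgue)"
      by (simp add: bounded_bilinear.diff_right[OF h] Bochner_Integration.integral_diff[OF int[OF F] int[OF G]])
    also have "norm \<dots> \<le> (\<integral>x. norm (h (k x) (?D x)) \<partial>lebesgue)"
      by (rule integral_norm_bound)
    also have "\<dots> \<le> (\<integral>x. indicator C x *\<^sub>R (M * norm (?D x)) \<partial>lebesgue)"
    proof (rule integral_mono)
      show "integrable lebesgue (\<lambda>x. norm (h (k x) (?D x)))" by (intro integrable_norm int D)
      show "integrable lebesgue (\<lambda>x. indicator C x *\<^sub>R (M * norm (?D x)))"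
        using integrable_mult_right[OF Dn, of M] S by (subst integrable_restrict_space[symmetric]) auto
      fix x
      show "norm (h (k x) (?D x)) \<le> indicator C x *\<^sub>R (M * norm (?D x))"
      proof (cases "x \<in> C")
        case True
        have "norm (h (k x) (?D x)) \<le> norm (k x) * norm (?D x)" by (rule hn)
        also have "\<dots> \<le> M * norm (?D x)" using M(2)[OF True] by (intro mult_right_mono) auto
        finally show ?thesis using True by simp
      next
        case False
        then show ?thesis by (simp add: k(3) bounded_bilinear.zero_left[OF h])
      qed
    qed
    also have "\<dots> = M * (\<integral>x. norm (?D x) \<partial>lebesgue_on C)"
      using S by (simp add: integral_restrict_space mult.left_commute)
    also have "\<dots> \<le> M * sqrt (ip C ?D ?D * measure lebesgue C)"
      using L2_imp_integrable(2)[OF D C] M(1) by (intro mult_left_mono real_le_rsqrt) auto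
    finally show ?thesis .
  qed
  have "(\<lambda>n. M * sqrt (ip C (\<lambda>x. F n x - G x) (\<lambda>x. F n x - G x) * measure lebesgue C)) \<longlonglongrightarrow> M * sqrt (0 * measure lebesgue C)"
    by (intro tendsto_intros lim)
  then have "(\<lambda>n. M * sqrt (ip C (\<lambda>x. F n x - G x) (\<lambda>x. F n x - G x) * measure lebesgue C)) \<longlonglongrightarrow> 0" by simp
  then have "(\<lambda>n. (\<integral>x. h (k x) (F n x) \<partial>lebesgue) - (\<integral>x. h (k x) (G x) \<partial>lebesgue)) \<longlonglongrightarrow> 0"
    by (rule Lim_null_comparison[rotated]) (use bound in simp)
  then show ?thesis by (rule LIM_zero_cancel)
qed

text \<open>Convergence is given on the cell only, but test functions may be supported anywhere.
  Periodicity spreads it to every box.\<close>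

lemma periodic_L2_limit:
  fixes F :: "nat \<Rightarrow> real^'n \<Rightarrow> 'b::euclidean_space" and a b :: "real^'n"
  assumes cell: "\<And>i. a $ i < b $ i"
    and F: "\<And>n. F n \<in> borel_measurable lebesgue" "\<And>n. F n \<in> L2 (box a b)"
    and per: "\<And>n i. AE x in lebesgue. F n (x + ((b - a) $ i) *\<^sub>R axis i 1) = F n x"
    and Cauchy: "form_Cauchy (ip (box a b)) F" and r: "strict_mono r"
    and conv: "AE x in lebesgue_on (box a b). convergent (\<lambda>k. F (r k) x)"
  defines "G \<equiv> \<lambda>x. lim (\<lambda>k. F (r k) x)"
  shows "AE x in lebesgue. (\<lambda>k. F (r k) x) \<longlonglongrightarrow> G x"
    and "AE x in lebesgue. G (x + ((b - a) $ i) *\<^sub>R axis i 1) = G x"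
    and "G \<in> borel_measurable lebesgue"
    and "G \<in> L2 (box a b)" and "(\<lambda>n. ip (box a b) (\<lambda>x. F n x - G x) (\<lambda>x. F n x - G x)) \<longlonglongrightarrow> 0"
    and "G \<in> L2 (cbox c d)" and "(\<lambda>n. ip (cbox c d) (\<lambda>x. F n x - G x) (\<lambda>x. F n x - G x)) \<longlonglongrightarrow> 0"
    and "F n \<in> L2 (cbox c d)"
proof -
  have per_all: "AE x in lebesgue. \<forall>n. F n (x + ((b - a) $ i) *\<^sub>R axis i 1) = F n x" for i
    using per by (simp add: AE_all_countable)
  have "AE x in lebesgue. convergent (\<lambda>k. F (r k) x)"
  proof (rule AE_periodic_extend[OF cell])
    show "AE x in lebesgue. x \<in> box a b \<longrightarrow> convergent (\<lambda>k. F (r k) x)"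
      using conv by (simp add: AE_restrict_space_iff)
    show "AE x in lebesgue. convergent (\<lambda>k. F (r k) (x + ((b - a) $ i) *\<^sub>R axis i 1)) = convergent (\<lambda>k. F (r k) x)" for i
      using per_all[of i] by eventually_elim simp
  qed
  then show lim: "AE x in lebesgue. (\<lambda>k. F (r k) x) \<longlonglongrightarrow> G x"
    by eventually_elim (simp add: G_def convergent_LIMSEQ_iff)
  \<comment> \<open>Where all \<open>F n\<close> are periodic, the sequences at the two points
    coincide, so \<open>lim\<close> gives the same value whether or not they converge.\<close>
  show "AE x in lebesgue. G (x + ((b - a) $ i) *\<^sub>R axis i 1) = G x"
    using per_all[of i] by eventually_elim (simp add: G_def)
  show G: "G \<in> borel_measurable lebesgue"
    unfolding G_def by (rule borel_measurable_lim_metric) (rule F)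
  have lim_on: "AE x in lebesgue_on \<Omega>. (\<lambda>k. F (r k) x) \<longlonglongrightarrow> G x" if "\<Omega> \<in> sets lebesgue" for \<Omega>
    using lim by (intro AE_lebesgue_on that) auto
  show "G \<in> L2 (box a b)" "(\<lambda>n. ip (box a b) (\<lambda>x. F n x - G x) (\<lambda>x. F n x - G x)) \<longlonglongrightarrow> 0"
    using L2_limit[OF F(2) Cauchy r lim_on measurable_restrict_space1[OF G]] by simp_all
  obtain N :: nat where N: "\<forall>f :: real^'n \<Rightarrow> 'b. f \<in> borel_measurable lebesgue \<longrightarrow> f \<in> L2 (box a b) \<longrightarrow>
    (\<forall>i. AE x in lebesgue. f (x + ((b - a) $ i) *\<^sub>R axis i 1) = f x) \<longrightarrow>
    f \<in> L2 (cbox c d) \<and> ip (cbox c d) f f \<le> real N * ip (box a b) f f"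
    using L2_periodic_cbox[OF cell] by blast
  have FC: "F n \<in> L2 (cbox c d)" for n
    using N F per by blast
  then show "F n \<in> L2 (cbox c d)" .
  have le: "ip (cbox c d) (\<lambda>x. F m x - F n x) (\<lambda>x. F m x - F n x)
      \<le> real N * ip (box a b) (\<lambda>x. F m x - F n x) (\<lambda>x. F m x - F n x)" for m n
  proof (rule N[rule_format, THEN conjunct2])
    show "(\<lambda>x. F m x - F n x) \<in> borel_measurable lebesgue" by (intro borel_measurable_diff F)
    show "(\<lambda>x. F m x - F n x) \<in> L2 (box a b)" by (intro L2_diff F)
    show "AE x in lebesgue. F m (x + ((b - a) $ i) *\<^sub>R axis i 1) - F n (x + ((b - a) $ i) *\<^sub>R axis i 1) = F m x - F n x" for i
      using per[of m i] per[of n i] by eventually_elim simp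
  qed
  have "form_Cauchy (ip (cbox c d)) F"
    unfolding form_Cauchy_def
  proof (intro allI impI)
    fix e :: real assume "e > 0"
    \<comment> \<open>\<open>N\<close> may be 0, so the added 1 keeps the division
      meaningful.\<close>
    then have "e / (real N + 1) > 0" by simp
    then obtain M where M: "\<forall>m\<ge>M. \<forall>n\<ge>M. ip (box a b) (\<lambda>x. F m x - F n x) (\<lambda>x. F m x - F n x) < e / (real N + 1)"
      using Cauchy unfolding form_Cauchy_def by blast
    have "ip (cbox c d) (\<lambda>x. F m x - F n x) (\<lambda>x. F m x - F n x) < e" if "m \<ge> M" "n \<ge> M" for m n
    proof -
      let ?q = "ip (box a b) (\<lambda>x. F m x - F n x) (\<lambda>x. F m x - F n x)"
      have "?q \<ge> 0" by (simp add: ip_def)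
      have "?q < e / (real N + 1)" using M that by blast
      then have "(real N + 1) * ?q < e" by (simp add: pos_less_divide_eq mult.commute)
      with \<open>?q \<ge> 0\<close> le[of m n] show ?thesis by (simp add: algebra_simps)
    qed
    then show "\<exists>M. \<forall>m\<ge>M. \<forall>n\<ge>M. ip (cbox c d) (\<lambda>x. F m x - F n x) (\<lambda>x. F m x - F n x) < e" by blast
  qed
  from L2_limit[OF FC this r lim_on measurable_restrict_space1[OF G]]
  show "G \<in> L2 (cbox c d)" "(\<lambda>n. ip (cbox c d) (\<lambda>x. F n x - G x) (\<lambda>x. F n x - G x)) \<longlonglongrightarrow> 0"
    by simp_all
qed

lemma form_Cauchy_subseq:
  assumes "form_Cauchy a F" "strict_mono r"
  shows "form_Cauchy a (\<lambda>n. F (r n))"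
  using assms(1) seq_suble[OF assms(2)] unfolding form_Cauchy_def by (meson order_trans)

text \<open>The weak gradient identity involves only integrals against test functions and passes to
  the limit. The subsequence converging almost everywhere is part of the conclusion because it
  identifies the limit of \<open>Z * U n\<close> later.\<close>

lemma H1per_complete:
  fixes a b :: "real^'n"
  assumes cell: "\<And>i. a $ i < b $ i" and U: "\<And>n. U n \<in> H1per a b"
    and C0: "form_Cauchy (ip (box a b)) U" and C1: "form_Cauchy (ip (box a b)) (\<lambda>n. wgrad (U n))"
  shows "\<exists>u\<in>H1per a b. (\<exists>r. strict_mono r \<and> (AE x in lebesgue. (\<lambda>k. U (r k) x) \<longlonglongrightarrow> u x)) \<and>
    (\<lambda>n. ip (box a b) (\<lambda>x. U n x - u x) (\<lambda>x. U n x - u x)) \<longlonglongrightarrow> 0 \<and>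
    (\<lambda>n. ip (box a b) (\<lambda>x. wgrad (U n) x - wgrad u x) (\<lambda>x. wgrad (U n) x - wgrad u x)) \<longlonglongrightarrow> 0"
proof -
  note H = H1per_weak_grad[OF U]
  obtain r1 where r1: "strict_mono r1" "AE x in lebesgue_on (box a b). convergent (\<lambda>k. U (r1 k) x)"
    using L2_convergent_subseq[OF H(3) C0] by blast
  \<comment> \<open>Taken inside the first subsequence, so that functions and gradients converge
    along a common one.\<close>
  obtain r2 where r2: "strict_mono r2" "AE x in lebesgue_on (box a b). convergent (\<lambda>k. wgrad (U (r1 (r2 k))) x)"
    using L2_convergent_subseq[OF H(2) form_Cauchy_subseq[OF C1 r1(1)]] by blast
  define r where "r k = r1 (r2 k)" for k
  have r: "strict_mono r"
    using strict_mono_o[OF r1(1) r2(1)] by (simp add: r_def[abs_def] comp_def)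
  have c0: "AE x in lebesgue_on (box a b). convergent (\<lambda>k. U (r k) x)"
    using r1(2)
  proof (rule eventually_mono)
    fix x assume "convergent (\<lambda>k. U (r1 k) x)"
    from convergent_subseq_convergent[OF this r2(1)] show "convergent (\<lambda>k. U (r k) x)"
      by (simp add: r_def comp_def)
  qed
  have c1: "AE x in lebesgue_on (box a b). convergent (\<lambda>k. wgrad (U (r k)) x)"
    using r2(2) by (simp add: r_def)
  define u where "u x = lim (\<lambda>k. U (r k) x)" for x
  define g where "g x = lim (\<lambda>k. wgrad (U (r k)) x)" for x
  note P = periodic_L2_limit[OF cell H(4) H(3) H(6) C0 r c0, folded u_def]
  note Q = periodic_L2_limit[OF cell H(5) H(2) H(7) C1 r c1, folded g_def]
  have "is_weak_grad u g"
    unfolding is_weak_grad_def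
  proof (intro conjI allI impI)
    show "locally_integrable u" using P(6) by (rule locally_L2_imp_locally_integrable)
    show "locally_integrable g" using Q(6) by (rule locally_L2_imp_locally_integrable)
    fix \<psi> :: "real^'n \<Rightarrow> real" assume \<psi>: "test_function \<psi>"
    note T = test_function_support[OF \<psi>]
    obtain c where c: "closure {x. \<psi> x \<noteq> 0} \<subseteq> cbox (- c) c"
      using bounded_subset_cbox_symmetric[OF compact_imp_bounded[OF T(1)]] by blast
    then have z: "\<And>x. x \<notin> cbox (- c) c \<Longrightarrow> \<psi> x = 0" "\<And>x. x \<notin> cbox (- c) c \<Longrightarrow> grad \<psi> x = 0"
      using T(4,5) by blast+
    have bd: "bounded (\<psi> ` cbox (- c) c)" "bounded (grad \<psi> ` cbox (- c) c)"
      by (rule compact_imp_bounded[OF compact_continuous_image[OF continuous_on_subset compact_cbox]],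
        rule T(2) T(3), rule subset_UNIV)+
    have A: "(\<lambda>n. \<integral>x. U n x *\<^sub>R grad \<psi> x \<partial>lebesgue) \<longlonglongrightarrow> (\<integral>x. u x *\<^sub>R grad \<psi> x \<partial>lebesgue)"
      by (rule integral_test_tendsto[OF bounded_bilinear.flip[OF bounded_bilinear_scaleR] _ _ P(8) P(6) P(7) T(3) bd(2) z(2)])
        (simp_all add: mult.commute)
    have B: "(\<lambda>n. \<integral>x. \<psi> x *\<^sub>R wgrad (U n) x \<partial>lebesgue) \<longlonglongrightarrow> (\<integral>x. \<psi> x *\<^sub>R g x \<partial>lebesgue)"
      by (rule integral_test_tendsto[OF bounded_bilinear_scaleR _ _ Q(8) Q(6) Q(7) T(2) bd(1) z(1)]) simp_all
    have E: "(\<integral>x. U n x *\<^sub>R grad \<psi> x \<partial>lebesgue) = - (\<integral>x. \<psi> x *\<^sub>R wgrad (U n) x \<partial>lebesgue)" for n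
      using H(1)[of n] \<psi> by (simp add: is_weak_grad_def)
    show "(\<integral>x. u x *\<^sub>R grad \<psi> x \<partial>lebesgue) = - (\<integral>x. \<psi> x *\<^sub>R g x \<partial>lebesgue)"
      by (rule LIMSEQ_unique[OF A[unfolded E] tendsto_minus[OF B]])
  qed
  moreover have "periodic (b - a) u" unfolding periodic_def using P(2) by blast
  ultimately have u: "u \<in> H1per a b"
    using P(4) Q(4) unfolding H1per_def by blast
  have "(\<lambda>n. ip (box a b) (\<lambda>x. wgrad (U n) x - wgrad u x) (\<lambda>x. wgrad (U n) x - wgrad u x)) \<longlonglongrightarrow> 0"
  proof -
    have "AE x in lebesgue_on (box a b). wgrad (U n) x - wgrad u x = wgrad (U n) x - g x" for n
      using wgrad_AE_eq[OF \<open>is_weak_grad u g\<close>] by (intro AE_lebesgue_on) auto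
    then have "ip (box a b) (\<lambda>x. wgrad (U n) x - wgrad u x) (\<lambda>x. wgrad (U n) x - wgrad u x)
        = ip (box a b) (\<lambda>x. wgrad (U n) x - g x) (\<lambda>x. wgrad (U n) x - g x)" for n
      by (intro ip_cong_AE L2_diff H Q H1per_weak_grad[OF u]) auto
    with Q(5) show ?thesis by simp
  qed
  with u r P(1) P(5) show ?thesis by blast
qed

section \<open>The variational problem\<close>

lemma semi_inner_add_scaled:
  assumes "semi_inner V p" "semi_inner V q" "c \<ge> 0"
  shows "semi_inner V (\<lambda>u v. p u v + c * q u v)"
proof -
  interpret p: semi_inner V p by fact
  interpret q: semi_inner V q by fact
  show ?thesis
  proof
    fix u v w t assume uv: "u \<in> V" "v \<in> V"
    show "(\<lambda>x. u x + t *\<^sub>R v x) \<in> V" by (rule p.closed[OF uv])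
    show "p u v + c * q u v = p v u + c * q v u" using p.sym[OF uv] q.sym[OF uv] by simp
    show "0 \<le> p u u + c * q u u" using p.nonneg[OF uv(1)] q.nonneg[OF uv(1)] assms(3) by simp
    assume "w \<in> V"
    with uv show "p (\<lambda>x. u x + t *\<^sub>R v x) w + c * q (\<lambda>x. u x + t *\<^sub>R v x) w
        = p u w + c * q u w + t * (p v w + c * q v w)"
      by (simp add: p.lin q.lin algebra_simps)
  qed
qed

text \<open>Linearity of \<open>T\<close> is asked only almost everywhere, since
  \<open>wgrad\<close> is a choice of representatives. The other instances are the identity and
  multiplication by a coefficient.\<close>

lemma semi_inner_pullback:
  fixes T :: "('x \<Rightarrow> 'a::real_vector) \<Rightarrow> real^'n \<Rightarrow> 'b::euclidean_space"
  assumes closed: "\<And>u v c. u \<in> V \<Longrightarrow> v \<in> V \<Longrightarrow> (\<lambda>x. u x + c *\<^sub>R v x) \<in> V"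
    and T: "\<And>u. u \<in> V \<Longrightarrow> T u \<in> L2 \<Omega>"
    and lin: "\<And>u v c. u \<in> V \<Longrightarrow> v \<in> V \<Longrightarrow>
      AE x in lebesgue_on \<Omega>. T (\<lambda>x. u x + c *\<^sub>R v x) x = T u x + c *\<^sub>R T v x"
  shows "semi_inner V (\<lambda>u v. ip \<Omega> (T u) (T v))"
proof
  fix u v w c assume uv: "u \<in> V" "v \<in> V"
  show "(\<lambda>x. u x + c *\<^sub>R v x) \<in> V" by (rule closed[OF uv])
  show "ip \<Omega> (T u) (T v) = ip \<Omega> (T v) (T u)" by (simp add: ip_def inner_commute)
  show "0 \<le> ip \<Omega> (T u) (T u)" by (simp add: ip_def)
  assume w: "w \<in> V"
  have "ip \<Omega> (T (\<lambda>x. u x + c *\<^sub>R v x)) (T w) = ip \<Omega> (\<lambda>x. T u x + c *\<^sub>R T v x) (T w)"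
    using uv w by (intro ip_cong_AE T closed L2_add_scaled lin) simp_all
  also have "\<dots> = ip \<Omega> (T u) (T w) + c * ip \<Omega> (T v) (T w)"
    by (rule semi_inner.lin[OF semi_inner_L2 T[OF uv(1)] T[OF uv(2)] T[OF w]])
  finally show "ip \<Omega> (T (\<lambda>x. u x + c *\<^sub>R v x)) (T w) = ip \<Omega> (T u) (T w) + c * ip \<Omega> (T v) (T w)" .
qed

lemma L2_bounded_mult:
  fixes k f :: "real^'n \<Rightarrow> real"
  assumes k: "k \<in> borel_measurable (lebesgue_on \<Omega>)" "AE x in lebesgue_on \<Omega>. \<bar>k x\<bar> \<le> M"
    and f: "f \<in> L2 \<Omega>"
  shows "(\<lambda>x. k x * f x) \<in> L2 \<Omega>" "ip \<Omega> (\<lambda>x. k x * f x) (\<lambda>x. k x * f x) \<le> M\<^sup>2 * ip \<Omega> f f"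
proof -
  have fm: "f \<in> borel_measurable (lebesgue_on \<Omega>)" and fi: "integrable (lebesgue_on \<Omega>) (\<lambda>x. (norm (f x))\<^sup>2)"
    using f by (simp_all add: L2_def)
  have km: "(\<lambda>x. k x * f x) \<in> borel_measurable (lebesgue_on \<Omega>)"
    by (intro borel_measurable_times k fm)
  have le: "AE x in lebesgue_on \<Omega>. (norm (k x * f x))\<^sup>2 \<le> M\<^sup>2 * (norm (f x))\<^sup>2"
    using k(2)
  proof eventually_elim
    fix x assume "\<bar>k x\<bar> \<le> M"
    then have "(k x)\<^sup>2 \<le> M\<^sup>2" by (metis abs_ge_zero power2_abs power_mono)
    then show "(norm (k x * f x))\<^sup>2 \<le> M\<^sup>2 * (norm (f x))\<^sup>2"
      by (simp add: power_mult_distrib mult_right_mono)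
  qed
  have int: "integrable (lebesgue_on \<Omega>) (\<lambda>x. (norm (k x * f x))\<^sup>2)"
  proof (rule Bochner_Integration.integrable_bound)
    show "integrable (lebesgue_on \<Omega>) (\<lambda>x. M\<^sup>2 * (norm (f x))\<^sup>2)" by (intro integrable_mult_right fi)
    show "(\<lambda>x. (norm (k x * f x))\<^sup>2) \<in> borel_measurable (lebesgue_on \<Omega>)" using km by simp
    show "AE x in lebesgue_on \<Omega>. norm ((norm (k x * f x))\<^sup>2) \<le> norm (M\<^sup>2 * (norm (f x))\<^sup>2)"
      using le by eventually_elim simp
  qed
  with km show "(\<lambda>x. k x * f x) \<in> L2 \<Omega>" by (simp add: L2_def)
  have "(\<integral>x. (norm (k x * f x))\<^sup>2 \<partial>lebesgue_on \<Omega>) \<le> (\<integral>x. M\<^sup>2 * (norm (f x))\<^sup>2 \<partial>lebesgue_on \<Omega>)"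
    by (rule integral_mono_AE[OF int integrable_mult_right[OF fi] le])
  then show "ip \<Omega> (\<lambda>x. k x * f x) (\<lambda>x. k x * f x) \<le> M\<^sup>2 * ip \<Omega> f f"
    by (simp only: ip_def dot_square_norm integral_mult_right_zero)
qed

lemma form_Cauchy_dominated:
  assumes "form_Cauchy p F" "c > 0"
    and "\<And>m n. c * q (\<lambda>x. G m x - G n x) (\<lambda>x. G m x - G n x) \<le> p (\<lambda>x. F m x - F n x) (\<lambda>x. F m x - F n x)"
  shows "form_Cauchy q G"
  unfolding form_Cauchy_def
proof (intro allI impI)
  fix e :: real assume "e > 0"
  then have "c * e > 0" using assms(2) by simp
  then obtain N where N: "\<forall>m\<ge>N. \<forall>n\<ge>N. p (\<lambda>x. F m x - F n x) (\<lambda>x. F m x - F n x) < c * e"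
    using assms(1) unfolding form_Cauchy_def by blast
  have "q (\<lambda>x. G m x - G n x) (\<lambda>x. G m x - G n x) < e" if "m \<ge> N" "n \<ge> N" for m n
  proof -
    have "c * q (\<lambda>x. G m x - G n x) (\<lambda>x. G m x - G n x) < c * e"
      using assms(3)[of m n] N that by (meson le_less_trans)
    then show ?thesis using assms(2) by simp
  qed
  then show "\<exists>N. \<forall>m\<ge>N. \<forall>n\<ge>N. q (\<lambda>x. G m x - G n x) (\<lambda>x. G m x - G n x) < e" by blast
qed

text \<open>The first equation uses all four terms, the second one only those with \<open>c1\<close> and \<open>c2\<close>.\<close>

definition energy :: "(real^'n) set \<Rightarrow> real \<Rightarrow> (real^'n \<Rightarrow> real) \<Rightarrow> real \<Rightarrow> real \<Rightarrow> real \<Rightarrow> (real^'n \<Rightarrow> real) \<Rightarrow>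
    (real^'n \<Rightarrow> real) \<Rightarrow> (real^'n \<Rightarrow> real) \<Rightarrow> real" where
  "energy \<Omega> c0 t c1 c2 c3 Z \<phi> \<psi> = c0 * ip \<Omega> (\<lambda>x. t x * \<phi> x) \<psi> + c1 * ip \<Omega> \<phi> \<psi>
     + c2 * ip \<Omega> (wgrad \<phi>) (wgrad \<psi>) + c3 * ip \<Omega> (\<lambda>x. Z x * \<phi> x) (\<lambda>x. Z x * \<psi> x)"

text \<open>The coefficient \<open>Z\<close> is assumed neither bounded nor measurable by itself,
  and no norm estimate for the products is required; \<open>t\<close>, in contrast, is
  bounded.\<close>

locale cell_coefficients =
  fixes a b :: "real^'n" and t Z :: "real^'n \<Rightarrow> real" and M :: real
  assumes cell: "\<And>i. a $ i < b $ i"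
    and t_meas: "t \<in> borel_measurable (lebesgue_on (box a b))"
    and t_nonneg: "\<And>x. t x \<ge> 0"
    and t_bound: "AE x in lebesgue_on (box a b). \<bar>t x\<bar> \<le> M"
    and Z: "\<And>w. w \<in> H1per a b \<Longrightarrow> (\<lambda>x. Z x * w x) \<in> L2 (box a b)"
begin

lemma wgrad_lin_on_box:
  assumes "\<phi> \<in> H1per a b" "\<psi> \<in> H1per a b"
  shows "AE x in lebesgue_on (box a b). wgrad (\<lambda>x. \<phi> x + c *\<^sub>R \<psi> x) x = wgrad \<phi> x + c *\<^sub>R wgrad \<psi> x"
  using H1per_add_scaled(2)[OF assms, of c] by (intro AE_lebesgue_on) auto

lemma semi_inner_ip: "semi_inner (H1per a b) (ip (box a b))"
  by (rule semi_inner_pullback[where T = "\<lambda>u. u"])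
    (assumption | rule H1per_add_scaled(1) H1per_weak_grad(3) AE_I2 refl)+

lemma semi_inner_grad: "semi_inner (H1per a b) (\<lambda>u v. ip (box a b) (wgrad u) (wgrad v))"
  by (rule semi_inner_pullback) (assumption | rule H1per_add_scaled(1) H1per_weak_grad(2) wgrad_lin_on_box)+

lemma semi_inner_Z: "semi_inner (H1per a b) (\<lambda>u v. ip (box a b) (\<lambda>x. Z x * u x) (\<lambda>x. Z x * v x))"
  by (rule semi_inner_pullback[where T = "\<lambda>u x. Z x * u x"])
    (assumption | rule H1per_add_scaled(1) Z | simp add: distrib_left)+

text \<open>Splitting the weight as sqrt t * sqrt t makes the form a pullback of the
  \<open>L2\<close> product; this uses t >= 0.\<close>

lemma semi_inner_t: "semi_inner (H1per a b) (\<lambda>u v. ip (box a b) (\<lambda>x. t x * u x) v)"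
proof -
  have "AE x in lebesgue_on (box a b). \<bar>sqrt (t x)\<bar> \<le> sqrt M"
    using t_bound by eventually_elim (simp add: t_nonneg)
  moreover have "(\<lambda>x. sqrt (t x)) \<in> borel_measurable (lebesgue_on (box a b))"
    using t_meas by simp
  ultimately have "(\<lambda>x. sqrt (t x) * u x) \<in> L2 (box a b)" if "u \<in> H1per a b" for u
    using L2_bounded_mult(1) H1per_weak_grad(3)[OF that] by blast
  then have "semi_inner (H1per a b) (\<lambda>u v. ip (box a b) (\<lambda>x. sqrt (t x) * u x) (\<lambda>x. sqrt (t x) * v x))"
    by (intro semi_inner_pullback[where T = "\<lambda>u x. sqrt (t x) * u x"])
      (assumption | rule H1per_add_scaled(1) | simp add: distrib_left)+
  moreover have "(sqrt (t x) * u x) * (sqrt (t x) * v x) = t x * u x * v x" for u v :: "real^'n \<Rightarrow> real" and x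
  proof -
    have "(sqrt (t x) * u x) * (sqrt (t x) * v x) = (sqrt (t x) * sqrt (t x)) * (u x * v x)"
      by (simp only: mult_ac)
    then show ?thesis using t_nonneg[of x] by simp
  qed
  ultimately show ?thesis by (simp add: ip_def)
qed

lemma semi_inner_energy:
  assumes "c0 \<ge> 0" "c1 \<ge> 0" "c2 \<ge> 0" "c3 \<ge> 0"
  shows "semi_inner (H1per a b) (energy (box a b) c0 t c1 c2 c3 Z)"
proof -
  have zero: "semi_inner (H1per a b) (\<lambda>u v. 0)"
    by standard (auto intro: H1per_add_scaled(1)[unfolded real_scaleR_def])
  have "semi_inner (H1per a b) (\<lambda>u v. 0 + c0 * ip (box a b) (\<lambda>x. t x * u x) v + c1 * ip (box a b) u v
      + c2 * ip (box a b) (wgrad u) (wgrad v) + c3 * ip (box a b) (\<lambda>x. Z x * u x) (\<lambda>x. Z x * v x))"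
    by (intro semi_inner_add_scaled zero semi_inner_t semi_inner_ip semi_inner_grad semi_inner_Z assms)
  moreover have "(\<lambda>u v. 0 + c0 * ip (box a b) (\<lambda>x. t x * u x) v + c1 * ip (box a b) u v
      + c2 * ip (box a b) (wgrad u) (wgrad v) + c3 * ip (box a b) (\<lambda>x. Z x * u x) (\<lambda>x. Z x * v x))
      = energy (box a b) c0 t c1 c2 c3 Z"
    by (intro ext) (simp add: energy_def)
  ultimately show ?thesis by simp
qed

lemma energy_ge:
  assumes "c0 \<ge> 0" "c1 \<ge> 0" "c2 \<ge> 0" "c3 \<ge> 0" "u \<in> H1per a b"
  shows "c1 * ip (box a b) u u \<le> energy (box a b) c0 t c1 c2 c3 Z u u"
    "c2 * ip (box a b) (wgrad u) (wgrad u) \<le> energy (box a b) c0 t c1 c2 c3 Z u u"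
    "c3 * ip (box a b) (\<lambda>x. Z x * u x) (\<lambda>x. Z x * u x) \<le> energy (box a b) c0 t c1 c2 c3 Z u u"
proof -
  have "0 \<le> c0 * ip (box a b) (\<lambda>x. t x * u x) u" "0 \<le> c1 * ip (box a b) u u"
    "0 \<le> c2 * ip (box a b) (wgrad u) (wgrad u)"
    "0 \<le> c3 * ip (box a b) (\<lambda>x. Z x * u x) (\<lambda>x. Z x * u x)"
    using assms semi_inner.nonneg[OF semi_inner_t assms(5)]
    by (auto intro!: mult_nonneg_nonneg simp: ip_def)
  then show "c1 * ip (box a b) u u \<le> energy (box a b) c0 t c1 c2 c3 Z u u"
    "c2 * ip (box a b) (wgrad u) (wgrad u) \<le> energy (box a b) c0 t c1 c2 c3 Z u u"
    "c3 * ip (box a b) (\<lambda>x. Z x * u x) (\<lambda>x. Z x * u x) \<le> energy (box a b) c0 t c1 c2 c3 Z u u"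
    by (simp_all add: energy_def)
qed

lemma ip_t_le:
  assumes "u \<in> H1per a b"
  shows "\<bar>ip (box a b) (\<lambda>x. t x * u x) u\<bar> \<le> \<bar>M\<bar> * ip (box a b) u u"
proof -
  note u = H1per_weak_grad(3)[OF assms]
  have "(ip (box a b) (\<lambda>x. t x * u x) u)\<^sup>2 \<le> ip (box a b) (\<lambda>x. t x * u x) (\<lambda>x. t x * u x) * ip (box a b) u u"
    by (rule semi_inner.cauchy_schwarz[OF semi_inner_L2 L2_bounded_mult(1)[OF t_meas t_bound u] u])
  also have "\<dots> \<le> (M\<^sup>2 * ip (box a b) u u) * ip (box a b) u u"
    by (intro mult_right_mono L2_bounded_mult(2)[OF t_meas t_bound u]) (simp add: ip_def)
  also have "\<dots> = (\<bar>M\<bar> * ip (box a b) u u)\<^sup>2" by (simp add: power2_eq_square)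
  finally have "\<bar>ip (box a b) (\<lambda>x. t x * u x) u\<bar> \<le> \<bar>\<bar>M\<bar> * ip (box a b) u u\<bar>"
    by (rule abs_le_square_iff[THEN iffD2])
  moreover have "0 \<le> ip (box a b) u u" by (simp add: ip_def)
  ultimately show ?thesis by simp
qed

text \<open>The mass and gradient terms yield a limit in \<open>H1per\<close>, and boundedness of
  \<open>t\<close> settles its term. For \<open>Z\<close> the energy makes the products Cauchy in
  \<open>L2\<close>, and pointwise convergence of a subsequence shows that their limit is
  \<open>Z * u\<close>.\<close>

lemma energy_complete:
  assumes c: "c0 \<ge> 0" "c1 > 0" "c2 > 0" "c3 \<ge> 0"
  shows "form_complete (H1per a b) (energy (box a b) c0 t c1 c2 c3 Z)"
  unfolding form_complete_def
proof (intro allI impI)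
  let ?E = "energy (box a b) c0 t c1 c2 c3 Z" and ?I = "ip (box a b)"
  fix U assume "\<forall>n. U n \<in> H1per a b" and Cauchy: "form_Cauchy ?E U"
  then have U: "U n \<in> H1per a b" for n by blast
  have D: "(\<lambda>x. U m x - U n x) \<in> H1per a b" for m n by (rule H1per_diff(1)[OF U U])
  have ge: "c1 * ?I u u \<le> ?E u u" "c2 * ?I (wgrad u) (wgrad u) \<le> ?E u u"
    "c3 * ?I (\<lambda>x. Z x * u x) (\<lambda>x. Z x * u x) \<le> ?E u u" if "u \<in> H1per a b" for u
    using c by (auto intro!: energy_ge that)
  have grad_diff: "?I (wgrad (\<lambda>x. u x - v x)) (wgrad (\<lambda>x. u x - v x))
      = ?I (\<lambda>x. wgrad u x - wgrad v x) (\<lambda>x. wgrad u x - wgrad v x)" if "u \<in> H1per a b" "v \<in> H1per a b" for u v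
  proof -
    have "AE x in lebesgue_on (box a b). wgrad (\<lambda>x. u x - v x) x = wgrad u x - wgrad v x"
      using H1per_diff(2)[OF that] by (intro AE_lebesgue_on) auto
    then show ?thesis
      by (intro ip_cong_AE L2_diff H1per_weak_grad(2) H1per_diff(1) that)
  qed
  have C0: "form_Cauchy ?I U"
    by (rule form_Cauchy_dominated[OF Cauchy c(2)]) (rule ge(1)[OF D])
  have C1: "form_Cauchy ?I (\<lambda>n. wgrad (U n))"
    by (rule form_Cauchy_dominated[OF Cauchy c(3)]) (use ge(2)[OF D] in \<open>simp only: grad_diff[OF U U]\<close>)
  obtain u r where u: "u \<in> H1per a b" and r: "strict_mono r" "AE x in lebesgue. (\<lambda>k. U (r k) x) \<longlonglongrightarrow> u x"
    and lim0: "(\<lambda>n. ?I (\<lambda>x. U n x - u x) (\<lambda>x. U n x - u x)) \<longlonglongrightarrow> 0"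
    and lim1: "(\<lambda>n. ?I (\<lambda>x. wgrad (U n) x - wgrad u x) (\<lambda>x. wgrad (U n) x - wgrad u x)) \<longlonglongrightarrow> 0"
    using H1per_complete[OF cell U C0 C1] by blast
  let ?w = "\<lambda>n x. U n x - u x"
  have w: "?w n \<in> H1per a b" for n by (rule H1per_diff(1)[OF U u])
  have limZ: "(\<lambda>n. c3 * ?I (\<lambda>x. Z x * ?w n x) (\<lambda>x. Z x * ?w n x)) \<longlonglongrightarrow> 0"
  \<comment> \<open>For c3 = 0 the energy gives no control over \<open>Z\<close>, but the term
    vanishes too. This case serves the second equation.\<close>
  proof (cases "c3 = 0")
    case False
    then have "c3 > 0" using c(4) by simp
    have CZ: "form_Cauchy ?I (\<lambda>n x. Z x * U n x)"
      by (rule form_Cauchy_dominated[OF Cauchy \<open>c3 > 0\<close>]) (use ge(3)[OF D] in \<open>simp only: right_diff_distrib\<close>)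
    have "AE x in lebesgue_on (box a b). (\<lambda>k. Z x * U (r k) x) \<longlonglongrightarrow> Z x * u x"
      using r(2) by (intro AE_lebesgue_on) (auto elim!: eventually_mono intro: tendsto_mult_left)
    from L2_limit(2)[OF Z[OF U] CZ r(1) this] Z[OF u]
    have "(\<lambda>n. ?I (\<lambda>x. Z x * U n x - Z x * u x) (\<lambda>x. Z x * U n x - Z x * u x)) \<longlonglongrightarrow> 0"
      by (simp add: L2_def)
    from tendsto_mult_right_zero[OF this, of c3] show ?thesis by (simp only: right_diff_distrib)
  qed simp
  have limt: "(\<lambda>n. ?I (\<lambda>x. t x * ?w n x) (?w n)) \<longlonglongrightarrow> 0"
  proof (rule Lim_null_comparison)
    show "\<forall>\<^sub>F n in sequentially. norm (?I (\<lambda>x. t x * ?w n x) (?w n)) \<le> \<bar>M\<bar> * ?I (?w n) (?w n)"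
      using ip_t_le[OF w] by simp
    show "(\<lambda>n. \<bar>M\<bar> * ?I (?w n) (?w n)) \<longlonglongrightarrow> 0" by (rule tendsto_mult_right_zero[OF lim0])
  qed
  have "(\<lambda>n. c0 * ?I (\<lambda>x. t x * ?w n x) (?w n) + c1 * ?I (?w n) (?w n)
      + c2 * ?I (wgrad (?w n)) (wgrad (?w n)) + c3 * ?I (\<lambda>x. Z x * ?w n x) (\<lambda>x. Z x * ?w n x))
      \<longlonglongrightarrow> c0 * 0 + c1 * 0 + c2 * 0 + 0"
    unfolding grad_diff[OF U u] by (intro tendsto_intros limt lim0 lim1 limZ)
  then have "(\<lambda>n. ?E (?w n) (?w n)) \<longlonglongrightarrow> 0" by (simp add: energy_def)
  with u show "\<exists>u\<in>H1per a b. (\<lambda>n. ?E (\<lambda>x. U n x - u x) (\<lambda>x. U n x - u x)) \<longlonglongrightarrow> 0" by blast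
qed

end

lemma H1per_eq_zero_AE:
  fixes a b :: "real^'n"
  assumes "\<And>i. a $ i < b $ i" "w \<in> H1per a b" "ip (box a b) w w = 0"
  shows "AE x in lebesgue. w x = 0"
proof (rule AE_periodic_extend[OF assms(1)])
  note w = H1per_weak_grad[OF assms(2)]
  have "AE x in lebesgue_on (box a b). (norm (w x))\<^sup>2 = 0"
    using assms(3) w(3) by (subst (asm) ip_def, unfold dot_square_norm, subst (asm) integral_nonneg_eq_0_iff_AE)
      (auto simp: L2_def)
  then show "AE x in lebesgue. x \<in> box a b \<longrightarrow> w x = 0"
    by (simp add: AE_restrict_space_iff)
  show "AE x in lebesgue. (w (x + ((b - a) $ i) *\<^sub>R axis i 1) = 0) = (w x = 0)" for i
    using w(6)[of i] by eventually_elim simp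
qed

text \<open>The data are split as \<open>h - Zs * A\<close> because the product need not be square
  integrable. Moving \<open>Zs\<close> onto the test function gives a functional that the
  \<open>Zs\<close> term of the first energy bounds.\<close>

lemma variational_problem_well_posed:
  fixes a b :: "real^'n" and \<tau>s Zs dps h A f\<^sub>1 f\<^sub>2 :: "real^'n \<Rightarrow> real"
  assumes cell: "\<And>i. a $ i < b $ i"
    and params: "\<delta>t > 0" "\<epsilon> > 0" "lam > 0" "K > 0" "D > 0" "S\<^sub>1 > 0" "S\<^sub>2 > 0"
    and \<tau>s: "\<tau>s \<in> borel_measurable (lebesgue_on (box a b))" "\<And>x. \<tau>s x \<ge> 0"
      "AE x in lebesgue_on (box a b). \<bar>\<tau>s x\<bar> \<le> M"
    and dps: "dps \<in> borel_measurable (lebesgue_on (box a b))"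
      "AE x in lebesgue_on (box a b). \<bar>dps x\<bar> \<le> M'"
    and Zs: "\<And>w. w \<in> H1per a b \<Longrightarrow> (\<lambda>x. Zs x * w x) \<in> L2 (box a b)"
    and h: "h \<in> L2 (box a b)" and A: "A \<in> L2 (box a b)"
    and f\<^sub>1: "f\<^sub>1 = (\<lambda>x. h x - Zs x * A x)" and f\<^sub>2: "f\<^sub>2 \<in> L2 (box a b)"
  shows "\<exists>\<phi> u. solves_variational_problem a b \<delta>t \<epsilon> lam K D S\<^sub>1 S\<^sub>2 \<tau>s Zs dps f\<^sub>1 f\<^sub>2 \<phi> u \<and>
      (\<forall>\<phi>' u'. solves_variational_problem a b \<delta>t \<epsilon> lam K D S\<^sub>1 S\<^sub>2 \<tau>s Zs dps f\<^sub>1 f\<^sub>2 \<phi>' u' \<longrightarrow>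
        (AE x in lebesgue. \<phi>' x = \<phi> x \<and> u' x = u x))"
proof -
  interpret cell_coefficients a b \<tau>s Zs M
    using cell \<tau>s Zs by unfold_locales
  let ?V = "H1per a b" and ?I = "ip (box a b)"
  define p where "p = energy (box a b) (3 / (2 * \<delta>t)) \<tau>s (S\<^sub>1 / \<epsilon>\<^sup>2) S\<^sub>2 (1/2) Zs"
  \<comment> \<open>Setting the first and last weights to 0 removes \<open>\<tau>s\<close> and
    \<open>Zs\<close>, so both equations are instances of one energy.\<close>
  define q where "q = energy (box a b) 0 \<tau>s (lam / (\<epsilon> * K)) ((2 * \<delta>t / 3) * (lam * D / (\<epsilon> * K))) 0 Zs"
  define r where "r u v = lam / \<epsilon> * ?I (\<lambda>x. dps x * u x) v" for u v :: "real^'n \<Rightarrow> real"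
  define l1 where "l1 = ?I f\<^sub>1"
  define l2 where "l2 = ?I f\<^sub>2"
  have pos: "3 / (2 * \<delta>t) > 0" "S\<^sub>1 / \<epsilon>\<^sup>2 > 0" "lam / (\<epsilon> * K) > 0"
    "(2 * \<delta>t / 3) * (lam * D / (\<epsilon> * K)) > 0"
    using params by simp_all
  have p: "semi_inner ?V p" "form_complete ?V p"
    unfolding p_def using pos params by (auto intro!: semi_inner_energy energy_complete)
  have q: "semi_inner ?V q" "form_complete ?V q"
    unfolding q_def using pos by (auto intro!: semi_inner_energy energy_complete)
  have p_ge: "S\<^sub>1 / \<epsilon>\<^sup>2 * ?I u u \<le> p u u" "1/2 * ?I (\<lambda>x. Zs x * u x) (\<lambda>x. Zs x * u x) \<le> p u u" if "u \<in> ?V" for u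
    unfolding p_def using pos params by (intro energy_ge that; simp)+
  have q_ge: "lam / (\<epsilon> * K) * ?I u u \<le> q u u" if "u \<in> ?V" for u
    unfolding q_def using pos that by (intro energy_ge) auto
  have ip_le_p: "?I u u \<le> \<epsilon>\<^sup>2 / S\<^sub>1 * p u u" if "u \<in> ?V" for u
    using p_ge(1)[OF that] params by (simp add: field_simps)
  have ip_le_q: "?I u u \<le> \<epsilon> * K / lam * q u u" if "u \<in> ?V" for u
    using q_ge[OF that] params by (simp add: field_simps)
  note V_L2 = H1per_weak_grad(3)
  note CS = semi_inner.cauchy_schwarz[OF semi_inner_L2]
  have solves_iff: "solves_variational_problem a b \<delta>t \<epsilon> lam K D S\<^sub>1 S\<^sub>2 \<tau>s Zs dps f\<^sub>1 f\<^sub>2 \<phi> u \<longleftrightarrow>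
      \<phi> \<in> ?V \<and> u \<in> ?V \<and> (\<forall>\<psi>\<in>?V. \<forall>v\<in>?V. p \<phi> \<psi> + r u \<psi> = l1 \<psi> \<and> q u v - r \<phi> v = l2 v)" for \<phi> u
    unfolding solves_variational_problem_def Let_def p_def q_def r_def l1_def l2_def energy_def by simp
  have r_L2: "(\<lambda>x. dps x * u x) \<in> L2 (box a b)" if "u \<in> ?V" for u
    by (rule L2_bounded_mult(1)[OF dps V_L2[OF that]])
  have r_lin: "r (\<lambda>x. u x + c *\<^sub>R v x) w = r u w + c * r v w" if "u \<in> ?V" "v \<in> ?V" "w \<in> ?V" for u v w c
    using semi_inner.lin[OF semi_inner_L2 r_L2[OF that(1)] r_L2[OF that(2)] V_L2[OF that(3)], of c]
    by (simp add: r_def algebra_simps)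
  have r_sym: "r u v = r v u" for u v
    by (simp add: r_def ip_def mult_ac)
  \<comment> \<open>Apart from (lam / eps)^2 and the square of the bound on \<open>dps\<close>, the
    constant consists of the inverses of the two mass coefficients; the gradient terms do not
    enter.\<close>
  have r_bound: "(r u v)\<^sup>2 \<le> ((lam / \<epsilon>)\<^sup>2 * M'\<^sup>2 * (\<epsilon>\<^sup>2 / S\<^sub>1) * (\<epsilon> * K / lam)) * p u u * q v v"
    if uv: "u \<in> ?V" "v \<in> ?V" for u v
  proof -
    have "(r u v)\<^sup>2 = (lam / \<epsilon>)\<^sup>2 * (?I (\<lambda>x. dps x * u x) v)\<^sup>2"
      unfolding r_def by (rule power_mult_distrib)
    also have "\<dots> \<le> (lam / \<epsilon>)\<^sup>2 * (?I (\<lambda>x. dps x * u x) (\<lambda>x. dps x * u x) * ?I v v)"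
      by (intro mult_left_mono CS r_L2 V_L2 uv) simp
    also have "\<dots> \<le> (lam / \<epsilon>)\<^sup>2 * ((M'\<^sup>2 * ?I u u) * ?I v v)"
      by (intro mult_left_mono mult_right_mono L2_bounded_mult(2)[OF dps V_L2[OF uv(1)]])
        (simp_all add: ip_def)
    also have "\<dots> \<le> (lam / \<epsilon>)\<^sup>2 * ((M'\<^sup>2 * (\<epsilon>\<^sup>2 / S\<^sub>1 * p u u)) * (\<epsilon> * K / lam * q v v))"
    proof (intro mult_left_mono mult_mono ip_le_p ip_le_q uv)
      have "0 \<le> \<epsilon>\<^sup>2 / S\<^sub>1 * p u u"
        using params semi_inner.nonneg[OF p(1) uv(1)] by simp
      then show "0 \<le> M'\<^sup>2 * (\<epsilon>\<^sup>2 / S\<^sub>1 * p u u)" by (rule mult_nonneg_nonneg[OF zero_le_power2])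
    qed (simp_all add: ip_def)
    finally show ?thesis by (simp only: mult_ac)
  qed
  have hA: "?I f\<^sub>1 \<psi> = ?I h \<psi> - ?I A (\<lambda>x. Zs x * \<psi> x)" if "\<psi> \<in> ?V" for \<psi>
  proof -
    have "?I f\<^sub>1 \<psi> = (\<integral>x. h x \<bullet> \<psi> x - A x \<bullet> (Zs x * \<psi> x) \<partial>lebesgue_on (box a b))"
      by (simp add: ip_def f\<^sub>1 algebra_simps)
    also have "\<dots> = ?I h \<psi> - ?I A (\<lambda>x. Zs x * \<psi> x)"
      unfolding ip_def
      by (rule Bochner_Integration.integral_diff[OF L2_inner_integrable[OF h V_L2[OF that]]
            L2_inner_integrable[OF A Zs[OF that]]])
    finally show ?thesis .
  qed
  have l1_lin: "l1 (\<lambda>x. u x + c *\<^sub>R v x) = l1 u + c * l1 v" if uv: "u \<in> ?V" "v \<in> ?V" for u v c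
  proof -
    have "?I h (\<lambda>x. u x + c *\<^sub>R v x) = ?I h u + c * ?I h v"
      by (rule semi_inner.lin_right[OF semi_inner_L2 V_L2[OF uv(1)] V_L2[OF uv(2)] h])
    moreover have "?I A (\<lambda>x. Zs x * u x + c *\<^sub>R (Zs x * v x)) = ?I A (\<lambda>x. Zs x * u x) + c * ?I A (\<lambda>x. Zs x * v x)"
      by (rule semi_inner.lin_right[OF semi_inner_L2 Zs[OF uv(1)] Zs[OF uv(2)] A])
    moreover have "(\<lambda>x. Zs x * (u x + c *\<^sub>R v x)) = (\<lambda>x. Zs x * u x + c *\<^sub>R (Zs x * v x))"
      by (simp add: algebra_simps)
    ultimately show ?thesis
      unfolding l1_def hA[OF H1per_add_scaled(1)[OF uv]] hA[OF uv(1)] hA[OF uv(2)]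
      by (simp only: right_diff_distrib)
  qed
  \<comment> \<open>In the 4, one 2 comes from (x - y)^2 <= 2 x^2 + 2 y^2 and the other inverts the
    coefficient 1/2 of the \<open>Zs\<close> term.\<close>
  have l1_bound: "(l1 v)\<^sup>2 \<le> (2 * ?I h h * (\<epsilon>\<^sup>2 / S\<^sub>1) + 4 * ?I A A) * p v v" if v: "v \<in> ?V" for v
  proof -
    let ?z = "\<lambda>x. Zs x * v x"
    have nn: "0 \<le> ?I h h" "0 \<le> ?I A A" by (simp_all add: ip_def)
    have "(l1 v)\<^sup>2 \<le> 2 * (?I h v)\<^sup>2 + 2 * (?I A ?z)\<^sup>2"
      using zero_le_power2[of "?I h v + ?I A ?z"] unfolding l1_def hA[OF v]
      by (simp add: power2_eq_square algebra_simps)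
    also have "\<dots> \<le> 2 * (?I h h * ?I v v) + 2 * (?I A A * ?I ?z ?z)"
      by (intro add_mono mult_left_mono CS h A V_L2 Zs v) simp_all
    also have "\<dots> \<le> 2 * (?I h h * (\<epsilon>\<^sup>2 / S\<^sub>1 * p v v)) + 2 * (?I A A * (2 * p v v))"
      using p_ge(2)[OF v] by (intro add_mono mult_left_mono ip_le_p v nn) simp_all
    also have "\<dots> = (2 * ?I h h * (\<epsilon>\<^sup>2 / S\<^sub>1) + 4 * ?I A A) * p v v"
      by (simp add: algebra_simps)
    finally show ?thesis .
  qed
  have l2_lin: "l2 (\<lambda>x. u x + c *\<^sub>R v x) = l2 u + c * l2 v" if uv: "u \<in> ?V" "v \<in> ?V" for u v c
    unfolding l2_def by (rule semi_inner.lin_right[OF semi_inner_L2 V_L2[OF uv(1)] V_L2[OF uv(2)] f\<^sub>2])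
  have l2_bound: "(l2 v)\<^sup>2 \<le> (?I f\<^sub>2 f\<^sub>2 * (\<epsilon> * K / lam)) * q v v" if v: "v \<in> ?V" for v
  proof -
    have "(l2 v)\<^sup>2 \<le> ?I f\<^sub>2 f\<^sub>2 * ?I v v"
      unfolding l2_def by (intro CS f\<^sub>2 V_L2 v)
    also have "\<dots> \<le> ?I f\<^sub>2 f\<^sub>2 * (\<epsilon> * K / lam * q v v)"
      by (intro mult_left_mono ip_le_q v) (simp add: ip_def)
    finally show ?thesis by (simp only: mult_ac)
  qed
  have ne: "?V \<noteq> {}" using zero_in_H1per by blast
  obtain \<phi> u where sol: "\<phi> \<in> ?V" "u \<in> ?V"
    "\<forall>\<psi>\<in>?V. p \<phi> \<psi> + r u \<psi> = l1 \<psi> \<and> q u \<psi> - r \<phi> \<psi> = l2 \<psi>"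
    using skew_coupled_system_solvable[OF p(1) q(1) ne p(2) q(2) r_lin r_sym r_bound l1_lin l1_bound l2_lin l2_bound]
    by blast
  have "AE x in lebesgue. \<phi>' x = \<phi> x \<and> u' x = u x"
    if sol': "\<phi>' \<in> ?V" "u' \<in> ?V" "\<forall>\<psi>\<in>?V. \<forall>v\<in>?V. p \<phi>' \<psi> + r u' \<psi> = l1 \<psi> \<and> q u' v - r \<phi>' v = l2 v" for \<phi>' u'
  proof -
    let ?d = "\<lambda>x. \<phi>' x - \<phi> x" and ?e = "\<lambda>x. u' x - u x"
    have d: "?d \<in> ?V" and e: "?e \<in> ?V"
      using H1per_diff(1) sol(1,2) sol'(1,2) by blast+
    have "p ?d ?d = p \<phi>' ?d - p \<phi> ?d" "q ?e ?e = q u' ?e - q u ?e"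
      by (rule semi_inner.lin_diff[OF p(1) sol'(1) sol(1) d] semi_inner.lin_diff[OF q(1) sol'(2) sol(2) e])+
    moreover have "r ?e ?d = r u' ?d - r u ?d" "r ?d ?e = r \<phi>' ?e - r \<phi> ?e"
      using r_lin[OF sol'(2) sol(2) d, of "-1"] r_lin[OF sol'(1) sol(1) e, of "-1"] by simp_all
    moreover have "p \<phi>' ?d + r u' ?d = l1 ?d" "q u' ?e - r \<phi>' ?e = l2 ?e"
      "p \<phi> ?d + r u ?d = l1 ?d" "q u ?e - r \<phi> ?e = l2 ?e"
      using sol(3) sol'(3) d e by blast+
    \<comment> \<open>Each difference serves as its own test function; adding the equations cancels
      the coupling, as \<open>r\<close> is symmetric and enters with opposite signs.\<close>
    ultimately have "p ?d ?d + q ?e ?e = 0"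
      using r_sym[of ?e ?d] by linarith
    moreover have "0 \<le> p ?d ?d" "0 \<le> q ?e ?e"
      by (rule semi_inner.nonneg[OF p(1) d] semi_inner.nonneg[OF q(1) e])+
    ultimately have "p ?d ?d = 0" "q ?e ?e = 0" by linarith+
    then have "?I ?d ?d \<le> 0" "?I ?e ?e \<le> 0"
      using ip_le_p[OF d] ip_le_q[OF e] by simp_all
    moreover have "0 \<le> ?I ?d ?d" "0 \<le> ?I ?e ?e" by (simp_all add: ip_def)
    ultimately have "?I ?d ?d = 0" "?I ?e ?e = 0" by linarith+
    from H1per_eq_zero_AE[OF cell d this(1)] H1per_eq_zero_AE[OF cell e this(2)]
    show ?thesis by eventually_elim simp
  qed
  moreover have "\<forall>\<psi>\<in>?V. \<forall>v\<in>?V. p \<phi> \<psi> + r u \<psi> = l1 \<psi> \<and> q u v - r \<phi> v = l2 v"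
    using sol(3) by blast
  ultimately show ?thesis
    unfolding solves_iff using sol(1,2) by blast
qed

section \<open>Regularity of the data from the previous steps\<close>

lemma L2_lincomb:
  fixes f g :: "real^'n \<Rightarrow> real"
  assumes "f \<in> L2 \<Omega>" "g \<in> L2 \<Omega>"
  shows "(\<lambda>x. c * f x + d * g x) \<in> L2 \<Omega>"
  \<comment> \<open>Writing c f as f + (c - 1) f reduces a general combination to the operation u +
    c v.\<close>
  using L2_add_scaled[OF L2_add_scaled[OF assms(1) assms(1), of "c - 1"] assms(2), of d]
  by (simp add: algebra_simps)

lemma H1per_lincomb:
  assumes "\<phi> \<in> H1per a b" "\<psi> \<in> H1per a b"
  shows "(\<lambda>x. c * \<phi> x + d * \<psi> x) \<in> H1per a b"
  using H1per_add_scaled(1)[OF H1per_add_scaled(1)[OF assms(1) assms(1), of "c - 1"] assms(2), of d]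
  by (simp add: algebra_simps)

lemma H2per_add_scaled:
  fixes a b :: "real^'n"
  assumes "\<phi> \<in> H2per a b" "\<psi> \<in> H2per a b"
  shows "(\<lambda>x. \<phi> x + c *\<^sub>R \<psi> x) \<in> H2per a b"
proof -
  have 1: "\<phi> \<in> H1per a b" "\<psi> \<in> H1per a b"
    "\<And>i. (\<lambda>x. wgrad \<phi> x $ i) \<in> H1per a b" "\<And>i. (\<lambda>x. wgrad \<psi> x $ i) \<in> H1per a b"
    using assms by (simp_all add: H2per_def)
  have "(\<lambda>x. wgrad (\<lambda>x. \<phi> x + c *\<^sub>R \<psi> x) x $ i) \<in> H1per a b" for i
  proof (rule H1per_cong_AE)
    show "(\<lambda>x. wgrad \<phi> x $ i + c *\<^sub>R wgrad \<psi> x $ i) \<in> H1per a b"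
      by (rule H1per_add_scaled(1)[OF 1(3,4)])
    show "AE x in lebesgue. wgrad \<phi> x $ i + c *\<^sub>R wgrad \<psi> x $ i = wgrad (\<lambda>x. \<phi> x + c *\<^sub>R \<psi> x) x $ i"
      using H1per_add_scaled(2)[OF 1(1,2), of c] by eventually_elim simp
  qed
  with H1per_add_scaled(1)[OF 1(1,2), of c] show ?thesis by (simp add: H2per_def)
qed

lemma L2_nth:
  fixes g :: "real^'n \<Rightarrow> real^'m"
  assumes "g \<in> L2 \<Omega>"
  shows "(\<lambda>x. g x $ i) \<in> L2 \<Omega>"
proof -
  have m: "(\<lambda>x. g x $ i) \<in> borel_measurable (lebesgue_on \<Omega>)"
    using assms by (intro measurable_compose[OF _ borel_measurable_nth]) (simp add: L2_def)
  have "integrable (lebesgue_on \<Omega>) (\<lambda>x. (norm (g x $ i))\<^sup>2)"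
  proof (rule Bochner_Integration.integrable_bound)
    show "integrable (lebesgue_on \<Omega>) (\<lambda>x. (norm (g x))\<^sup>2)" using assms by (simp add: L2_def)
    show "(\<lambda>x. (norm (g x $ i))\<^sup>2) \<in> borel_measurable (lebesgue_on \<Omega>)" using m by simp
    show "AE x in lebesgue_on \<Omega>. norm ((norm (g x $ i))\<^sup>2) \<le> norm ((norm (g x))\<^sup>2)"
    proof (rule AE_I2)
      fix x
      have "(norm (g x $ i))\<^sup>2 \<le> (norm (g x))\<^sup>2" 
        using component_le_norm_cart[of "g x" i] by (intro power_mono) simp_all
      then show "norm ((norm (g x $ i))\<^sup>2) \<le> norm ((norm (g x))\<^sup>2)" by simp
    qed
  qed
  with m show ?thesis by (simp add: L2_def)
qed

lemma H1per_L2_cbox: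
  fixes a b :: "real^'n"
  assumes "\<And>i. a $ i < b $ i" "\<phi> \<in> H1per a b"
  shows "wgrad \<phi> \<in> L2 (cbox c d)"
proof -
  note H = H1per_weak_grad[OF assms(2)]
  show ?thesis
    using L2_periodic_cbox[OF assms(1), where c = c and d = d and 'b = "real^'n"] H(2,5,7) by blast
qed

text \<open>The averaging cubes leave the cell, so the second derivatives must be square integrable
  on a larger box; periodicity provides this.\<close>

lemma H2per_bounded:
  fixes a b :: "real^'n"
  assumes dim: "CARD('n) \<le> 3" and cell: "\<And>i. a $ i < b $ i" and \<phi>: "\<phi> \<in> H2per a b"
  shows "\<exists>M. AE x in lebesgue_on (box a b). \<bar>\<phi> x\<bar> \<le> M"
proof -
  have 1: "\<phi> \<in> H1per a b" "\<And>i. (\<lambda>x. wgrad \<phi> x $ i) \<in> H1per a b"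
    using \<phi> by (simp_all add: H2per_def)
  have "(\<lambda>x. (wgrad (\<lambda>x. wgrad \<phi> x $ i) x $ j)\<^sup>2) integrable_on cbox a (b + One)" for i j
    using L2_nth[OF H1per_L2_cbox[OF cell 1(2)[of i], of a "b + One"], of j]
    by (intro integrable_on_lebesgue_on) (simp_all add: L2_def)
  from weak_second_derivatives_imp_bounded[OF dim H1per_weak_grad(1)[OF 1(1)] H1per_weak_grad(1)[OF 1(2)] this]
  obtain M where "AE x in lebesgue. x \<in> cbox a b \<longrightarrow> \<bar>\<phi> x\<bar> \<le> M" by blast
  then have "AE x in lebesgue. x \<in> box a b \<longrightarrow> \<bar>\<phi> x\<bar> \<le> M"
    by (rule eventually_mono) (use box_subset_cbox[of a b] in blast)
  then show ?thesis by (intro exI AE_lebesgue_on) auto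
qed

lemma H2per_compose_bounded:
  fixes a b :: "real^'n" and f :: "real \<Rightarrow> real"
  assumes "CARD('n) \<le> 3" and "\<And>i. a $ i < b $ i" and \<phi>: "\<phi> \<in> H2per a b" and f: "continuous_on UNIV f"
  shows "(\<lambda>x. f (\<phi> x)) \<in> borel_measurable (lebesgue_on (box a b))"
    "\<exists>M. AE x in lebesgue_on (box a b). \<bar>f (\<phi> x)\<bar> \<le> M"
proof -
  have "\<phi> \<in> H1per a b" using \<phi> by (simp add: H2per_def)
  then have "\<phi> \<in> borel_measurable (lebesgue_on (box a b))"
    by (intro measurable_restrict_space1 H1per_weak_grad(4))
  from measurable_compose[OF this borel_measurable_continuous_onI[OF f]]
  show "(\<lambda>x. f (\<phi> x)) \<in> borel_measurable (lebesgue_on (box a b))" .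
  obtain M where M: "AE x in lebesgue_on (box a b). \<bar>\<phi> x\<bar> \<le> M"
    using H2per_bounded[OF assms(1-3)] by blast
  have "compact (f ` {- M..M})"
    by (intro compact_continuous_image continuous_on_subset[OF f]) auto
  then obtain M' where "\<And>y. y \<in> {- M..M} \<Longrightarrow> \<bar>f y\<bar> \<le> M'"
    using compact_imp_bounded bounded_iff by (metis (no_types) image_eqI real_norm_def)
  then have "AE x in lebesgue_on (box a b). \<bar>f (\<phi> x)\<bar> \<le> M'"
    by (intro eventually_mono[OF M]) (auto simp: abs_le_iff)
  then show "\<exists>M. AE x in lebesgue_on (box a b). \<bar>f (\<phi> x)\<bar> \<le> M" by blast
qed

text \<open>The trace of the second weak derivatives is a weak divergence of the gradient. One
  therefore exists, and the version chosen by \<open>wlaplacian\<close> agrees with the trace almost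
  everywhere.\<close>

lemma wlaplacian_L2:
  fixes a b :: "real^'n"
  assumes "\<phi> \<in> H2per a b"
  shows "wlaplacian \<phi> \<in> L2 (box a b)"
proof -
  have 1: "\<phi> \<in> H1per a b" "\<And>i. (\<lambda>x. wgrad \<phi> x $ i) \<in> H1per a b"
    using assms by (simp_all add: H2per_def)
  note H = H1per_weak_grad[OF 1(1)] and G = H1per_weak_grad[OF 1(2)]
  let ?G = "\<lambda>i. wgrad (\<lambda>x. wgrad \<phi> x $ i)"
  let ?q = "\<lambda>x. \<Sum>i\<in>UNIV. ?G i x $ i"
  have li: "locally_integrable (wgrad \<phi>)" "\<And>i. locally_integrable (\<lambda>x. wgrad \<phi> x $ i)" "\<And>i. locally_integrable (?G i)"
    using H(1) G(1) by (auto simp: is_weak_grad_def)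
  have "is_weak_div (wgrad \<phi>) ?q"
    unfolding is_weak_div_def
  proof (intro conjI allI impI)
    show "locally_integrable (wgrad \<phi>)" by fact
    show "locally_integrable ?q"
      unfolding locally_integrable_def
    proof (intro allI impI)
      fix C :: "(real^'n) set" assume "compact C"
      then show "?q absolutely_integrable_on C"
        using locally_integrable_nth[OF li(3)]
        by (intro absolutely_integrable_sum) (auto simp: locally_integrable_def)
    qed
    fix \<psi> :: "real^'n \<Rightarrow> real" assume \<psi>: "test_function \<psi>"
    have i1: "integrable lebesgue (\<lambda>x. (wgrad \<phi> x $ i *\<^sub>R grad \<psi> x) $ i)" for i
      by (intro integrable_bounded_linear[OF bounded_linear_vec_nth] integrable_scaleR_grad \<psi> li)
    have i2: "integrable lebesgue (\<lambda>x. (\<psi> x *\<^sub>R ?G i x) $ i)" for i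
      by (intro integrable_bounded_linear[OF bounded_linear_vec_nth] integrable_test_scaleR \<psi> li)
    have "(\<integral>x. wgrad \<phi> x \<bullet> grad \<psi> x \<partial>lebesgue) = (\<integral>x. (\<Sum>i\<in>UNIV. (wgrad \<phi> x $ i *\<^sub>R grad \<psi> x) $ i) \<partial>lebesgue)"
      by (simp add: inner_vec_def)
    also have "\<dots> = (\<Sum>i\<in>UNIV. \<integral>x. (wgrad \<phi> x $ i *\<^sub>R grad \<psi> x) $ i \<partial>lebesgue)"
      by (rule Bochner_Integration.integral_sum) (rule i1)
    also have "\<dots> = (\<Sum>i\<in>UNIV. (\<integral>x. wgrad \<phi> x $ i *\<^sub>R grad \<psi> x \<partial>lebesgue) $ i)"
      by (intro sum.cong refl integral_bounded_linear[OF bounded_linear_vec_nth] integrable_scaleR_grad \<psi> li)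
    also have "\<dots> = (\<Sum>i\<in>UNIV. - (\<integral>x. \<psi> x *\<^sub>R ?G i x \<partial>lebesgue) $ i)"
      using G(1) \<psi> by (simp add: is_weak_grad_def)
    also have "\<dots> = (\<Sum>i\<in>UNIV. - (\<integral>x. (\<psi> x *\<^sub>R ?G i x) $ i \<partial>lebesgue))"
      by (intro sum.cong refl arg_cong[where f = uminus] integral_bounded_linear[OF bounded_linear_vec_nth, symmetric]
          integrable_test_scaleR \<psi> li)
    also have "\<dots> = - (\<integral>x. (\<Sum>i\<in>UNIV. (\<psi> x *\<^sub>R ?G i x) $ i) \<partial>lebesgue)"
      using i2 by (subst Bochner_Integration.integral_sum) (simp_all add: sum_negf)
    also have "\<dots> = - (\<integral>x. ?q x * \<psi> x \<partial>lebesgue)"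
      by (simp add: sum_distrib_left mult.commute)
    finally show "(\<integral>x. wgrad \<phi> x \<bullet> grad \<psi> x \<partial>lebesgue) = - (\<integral>x. ?q x * \<psi> x \<partial>lebesgue)" .
  qed
  note div = this
  have "is_weak_div (wgrad \<phi>) (wlaplacian \<phi>)"
    unfolding wlaplacian_def wdiv_def by (rule someI[of "is_weak_div (wgrad \<phi>)", OF div])
  note div' = this
  show ?thesis
  proof (rule L2_cong_AE)
    have "(\<lambda>x. \<Sum>i\<in>A. ?G i x $ i) \<in> L2 (box a b)" if "finite A" for A
      using that
    proof induction
      case empty
      show ?case using H1per_weak_grad(3)[OF zero_in_H1per] by simp
    next
      case (insert i A)
      with L2_add_scaled[OF L2_nth[OF G(2)] insert(3), of i i 1] show ?case by simp
    qed
    then show "?q \<in> L2 (box a b)" by simp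
    show "wlaplacian \<phi> \<in> borel_measurable (lebesgue_on (box a b))"
      using div' by (intro measurable_restrict_space1 locally_integrable_measurable) (simp add: is_weak_div_def)
    show "AE x in lebesgue_on (box a b). ?q x = wlaplacian \<phi> x"
      using is_weak_div_unique[OF div div'] by (intro AE_lebesgue_on) auto
  qed
qed

theorem theorem3p1:
  fixes a b :: "real^'n"
    and \<delta>t \<epsilon> lam K D S\<^sub>1 S\<^sub>2 B :: real
    and \<tau> p p' :: "real \<Rightarrow> real"
    and \<kappa> :: "real^'n \<Rightarrow> real" and H :: "real^'n \<Rightarrow> real^'n"
    and \<phi>\<^sub>n \<phi>\<^sub>p U\<^sub>n U\<^sub>p u\<^sub>n u\<^sub>p \<phi>s Zs A\<^sub>1 f\<^sub>1 f\<^sub>2 :: "real^'n \<Rightarrow> real"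
  assumes dim: "CARD('n) = 2 \<or> CARD('n) = 3"
    and cell: "\<And>i. a $ i < b $ i"
    and params: "\<delta>t > 0" "\<epsilon> > 0" "lam > 0" "K > 0" "D > 0" "S\<^sub>1 > 0" "S\<^sub>2 > 0"
    and mobility: "continuous_on UNIV \<tau>" "\<And>s. \<tau> s > 0"
    and p_deriv: "\<And>s. (p has_real_derivative p' s) (at s)" "continuous_on UNIV p'"
    and anisotropy: "\<And>\<xi>. \<xi> \<noteq> 0 \<Longrightarrow> GDERIV \<kappa> \<xi> :> H \<xi>"
    and previous_steps: "\<phi>\<^sub>n \<in> H2per a b" "\<phi>\<^sub>p \<in> H2per a b"
      "U\<^sub>n \<in> L2 (box a b)" "U\<^sub>p \<in> L2 (box a b)"
      "u\<^sub>n \<in> H1per a b" "u\<^sub>p \<in> H1per a b"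
    and \<phi>s: "\<phi>s = (\<lambda>x. 2 * \<phi>\<^sub>n x - \<phi>\<^sub>p x)"
    and Zs: "Zs = Z_aniso \<kappa> H \<epsilon> B \<phi>s"
    and radicand_pos: "AE x in lebesgue. radicand \<kappa> \<epsilon> B \<phi>s x > 0"
    and flux_div: "\<exists>q. is_weak_div (\<lambda>x. flux \<kappa> H (wgrad \<phi>s x)) q"
    and Zs_products: "\<And>w. w \<in> H1per a b \<Longrightarrow> (\<lambda>x. Zs x * w x) \<in> L2 (box a b)"
    and A\<^sub>1: "A\<^sub>1 = (\<lambda>x. (4 * U\<^sub>n x - U\<^sub>p x) / 3 - 1/2 * Zs x * ((4 * \<phi>\<^sub>n x - \<phi>\<^sub>p x) / 3))"
    and f\<^sub>1: "f\<^sub>1 = (\<lambda>x. \<tau> (\<phi>s x) * ((4 * \<phi>\<^sub>n x - \<phi>\<^sub>p x) / (2 * \<delta>t))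
        + S\<^sub>1 / \<epsilon>\<^sup>2 * (2 * \<phi>\<^sub>n x - \<phi>\<^sub>p x)
        - S\<^sub>2 * wlaplacian (\<lambda>y. 2 * \<phi>\<^sub>n y - \<phi>\<^sub>p y) x
        - Zs x * A\<^sub>1 x)"
    and f\<^sub>2: "f\<^sub>2 = (\<lambda>x. lam / (\<epsilon> * K) * ((4 * u\<^sub>n x - u\<^sub>p x) / 3)
        - lam / \<epsilon> * p' (\<phi>s x) * ((4 * \<phi>\<^sub>n x - \<phi>\<^sub>p x) / 3))"
  shows "\<exists>\<phi> u. solves_variational_problem a b \<delta>t \<epsilon> lam K D S\<^sub>1 S\<^sub>2
             (\<lambda>x. \<tau> (\<phi>s x)) Zs (\<lambda>x. p' (\<phi>s x)) f\<^sub>1 f\<^sub>2 \<phi> u \<and>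
           (\<forall>\<phi>' u'. solves_variational_problem a b \<delta>t \<epsilon> lam K D S\<^sub>1 S\<^sub>2
               (\<lambda>x. \<tau> (\<phi>s x)) Zs (\<lambda>x. p' (\<phi>s x)) f\<^sub>1 f\<^sub>2 \<phi>' u' \<longrightarrow>
             (AE x in lebesgue. \<phi>' x = \<phi> x \<and> u' x = u x))"
proof -
  have dim3: "CARD('n) \<le> 3" using dim by auto
  have \<phi>s2: "\<phi>s \<in> H2per a b"
    using H2per_add_scaled[OF H2per_add_scaled[OF previous_steps(1,1), of 1] previous_steps(2), of "-1"]
    by (simp add: \<phi>s)
  note \<tau>s = H2per_compose_bounded[OF dim3 cell \<phi>s2 mobility(1)]
  note dps = H2per_compose_bounded[OF dim3 cell \<phi>s2 p_deriv(2)]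
  obtain M where M: "AE x in lebesgue_on (box a b). \<bar>\<tau> (\<phi>s x)\<bar> \<le> M" using \<tau>s(2) by blast
  obtain M' where M': "AE x in lebesgue_on (box a b). \<bar>p' (\<phi>s x)\<bar> \<le> M'" using dps(2) by blast
  have \<phi>H1: "\<phi>\<^sub>n \<in> H1per a b" "\<phi>\<^sub>p \<in> H1per a b" using previous_steps by (simp_all add: H2per_def)
  note \<phi>L2 = H1per_weak_grad(3)[OF \<phi>H1(1)] H1per_weak_grad(3)[OF \<phi>H1(2)]
  note uL2 = H1per_weak_grad(3)[OF previous_steps(5)] H1per_weak_grad(3)[OF previous_steps(6)]
  \<comment> \<open>This combination lies in \<open>H1per\<close>, so \<open>Zs * ?w\<close> is
    square integrable by the hypothesis on products, and with it \<open>A\<^sub>1\<close>.\<close>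
  let ?w = "\<lambda>x. 4/3 * \<phi>\<^sub>n x + (- 1/3) * \<phi>\<^sub>p x"
  have w: "?w \<in> H1per a b" by (rule H1per_lincomb[OF \<phi>H1])
  note wL2 = H1per_weak_grad(3)[OF w]
  \<comment> \<open>\<open>?h\<close> collects all of \<open>f\<^sub>1\<close> except
    \<open>Zs * A\<^sub>1\<close>, arranged as nested linear combinations. The factor 3 undoes the
    denominator in \<open>?w\<close>.\<close>
  let ?h = "\<lambda>x. 1 * (3 / (2 * \<delta>t) * (\<tau> (\<phi>s x) * ?w x) + S\<^sub>1 / \<epsilon>\<^sup>2 * \<phi>s x) + (- S\<^sub>2) * wlaplacian \<phi>s x"
  have "\<phi>s \<in> L2 (box a b)" using \<phi>s2 by (simp add: H2per_def H1per_weak_grad(3))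
  then have h: "?h \<in> L2 (box a b)"
    by (intro L2_lincomb wlaplacian_L2 \<phi>s2 L2_bounded_mult(1)[OF \<tau>s(1) M wL2])
  have A: "A\<^sub>1 \<in> L2 (box a b)"
  proof -
    have "(\<lambda>x. 1 * (4/3 * U\<^sub>n x + (- 1/3) * U\<^sub>p x) + (- 1/2) * (Zs x * ?w x)) \<in> L2 (box a b)"
      by (intro L2_lincomb previous_steps Zs_products w)
    moreover have "A\<^sub>1 = (\<lambda>x. 1 * (4/3 * U\<^sub>n x + (- 1/3) * U\<^sub>p x) + (- 1/2) * (Zs x * ?w x))"
      by (simp add: A\<^sub>1 fun_eq_iff field_simps)
    ultimately show ?thesis by simp
  qed
  have f1: "f\<^sub>1 = (\<lambda>x. ?h x - Zs x * A\<^sub>1 x)"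
  proof
    fix x
    have "\<tau> (\<phi>s x) * ((4 * \<phi>\<^sub>n x - \<phi>\<^sub>p x) / (2 * \<delta>t)) = 3 / (2 * \<delta>t) * (\<tau> (\<phi>s x) * ?w x)"
      using params(1) by (simp add: field_simps)
    moreover have "f\<^sub>1 x = \<tau> (\<phi>s x) * ((4 * \<phi>\<^sub>n x - \<phi>\<^sub>p x) / (2 * \<delta>t)) + S\<^sub>1 / \<epsilon>\<^sup>2 * \<phi>s x
        - S\<^sub>2 * wlaplacian \<phi>s x - Zs x * A\<^sub>1 x"
      unfolding f\<^sub>1 \<phi>s by simp
    ultimately show "f\<^sub>1 x = ?h x - Zs x * A\<^sub>1 x" by simp
  qed
  have f2: "f\<^sub>2 \<in> L2 (box a b)"
  proof -
    have "(\<lambda>x. lam / (\<epsilon> * K) * (4/3 * u\<^sub>n x + (- 1/3) * u\<^sub>p x) + (- lam / \<epsilon>) * (p' (\<phi>s x) * ?w x)) \<in> L2 (box a b)"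
      by (intro L2_lincomb uL2 L2_bounded_mult(1)[OF dps(1) M' wL2])
    moreover have "f\<^sub>2 = (\<lambda>x. lam / (\<epsilon> * K) * (4/3 * u\<^sub>n x + (- 1/3) * u\<^sub>p x) + (- lam / \<epsilon>) * (p' (\<phi>s x) * ?w x))"
    proof
      fix x
      have "(4 * u\<^sub>n x - u\<^sub>p x) / 3 = 4/3 * u\<^sub>n x + (- 1/3) * u\<^sub>p x" "(4 * \<phi>\<^sub>n x - \<phi>\<^sub>p x) / 3 = ?w x"
        by simp_all
      then show "f\<^sub>2 x = lam / (\<epsilon> * K) * (4/3 * u\<^sub>n x + (- 1/3) * u\<^sub>p x) + (- lam / \<epsilon>) * (p' (\<phi>s x) * ?w x)"
        unfolding f\<^sub>2 by (simp only:)
    qed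
    ultimately show ?thesis by simp
  qed
  show ?thesis
    by (rule variational_problem_well_posed[OF cell params \<tau>s(1) _ M dps(1) M' Zs_products h A f1 f2])
      (simp add: mobility(2) less_imp_le)
qed

end
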